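(* Let $E$ be a locally complete lcHs with a fundamental sequence of bounded sets and let $Z$ be an $(LB)$-space. Suppose that one of the following assumptions is satisfied: (a) $E\cong k^{\infty}(A)$ for some $A$; (b) $E$ is an $(LN)$-space; (c) $Z\cong k^{1}(A)$ for some $A$; (d) $Z$ is an $(LN)$-space. If $E$ satisfies condition $(\mathrm{A})$ and $Z$ satisfies condition $(\mathrm{D}\Omega)$, then $Z$ is weakly $E$-acyclic.
   Context: All vector spaces are over $\mathbb{C}$; lcHs means locally convex Hausdorff space; $L(X,Y)$ is the space of continuous linear maps $X\to Y$; $\cong$ means isomorphic as locally convex spaces. A lcHs $E$ is locally complete if every bounded subset is contained in a Banach disk, i.e. an absolutely convex bounded set $B$ such that its linear span $E_B$, normed by the Minkowski functional of $B$, is complete. A fundamental sequence of bounded sets is a sequence of bounded sets $(B_N)_{N\in\mathbb{N}}$ such that every bounded set is contained in some $B_N$; it may be taken increasing. An inductive spectrum of Banach spaces is a sequence $(Z_n)_{n\in\mathbb{N}}$ of Banach spaces with $Z_n\subseteq Z_{n+1}$ and continuous inclusions; $\operatorname{Ind}(Z_n)_{n}$ is $\bigcup_n Z_n$ with the finest locally convex topology making all inclusions continuous. An $(LB)$-space is a Hausdorff locally convex space equal to such an inductive limit. An $(LN)$-space is a lcHs of the form $\operatorname{Ind}(X_n)_n$ for an inductive spectrum of Banach spaces with nuclear inclusion maps $X_n\to X_{n+1}$. $k^p(A)$ ($p=1,\infty$): $I$ is an arbitrary index set, $A=(a_{n,j})_{n\in\mathbb{N},j\in I}$ consists of positive reals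 with $a_{n+1,j}\le a_{n,j}$, $\ell^p(a_n)=\{c\in\mathbb{C}^I : \|(a_{n,j}c_j)_{j}\|_{\ell^p(I)}<\infty\}$, and $k^p(A)=\operatorname{Ind}(\ell^p(a_n))_{n\in\mathbb{N}}$. Condition $(\mathrm{A})$ for $E$, with $(B_N)_N$ an increasing fundamental sequence of bounded sets (the choice is immaterial): $\exists N\ \forall M\ge N\ \forall\nu>0\ \exists K\ge M,\ C>0\ \forall r>0:\ B_M\subseteq rB_K+\frac{C}{r^{\nu}}B_N$. Condition $(\mathrm{D}\Omega)$ for $Z=\operatorname{Ind}(Z_n)_n$, with $(Z_n)_n$ an inductive spectrum of Banach spaces (the choice is immaterial): $\forall n\ \exists m\ge n\ \forall k\ge m\ \exists\theta\in(0,1),\ C>0:\ \|z\|_{Z_m}\le C\|z\|_{Z_n}^{\theta}\|z\|_{Z_k}^{1-\theta}$ for all $z\in Z_n$. A sequence $0\to X\xrightarrow{\iota}Y\xrightarrow{Q}Z\to0$ of lcHs is exact if $\iota,Q$ are continuous linear and the sequence is algebraically exact. $Z$ is weakly $E$-acyclic if for every exact sequence $0\to X\xrightarrow{\iota}Y\to Z\to0$ of $(LB)$-spaces the map $L(Y,E)\to L(X,E)$, $T\mapsto T\circ\iota$, is surjective. *)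

theory Defs
  imports "HOL-Analysis.Analysis" "HOL-Library.Function_Algebras"
begin

section \<open>Complex vector spaces\<close>

text \<open>
  A complex vector space is a complex linear subspace of a type of class
  \<open>complex_vector\<close>; a topological vector space is a value of type \<^typ>\<open>'a topology\<close>
  whose \<^const>\<open>topspace\<close> is such a subspace. Functions between such spaces only matter on
  the \<^const>\<open>topspace\<close> of their domain.
\<close>

class complex_vector = ab_group_add +
  fixes scaleC :: "complex \<Rightarrow> 'a \<Rightarrow> 'a"  (infixr \<open>*\<^sub>C\<close> 75)
  assumes scaleC_add_right: "a *\<^sub>C (x + y) = a *\<^sub>C x + a *\<^sub>C y"
    and scaleC_add_left: "(a + b) *\<^sub>C x = a *\<^sub>C x + b *\<^sub>C x"
    and scaleC_scaleC: "a *\<^sub>C b *\<^sub>C x = (a * b) *\<^sub>C x"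
    and scaleC_one: "1 *\<^sub>C x = x"

interpretation cvs: vector_space "scaleC :: complex \<Rightarrow> 'a \<Rightarrow> 'a::complex_vector"
  by unfold_locales (simp_all add: scaleC_add_right scaleC_add_left scaleC_scaleC scaleC_one)

instantiation complex :: complex_vector
begin
definition scaleC_complex :: "complex \<Rightarrow> complex \<Rightarrow> complex" where "scaleC_complex a z = a * z"
instance by standard (simp_all add: scaleC_complex_def algebra_simps)
end

instantiation "fun" :: (type, complex_vector) complex_vector
begin
definition scaleC_fun :: "complex \<Rightarrow> ('a \<Rightarrow> 'b) \<Rightarrow> 'a \<Rightarrow> 'b"
  where "scaleC_fun a f = (\<lambda>j. a *\<^sub>C f j)"
instance
  by standard
    (simp_all add: scaleC_fun_def fun_eq_iff scaleC_add_right scaleC_add_left scaleC_scaleC scaleC_one)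
end

definition linear_on :: "'a::complex_vector set \<Rightarrow> ('a \<Rightarrow> 'b::complex_vector) \<Rightarrow> bool" where
  "linear_on S f \<longleftrightarrow>
     (\<forall>x\<in>S. \<forall>y\<in>S. f (x + y) = f x + f y) \<and> (\<forall>c. \<forall>x\<in>S. f (c *\<^sub>C x) = c *\<^sub>C f x)"

definition cconvex :: "'a::complex_vector set \<Rightarrow> bool" where
  "cconvex U \<longleftrightarrow> (\<forall>x\<in>U. \<forall>y\<in>U. \<forall>t\<in>{0..1::real}.
     complex_of_real (1 - t) *\<^sub>C x + complex_of_real t *\<^sub>C y \<in> U)"

definition absolutely_convex :: "'a::complex_vector set \<Rightarrow> bool" where
  "absolutely_convex B \<longleftrightarrow> B \<noteq> {} \<and>
     (\<forall>x\<in>B. \<forall>y\<in>B. \<forall>a b. cmod a + cmod b \<le> 1 \<longrightarrow> a *\<^sub>C x + b *\<^sub>C y \<in> B)"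

definition scale_set :: "real \<Rightarrow> 'a::complex_vector set \<Rightarrow> 'a set" where
  "scale_set r B = (\<lambda>x. complex_of_real r *\<^sub>C x) ` B"


section \<open>Locally convex spaces\<close>

definition locally_convex :: "'a::complex_vector topology \<Rightarrow> bool" where
  "locally_convex T \<longleftrightarrow>
     cvs.subspace (topspace T) \<and>
     continuous_map (prod_topology T T) T (\<lambda>(x, y). x + y) \<and>
     continuous_map (prod_topology euclidean T) T (\<lambda>(c, x). c *\<^sub>C x) \<and>
     (\<forall>U. openin T U \<and> 0 \<in> U \<longrightarrow> (\<exists>V. openin T V \<and> 0 \<in> V \<and> cconvex V \<and> V \<subseteq> U))"

definition lcHs :: "'a::complex_vector topology \<Rightarrow> bool" where
  "lcHs T \<longleftrightarrow> locally_convex T \<and> Hausdorff_space T"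

text \<open>The space \<open>L(X, Y)\<close>; \<^const>\<open>continuous_map\<close> includes that \<open>f\<close> maps \<open>X\<close> into \<open>Y\<close>.\<close>

definition clinear_maps ::
    "'a::complex_vector topology \<Rightarrow> 'b::complex_vector topology \<Rightarrow> ('a \<Rightarrow> 'b) set" where
  "clinear_maps X Y = {f. linear_on (topspace X) f \<and> continuous_map X Y f}"

definition lc_isomorphic ::
    "'a::complex_vector topology \<Rightarrow> 'b::complex_vector topology \<Rightarrow> bool" where
  "lc_isomorphic X Y \<longleftrightarrow> (\<exists>f. linear_on (topspace X) f \<and> homeomorphic_map X Y f)"

definition bounded_in :: "'a::complex_vector topology \<Rightarrow> 'a set \<Rightarrow> bool" where
  "bounded_in T B \<longleftrightarrow> B \<subseteq> topspace T \<and>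
     (\<forall>U. openin T U \<and> 0 \<in> U \<longrightarrow> (\<exists>r>0. B \<subseteq> scale_set r U))"


section \<open>Normed and Banach spaces as subspaces\<close>

definition norm_on :: "'a::complex_vector set \<Rightarrow> ('a \<Rightarrow> real) \<Rightarrow> bool" where
  "norm_on S p \<longleftrightarrow> cvs.subspace S \<and>
     (\<forall>x\<in>S. 0 \<le> p x \<and> (p x = 0 \<longleftrightarrow> x = 0)) \<and>
     (\<forall>c. \<forall>x\<in>S. p (c *\<^sub>C x) = cmod c * p x) \<and>
     (\<forall>x\<in>S. \<forall>y\<in>S. p (x + y) \<le> p x + p y)"

definition banach_on :: "'a::complex_vector set \<Rightarrow> ('a \<Rightarrow> real) \<Rightarrow> bool" where
  "banach_on S p \<longleftrightarrow> norm_on S p \<and>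
     (\<forall>u::nat \<Rightarrow> 'a. range u \<subseteq> S \<and> (\<forall>e>0. \<exists>M. \<forall>m\<ge>M. \<forall>n\<ge>M. p (u m - u n) < e)
        \<longrightarrow> (\<exists>x\<in>S. (\<lambda>n. p (u n - x)) \<longlonglongrightarrow> 0))"

definition norm_topology :: "'a::complex_vector set \<Rightarrow> ('a \<Rightarrow> real) \<Rightarrow> 'a topology" where
  "norm_topology S p =
     topology (\<lambda>U. U \<subseteq> S \<and> (\<forall>x\<in>U. \<exists>e>0. \<forall>y\<in>S. p (y - x) < e \<longrightarrow> y \<in> U))"

lemma openin_norm_topology:
  "openin (norm_topology S p) U \<longleftrightarrow>
     U \<subseteq> S \<and> (\<forall>x\<in>U. \<exists>e>0. \<forall>y\<in>S. p (y - x) < e \<longrightarrow> y \<in> U)"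
proof -
  let ?P = "\<lambda>U. U \<subseteq> S \<and> (\<forall>x\<in>U. \<exists>e>0. \<forall>y\<in>S. p (y - x) < e \<longrightarrow> y \<in> U)"
  have "?P (U \<inter> V)" if UV: "?P U" "?P V" for U V
  proof (intro conjI ballI)
    show "U \<inter> V \<subseteq> S" using that by blast
    fix x assume "x \<in> U \<inter> V"
    then obtain d e where "d > 0" "\<forall>y\<in>S. p (y - x) < d \<longrightarrow> y \<in> U"
      "e > 0" "\<forall>y\<in>S. p (y - x) < e \<longrightarrow> y \<in> V"
      using UV by blast
    then show "\<exists>e>0. \<forall>y\<in>S. p (y - x) < e \<longrightarrow> y \<in> U \<inter> V"
      by (intro exI[of _ "min d e"]) auto
  qed
  moreover have "?P (\<Union>K)" if K: "\<forall>U\<in>K. ?P U" for K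
  proof (intro conjI ballI)
    show "\<Union>K \<subseteq> S" using that by blast
    fix x assume "x \<in> \<Union>K"
    then obtain U where U: "U \<in> K" "x \<in> U" by blast
    then obtain e where "e > 0" "\<forall>y\<in>S. p (y - x) < e \<longrightarrow> y \<in> U" using K by blast
    then show "\<exists>e>0. \<forall>y\<in>S. p (y - x) < e \<longrightarrow> y \<in> \<Union>K" using U by blast
  qed
  ultimately have "istopology ?P" unfolding istopology_def by simp
  then show ?thesis unfolding norm_topology_def by (simp add: topology_inverse')
qed

lemma topspace_norm_topology [simp]: "topspace (norm_topology S p) = S"
proof (rule antisym)
  show "topspace (norm_topology S p) \<subseteq> S"
    using openin_topspace[of "norm_topology S p"] unfolding openin_norm_topology by blast
  have "openin (norm_topology S p) S"
    by (auto simp: openin_norm_topology intro: exI[of _ "1::real"])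
  then show "S \<subseteq> topspace (norm_topology S p)" by (rule openin_subset)
qed

definition minkowski :: "'a::complex_vector set \<Rightarrow> 'a \<Rightarrow> real" where
  "minkowski B x = Inf {t. 0 < t \<and> x \<in> scale_set t B}"

definition banach_disk :: "'a::complex_vector topology \<Rightarrow> 'a set \<Rightarrow> bool" where
  "banach_disk T B \<longleftrightarrow>
     absolutely_convex B \<and> bounded_in T B \<and> banach_on (cvs.span B) (minkowski B)"

definition locally_complete :: "'a::complex_vector topology \<Rightarrow> bool" where
  "locally_complete T \<longleftrightarrow> (\<forall>B. bounded_in T B \<longrightarrow> (\<exists>D. banach_disk T D \<and> B \<subseteq> D))"

definition fundamental_bounded :: "'a::complex_vector topology \<Rightarrow> (nat \<Rightarrow> 'a set) \<Rightarrow> bool" where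
  "fundamental_bounded T B \<longleftrightarrow>
     (\<forall>N. bounded_in T (B N)) \<and> (\<forall>D. bounded_in T D \<longrightarrow> (\<exists>N. D \<subseteq> B N))"

text \<open>Nuclear maps \<open>(S, p) \<rightarrow> (S', p')\<close> between Banach spaces: \<open>f = \<Sum>k. \<phi>\<^sub>k(\<cdot>) y\<^sub>k\<close> with
  \<open>\<Sum>k. \<parallel>\<phi>\<^sub>k\<parallel> \<parallel>y\<^sub>k\<parallel> < \<infinity>\<close>, where the \<open>\<phi>\<^sub>k\<close> are in the dual of \<open>(S, p)\<close>.\<close>

definition dual_on :: "'a::complex_vector set \<Rightarrow> ('a \<Rightarrow> real) \<Rightarrow> ('a \<Rightarrow> complex) set" where
  "dual_on S p = {\<phi>. linear_on S \<phi> \<and> (\<exists>C. \<forall>x\<in>S. cmod (\<phi> x) \<le> C * p x)}"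

definition dual_norm :: "'a::complex_vector set \<Rightarrow> ('a \<Rightarrow> real) \<Rightarrow> ('a \<Rightarrow> complex) \<Rightarrow> real" where
  "dual_norm S p \<phi> = Inf {C. 0 \<le> C \<and> (\<forall>x\<in>S. cmod (\<phi> x) \<le> C * p x)}"

definition nuclear_on :: "'a::complex_vector set \<Rightarrow> ('a \<Rightarrow> real) \<Rightarrow>
    'b::complex_vector set \<Rightarrow> ('b \<Rightarrow> real) \<Rightarrow> ('a \<Rightarrow> 'b) \<Rightarrow> bool" where
  "nuclear_on S p S' p' f \<longleftrightarrow> (\<exists>(\<phi> :: nat \<Rightarrow> 'a \<Rightarrow> complex) (y :: nat \<Rightarrow> 'b).
     (\<forall>k. \<phi> k \<in> dual_on S p \<and> y k \<in> S') \<and>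
     summable (\<lambda>k. dual_norm S p (\<phi> k) * p' (y k)) \<and>
     (\<forall>x\<in>S. f x \<in> S' \<and> (\<lambda>n. p' (f x - (\<Sum>k<n. \<phi> k x *\<^sub>C y k))) \<longlonglongrightarrow> 0))"


section \<open>Inductive limits of Banach spaces\<close>

definition banach_spectrum ::
    "(nat \<Rightarrow> 'a::complex_vector set) \<Rightarrow> (nat \<Rightarrow> 'a \<Rightarrow> real) \<Rightarrow> bool" where
  "banach_spectrum S p \<longleftrightarrow> (\<forall>n. banach_on (S n) (p n) \<and> S n \<subseteq> S (Suc n) \<and>
     continuous_map (norm_topology (S n) (p n)) (norm_topology (S (Suc n)) (p (Suc n))) (\<lambda>x. x))"

definition ind_candidate :: "(nat \<Rightarrow> 'a::complex_vector set) \<Rightarrow> (nat \<Rightarrow> 'a \<Rightarrow> real) \<Rightarrow>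
    'a topology \<Rightarrow> bool" where
  "ind_candidate S p T \<longleftrightarrow> locally_convex T \<and> topspace T = (\<Union>n. S n) \<and>
     (\<forall>n. continuous_map (norm_topology (S n) (p n)) T (\<lambda>x. x))"

text \<open>The supremum of all candidate topologies. It is itself a candidate, and hence the finest
  one; see \<open>Ind_candidate\<close> and \<open>Ind_finest\<close>.\<close>

definition Ind :: "(nat \<Rightarrow> 'a::complex_vector set) \<Rightarrow> (nat \<Rightarrow> 'a \<Rightarrow> real) \<Rightarrow> 'a topology" where
  "Ind S p = topology_generated_by {U. \<exists>T. ind_candidate S p T \<and> openin T U}"

lemma Ind_finest:
  assumes "ind_candidate S p T" "openin T U"
  shows "openin (Ind S p) U"
  unfolding Ind_def using assms by (blast intro: topology_generated_by_Basis)

lemma Ind_candidate: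
  assumes sub: "\<And>n. cvs.subspace (S n)" and inc: "\<And>n. S n \<subseteq> S (Suc n)"
  shows "ind_candidate S p (Ind S p)"
proof -
  let ?V = "\<Union>n. S n"
  let ?G = "{U. \<exists>T. ind_candidate S p T \<and> openin T U}"
  have mono: "S m \<subseteq> S n" if "m \<le> n" for m n using inc that by (rule lift_Suc_mono_le)
  have subV: "cvs.subspace ?V"
  proof (rule cvs.subspaceI)
    show "0 \<in> ?V" using sub cvs.subspace_0 by blast
  next
    fix x y assume "x \<in> ?V" "y \<in> ?V"
    then obtain m n where "x \<in> S m" "y \<in> S n" by blast
    then have "x \<in> S (max m n)" "y \<in> S (max m n)"
      using mono[of m "max m n"] mono[of n "max m n"] by auto
    then show "x + y \<in> ?V" using sub cvs.subspace_add by blast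
  next
    fix c x assume "x \<in> ?V"
    then show "c *\<^sub>C x \<in> ?V" using sub cvs.subspace_scale by blast
  qed
  let ?T0 = "topology (\<lambda>U. U = {} \<or> U = ?V)"
  have "istopology (\<lambda>U. U = {} \<or> U = ?V)" unfolding istopology_def by blast
  then have o0: "openin ?T0 U \<longleftrightarrow> U = {} \<or> U = ?V" for U by (simp add: topology_inverse')
  have t0: "topspace ?T0 = ?V" using o0 unfolding topspace_def by blast
  have triv: "continuous_map X ?T0 f" if "\<And>x. x \<in> topspace X \<Longrightarrow> f x \<in> ?V"
    for X :: "'b topology" and f
  proof -
    have "{x \<in> topspace X. f x \<in> ?V} = topspace X" using that by blast
    then show ?thesis unfolding continuous_map_def t0 o0 using that by auto
  qed
  have "cconvex ?V" unfolding cconvex_def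
  proof (intro ballI)
    fix x y and t :: real assume "x \<in> ?V" "y \<in> ?V"
    then show "complex_of_real (1 - t) *\<^sub>C x + complex_of_real t *\<^sub>C y \<in> ?V"
      by (intro cvs.subspace_add[OF subV] cvs.subspace_scale[OF subV])
  qed
  then have cV: "\<exists>V. openin ?T0 V \<and> 0 \<in> V \<and> cconvex V \<and> V \<subseteq> U" if "openin ?T0 U" "0 \<in> U" for U
    using that unfolding o0 by blast
  have "continuous_map (prod_topology ?T0 ?T0) ?T0 (\<lambda>(x, y). x + y)"
  proof (rule triv)
    fix z assume "z \<in> topspace (prod_topology ?T0 ?T0)"
    then have "fst z \<in> ?V" "snd z \<in> ?V" unfolding topspace_prod_topology t0 by auto
    then have "fst z + snd z \<in> ?V" by (rule cvs.subspace_add[OF subV])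
    then show "(case z of (x, y) \<Rightarrow> x + y) \<in> ?V" by (simp add: split_def)
  qed
  moreover have "continuous_map (prod_topology euclidean ?T0) ?T0 (\<lambda>(c, x). c *\<^sub>C x)"
  proof (rule triv)
    fix z :: "complex \<times> 'a" assume "z \<in> topspace (prod_topology euclidean ?T0)"
    then have "snd z \<in> ?V" unfolding topspace_prod_topology t0 by auto
    then have "fst z *\<^sub>C snd z \<in> ?V" by (rule cvs.subspace_scale[OF subV])
    then show "(case z of (c, x) \<Rightarrow> c *\<^sub>C x) \<in> ?V" by (simp add: split_def)
  qed
  ultimately have "locally_convex ?T0"
    unfolding locally_convex_def t0 using subV cV by blast
  then have c0: "ind_candidate S p ?T0"
    unfolding ind_candidate_def t0 by (auto intro!: triv)
  have UG: "\<Union>?G = ?V"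
  proof
    have "U \<subseteq> ?V" if "ind_candidate S p T" "openin T U" for T U
      using openin_subset[OF that(2)] that(1) unfolding ind_candidate_def by simp
    then show "\<Union>?G \<subseteq> ?V" by blast
    show "?V \<subseteq> \<Union>?G" using c0 o0 by blast
  qed
  have tI: "topspace (Ind S p) = ?V" unfolding Ind_def by (simp add: UG)
  have into: "continuous_map X (Ind S p) f"
    if "\<And>T. ind_candidate S p T \<Longrightarrow> continuous_map X T f" for X :: "'b topology" and f
    unfolding Ind_def
  proof (rule continuous_on_generated_topo)
    fix U assume "U \<in> ?G"
    then obtain T where "ind_candidate S p T" "openin T U" by blast
    then have "openin X {x \<in> topspace X. f x \<in> U}"
      using openin_continuous_map_preimage[OF that] by simp
    moreover have "{x \<in> topspace X. f x \<in> U} = f -` U \<inter> topspace X" by blast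
    ultimately show "openin X (f -` U \<inter> topspace X)" by simp
  next
    show "f ` topspace X \<subseteq> \<Union>?G"
      using continuous_map_image_subset_topspace[OF that[OF c0]] unfolding UG t0 .
  qed
  have idc: "continuous_map (Ind S p) T (\<lambda>x. x)" if "ind_candidate S p T" for T
  proof -
    have tT: "topspace T = ?V" using that unfolding ind_candidate_def by simp
    have "openin (Ind S p) {x \<in> ?V. x \<in> U}" if U: "openin T U" for U
    proof -
      have "{x \<in> ?V. x \<in> U} = U" using openin_subset[OF U] tT by blast
      then show ?thesis using Ind_finest[OF \<open>ind_candidate S p T\<close> U] by simp
    qed
    then show ?thesis unfolding continuous_map_def tI tT by auto
  qed
  have add: "continuous_map (prod_topology (Ind S p) (Ind S p)) (Ind S p) (\<lambda>(x, y). x + y)"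
  proof (rule into)
    fix T assume T: "ind_candidate S p T"
    then have "continuous_map (prod_topology T T) T (\<lambda>(x, y). x + y)"
      unfolding ind_candidate_def locally_convex_def by blast
    moreover have "continuous_map (prod_topology (Ind S p) (Ind S p)) (prod_topology T T)
        (\<lambda>z. (fst z, snd z))"
      using continuous_map_compose[OF continuous_map_fst idc[OF T]]
        continuous_map_compose[OF continuous_map_snd idc[OF T]]
      by (intro continuous_map_pairedI) (simp_all add: o_def)
    ultimately have "continuous_map (prod_topology (Ind S p) (Ind S p)) T
        ((\<lambda>(x, y). x + y) \<circ> (\<lambda>z. (fst z, snd z)))"
      by (rule continuous_map_compose[rotated])
    then show "continuous_map (prod_topology (Ind S p) (Ind S p)) T (\<lambda>(x, y). x + y)"
      by (simp add: o_def split_def)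
  qed
  have scale: "continuous_map (prod_topology euclidean (Ind S p)) (Ind S p) (\<lambda>(c, x). c *\<^sub>C x)"
  proof (rule into)
    fix T assume T: "ind_candidate S p T"
    then have "continuous_map (prod_topology euclidean T) T (\<lambda>(c, x). c *\<^sub>C x)"
      unfolding ind_candidate_def locally_convex_def by blast
    moreover have "continuous_map (prod_topology euclidean (Ind S p)) (prod_topology euclidean T)
        (\<lambda>z :: complex \<times> 'a. (fst z, snd z))"
      using continuous_map_compose[OF continuous_map_snd idc[OF T]]
      by (intro continuous_map_pairedI continuous_map_fst) (simp_all add: o_def)
    ultimately have "continuous_map (prod_topology euclidean (Ind S p)) T
        ((\<lambda>(c, x). c *\<^sub>C x) \<circ> (\<lambda>z. (fst z, snd z)))"
      by (rule continuous_map_compose[rotated])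
    then show "continuous_map (prod_topology euclidean (Ind S p)) T (\<lambda>(c, x). c *\<^sub>C x)"
      by (simp add: o_def split_def)
  qed
  have lc: "0 \<in> U \<longrightarrow> (\<exists>W. openin (Ind S p) W \<and> 0 \<in> W \<and> cconvex W \<and> W \<subseteq> U)"
    if "generate_topology_on ?G U" for U
    using that
  proof (induction rule: generate_topology_on.induct)
    case Empty
    then show ?case by simp
  next
    case (Int a b)
    show ?case
    proof
      assume "0 \<in> a \<inter> b"
      then obtain A B where "openin (Ind S p) A" "0 \<in> A" "cconvex A" "A \<subseteq> a"
        "openin (Ind S p) B" "0 \<in> B" "cconvex B" "B \<subseteq> b"
        using Int.IH by blast
      moreover from \<open>cconvex A\<close> \<open>cconvex B\<close> have "cconvex (A \<inter> B)"
        unfolding cconvex_def by simp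
      ultimately have "openin (Ind S p) (A \<inter> B) \<and> 0 \<in> A \<inter> B \<and> cconvex (A \<inter> B) \<and>
          A \<inter> B \<subseteq> a \<inter> b"
        by (simp add: openin_Int le_infI1 le_infI2)
      then show "\<exists>W. openin (Ind S p) W \<and> 0 \<in> W \<and> cconvex W \<and> W \<subseteq> a \<inter> b" by blast
    qed
  next
    case (UN K)
    show ?case
    proof
      assume "0 \<in> \<Union>K"
      then obtain k where k: "k \<in> K" "0 \<in> k" by blast
      then obtain W where "openin (Ind S p) W" "0 \<in> W" "cconvex W" "W \<subseteq> k"
        using UN.IH by blast
      then show "\<exists>W. openin (Ind S p) W \<and> 0 \<in> W \<and> cconvex W \<and> W \<subseteq> \<Union>K" using k(1) by blast
    qed
  next
    case (Basis U)
    then obtain T where T: "ind_candidate S p T" "openin T U" by blast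
    show ?case
    proof
      assume "0 \<in> U"
      moreover have "locally_convex T" using T(1) by (simp add: ind_candidate_def)
      ultimately obtain W where "openin T W" "0 \<in> W" "cconvex W" "W \<subseteq> U"
        using T(2) unfolding locally_convex_def by meson
      then show "\<exists>W. openin (Ind S p) W \<and> 0 \<in> W \<and> cconvex W \<and> W \<subseteq> U"
        using Ind_finest[OF T(1)] by blast
    qed
  qed
  have "locally_convex (Ind S p)"
    unfolding locally_convex_def
    using add scale subV tI lc by (simp add: Ind_def openin_topology_generated_by_iff)
  moreover have "continuous_map (norm_topology (S n) (p n)) (Ind S p) (\<lambda>x. x)" for n
    by (rule into) (simp add: ind_candidate_def)
  ultimately show ?thesis
    unfolding ind_candidate_def[of S p "Ind S p"] using tI by simp
qed

definition LB_space :: "'a::complex_vector topology \<Rightarrow> bool" where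
  "LB_space T \<longleftrightarrow> lcHs T \<and> (\<exists>S p. banach_spectrum S p \<and> T = Ind S p)"

definition LN_space :: "'a::complex_vector topology \<Rightarrow> bool" where
  "LN_space T \<longleftrightarrow> lcHs T \<and> (\<exists>S p. banach_spectrum S p \<and>
     (\<forall>n. nuclear_on (S n) (p n) (S (Suc n)) (p (Suc n)) (\<lambda>x. x)) \<and> T = Ind S p)"


section \<open>The spaces \<open>k\<^sup>p(A)\<close>\<close>

text \<open>\<open>\<complex>\<^sup>I\<close> is represented by the functions vanishing outside of \<open>I\<close>.\<close>

definition weight_matrix :: "'i set \<Rightarrow> (nat \<Rightarrow> 'i \<Rightarrow> real) \<Rightarrow> bool" where
  "weight_matrix I a \<longleftrightarrow> (\<forall>n. \<forall>j\<in>I. 0 < a n j \<and> a (Suc n) j \<le> a n j)"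

definition l1_space :: "'i set \<Rightarrow> ('i \<Rightarrow> real) \<Rightarrow> ('i \<Rightarrow> complex) set" where
  "l1_space I w = {c. (\<forall>j. j \<notin> I \<longrightarrow> c j = 0) \<and> (\<lambda>j. cmod (w j * c j)) summable_on I}"

definition l1_norm :: "'i set \<Rightarrow> ('i \<Rightarrow> real) \<Rightarrow> ('i \<Rightarrow> complex) \<Rightarrow> real" where
  "l1_norm I w c = infsum (\<lambda>j. cmod (w j * c j)) I"

definition linf_space :: "'i set \<Rightarrow> ('i \<Rightarrow> real) \<Rightarrow> ('i \<Rightarrow> complex) set" where
  "linf_space I w = {c. (\<forall>j. j \<notin> I \<longrightarrow> c j = 0) \<and> bdd_above ((\<lambda>j. cmod (w j * c j)) ` I)}"

text \<open>The inserted \<open>0\<close> only matters for empty \<open>I\<close>.\<close>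

definition linf_norm :: "'i set \<Rightarrow> ('i \<Rightarrow> real) \<Rightarrow> ('i \<Rightarrow> complex) \<Rightarrow> real" where
  "linf_norm I w c = Sup (insert 0 ((\<lambda>j. cmod (w j * c j)) ` I))"

definition k_one :: "'i set \<Rightarrow> (nat \<Rightarrow> 'i \<Rightarrow> real) \<Rightarrow> ('i \<Rightarrow> complex) topology" where
  "k_one I a = Ind (\<lambda>n. l1_space I (a n)) (\<lambda>n. l1_norm I (a n))"

definition k_inf :: "'i set \<Rightarrow> (nat \<Rightarrow> 'i \<Rightarrow> real) \<Rightarrow> ('i \<Rightarrow> complex) topology" where
  "k_inf I a = Ind (\<lambda>n. linf_space I (a n)) (\<lambda>n. linf_norm I (a n))"


section \<open>The conditions \<open>(A)\<close> and \<open>(D\<Omega>)\<close>\<close>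

text \<open>Both conditions are independent of the choice of the fundamental sequence of bounded sets,
  respectively of the defining spectrum; they are required for some choice.\<close>

definition condition_A :: "'a::complex_vector topology \<Rightarrow> bool" where
  "condition_A E \<longleftrightarrow> (\<exists>B. fundamental_bounded E B \<and> (\<forall>N. B N \<subseteq> B (Suc N)) \<and>
     (\<exists>N. \<forall>M\<ge>N. \<forall>\<nu>>0::real. \<exists>K\<ge>M. \<exists>C>0::real. \<forall>r>0::real.
        B M \<subseteq> {x + y | x y. x \<in> scale_set r (B K) \<and> y \<in> scale_set (C / r powr \<nu>) (B N)}))"

definition condition_DOmega :: "'a::complex_vector topology \<Rightarrow> bool" where
  "condition_DOmega Z \<longleftrightarrow> (\<exists>S p. banach_spectrum S p \<and> Z = Ind S p \<and>
     (\<forall>n. \<exists>m\<ge>n. \<forall>k\<ge>m. \<exists>\<theta>\<in>{0<..<1::real}. \<exists>C>0::real. \<forall>z\<in>S n.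
        p m z \<le> C * p n z powr \<theta> * p k z powr (1 - \<theta>)))"


section \<open>Weak acyclicity\<close>

definition exact_seq :: "'x::complex_vector topology \<Rightarrow> ('x \<Rightarrow> 'y::complex_vector) \<Rightarrow>
    'y topology \<Rightarrow> ('y \<Rightarrow> 'z::complex_vector) \<Rightarrow> 'z topology \<Rightarrow> bool" where
  "exact_seq X \<iota> Y Q Z \<longleftrightarrow>
     \<iota> \<in> clinear_maps X Y \<and> Q \<in> clinear_maps Y Z \<and>
     inj_on \<iota> (topspace X) \<and> \<iota> ` topspace X = {y \<in> topspace Y. Q y = 0} \<and>
     Q ` topspace Y = topspace Z"

text \<open>The first two arguments are the types in which the spaces \<open>X\<close> and \<open>Y\<close> of the exact
  sequences live. HOL cannot quantify over types inside a definition, so ``all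
  exact sequences of \<open>(LB)\<close>-spaces'' is expressed by leaving both types arbitrary.\<close>

definition weakly_acyclic :: "'x::complex_vector itself \<Rightarrow> 'y::complex_vector itself \<Rightarrow>
    'e::complex_vector topology \<Rightarrow> 'z::complex_vector topology \<Rightarrow> bool" where
  "weakly_acyclic _ _ E Z \<longleftrightarrow>
     (\<forall>(X :: 'x topology) (Y :: 'y topology) \<iota> Q.
        LB_space X \<and> LB_space Y \<and> LB_space Z \<and> exact_seq X \<iota> Y Q Z \<longrightarrow>
        (\<forall>R\<in>clinear_maps X E. \<exists>T\<in>clinear_maps Y E. \<forall>x\<in>topspace X. T (\<iota> x) = R x))"

end

theory Submission
  imports Defs
begin

text \<open>
  Inside a locally convex space, everything is expressed by its Banach pieces: Banach spaces
  \<open>(F, q)\<close> with \<open>F\<close> a subspace and continuous inclusion. In a locally complete space they are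
  directed and absorb the bounded sets, and a factorization theorem of Grothendieck type makes any
  two exhaustions of the same space by Banach pieces equivalent; this is what makes the choice of
  the spectra immaterial.

  Identify \<open>X\<close> with the kernel of \<open>Q\<close>. In each of the four cases the given operator extends from
  \<open>X \<inter> Y\<^sub>n\<close> to \<open>Y\<^sub>n\<close> for every single \<open>n\<close>: by Hahn--Banach in the cases (a) and (b), and by a
  bounded local right inverse of \<open>Q\<close> in the cases (c) and (d). The extensions for different \<open>n\<close>
  differ by operators that factor through \<open>Z\<^sub>n\<close>, and a Mittag-Leffler argument glues them as soon
  as every bounded operator \<open>Z\<^sub>m \<rightarrow> E\<close> can be approximated by bounded operators \<open>Z\<^sub>k \<rightarrow> E\<close>,
  with an error that on \<open>Z\<^sub>n\<close> is small in one fixed Banach piece of \<open>E\<close>.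

  For rank one operators this approximation is a real interpolation argument: condition \<open>(D\<Omega>)\<close>
  splits the functional, condition \<open>(A)\<close> splits the vector, and balancing the scales of both
  splittings yields convergent series. The four cases are those in which an operator can be
  assembled from rank one operators: nuclear series in (b) and (d), coordinates of \<open>\<ell>\<^sup>1\<close> in (c),
  coordinates of \<open>\<ell>\<^sup>\<infinity>\<close> in (a).
\<close>


section \<open>Norms and absolutely summable families\<close>

text \<open>The exponent s that (D\<Omega>) yields for given n, m, k cannot be controlled, whereas
  (A) holds for every \<nu> > 0 with N fixed beforehand; so \<nu> is chosen after s. At scale 4^-l
  the functional is left with an error of order 4^-l and has norm of order 4^(s l) on
  \<open>S k\<close>. Splitting the vector at r = 4^(-(s+1) l) with \<nu> = 1/(2(s+1)) leaves terms
  of order 4^(s l) 4^(-(s+1) l) = 4^-l in one series and of order 4^-l 2^l = 2^-l in the other. That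
  N comes first is used again in the gluing: infinitely many corrections have to be summed, which
  takes one complete space, the piece attached to B_N, while all other pieces may change from level
  to level. A second obstacle is that \<iota> need not be a topological embedding and that Q need
  not have a continuous linear right inverse. On Banach levels the factorization theorem replaces
  both by lifts that are bounded but not linear; they suffice because they are applied to single
  vectors or followed by operators that forget the choice.\<close>

lemma norm_on_subspace: "norm_on S p \<Longrightarrow> cvs.subspace S"
  by (simp add: norm_on_def)

lemma norm_on_nonneg: "norm_on S p \<Longrightarrow> x \<in> S \<Longrightarrow> 0 \<le> p x"
  by (simp add: norm_on_def)

lemma norm_on_eq_0: "norm_on S p \<Longrightarrow> x \<in> S \<Longrightarrow> p x = 0 \<longleftrightarrow> x = 0"
  by (simp add: norm_on_def)

lemma norm_on_scale: "norm_on S p \<Longrightarrow> x \<in> S \<Longrightarrow> p (c *\<^sub>C x) = cmod c * p x"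
  by (simp add: norm_on_def)

lemma norm_on_add: "norm_on S p \<Longrightarrow> x \<in> S \<Longrightarrow> y \<in> S \<Longrightarrow> p (x + y) \<le> p x + p y"
  by (simp add: norm_on_def)

lemma norm_on_zero: "norm_on S p \<Longrightarrow> p 0 = 0"
  using norm_on_eq_0 norm_on_subspace cvs.subspace_0 by blast

lemma norm_on_minus: "norm_on S p \<Longrightarrow> x \<in> S \<Longrightarrow> p (- x) = p x"
  using norm_on_scale[of S p x "-1"] by (simp add: scaleC_one)

lemma norm_on_diff: "norm_on S p \<Longrightarrow> x \<in> S \<Longrightarrow> y \<in> S \<Longrightarrow> p (x - y) \<le> p x + p y"
  using norm_on_add[of S p x "- y"] norm_on_minus[of S p y] norm_on_subspace[of S p]
    cvs.subspace_neg[of S y] by auto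

lemma norm_on_diff_commute: "norm_on S p \<Longrightarrow> x \<in> S \<Longrightarrow> y \<in> S \<Longrightarrow> p (x - y) = p (y - x)"
  using norm_on_minus[of S p "y - x"] norm_on_subspace[of S p] cvs.subspace_diff[of S y x] by auto

lemma norm_on_triangle:
  assumes "norm_on S p" "x \<in> S" "y \<in> S" "z \<in> S"
  shows "p (x - z) \<le> p (x - y) + p (y - z)"
  using norm_on_add[OF assms(1), of "x - y" "y - z"] assms
    cvs.subspace_diff[OF norm_on_subspace[OF assms(1)]] by auto

lemma norm_on_sum:
  assumes "norm_on S p" "\<And>j. j \<in> A \<Longrightarrow> u j \<in> S"
  shows "p (sum u A) \<le> (\<Sum>j\<in>A. p (u j))"
  using assms(2)
proof (induction A rule: infinite_finite_induct)
  case (insert a A)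
  have "sum u A \<in> S"
    using insert.prems by (intro cvs.subspace_sum[OF norm_on_subspace[OF assms(1)]]) auto
  then have "p (u a + sum u A) \<le> p (u a) + p (sum u A)"
    using insert.prems by (intro norm_on_add[OF assms(1)]) auto
  then show ?case using insert by fastforce
qed (simp_all add: norm_on_zero[OF assms(1)])

lemma banach_on_norm_on: "banach_on S p \<Longrightarrow> norm_on S p"
  by (simp add: banach_on_def)

lemma banach_on_subspace: "banach_on S p \<Longrightarrow> cvs.subspace S"
  using banach_on_norm_on norm_on_subspace by blast

section \<open>Linear maps on subspaces\<close>

lemma linear_onD:
  assumes "linear_on S f"
  shows "x \<in> S \<Longrightarrow> y \<in> S \<Longrightarrow> f (x + y) = f x + f y" "x \<in> S \<Longrightarrow> f (c *\<^sub>C x) = c *\<^sub>C f x"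
  using assms by (auto simp: linear_on_def)

lemma linear_on_0: "linear_on S f \<Longrightarrow> cvs.subspace S \<Longrightarrow> f 0 = 0"
  using linear_onD(2)[of S f 0 0] cvs.subspace_0[of S] by simp

lemma linear_on_minus: "linear_on S f \<Longrightarrow> x \<in> S \<Longrightarrow> f (- x) = - f x"
  using linear_onD(2)[of S f x "-1"] by (simp add: scaleC_one)

lemma linear_on_diff:
  "linear_on S f \<Longrightarrow> cvs.subspace S \<Longrightarrow> x \<in> S \<Longrightarrow> y \<in> S \<Longrightarrow> f (x - y) = f x - f y"
  using linear_onD(1)[of S f x "- y"] linear_on_minus[of S f y] cvs.subspace_neg[of S y] by auto

lemma linear_on_sum:
  assumes "linear_on S f" "cvs.subspace S" "\<And>j. j \<in> A \<Longrightarrow> u j \<in> S"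
  shows "f (sum u A) = (\<Sum>j\<in>A. f (u j))"
  using assms(3)
proof (induction A rule: infinite_finite_induct)
  case (insert a A)
  have "sum u A \<in> S"
    using insert.prems by (intro cvs.subspace_sum[OF assms(2)]) auto
  then show ?case using insert linear_onD(1)[OF assms(1), of "u a" "sum u A"] by simp
qed (simp_all add: linear_on_0[OF assms(1,2)])

lemma linear_on_subset: "linear_on S f \<Longrightarrow> T \<subseteq> S \<Longrightarrow> linear_on T f"
  unfolding linear_on_def by blast

lemma linear_on_id: "linear_on S (\<lambda>x. x)"
  by (simp add: linear_on_def)

lemma linear_on_compose:
  "linear_on S f \<Longrightarrow> linear_on T g \<Longrightarrow> (\<And>x. x \<in> S \<Longrightarrow> f x \<in> T) \<Longrightarrow> linear_on S (\<lambda>x. g (f x))"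
  by (simp add: linear_on_def)

lemma linear_on_add: "linear_on S f \<Longrightarrow> linear_on S g \<Longrightarrow> linear_on S (\<lambda>x. f x + g x)"
  by (simp add: linear_on_def algebra_simps scaleC_add_right)

lemma linear_on_uminus: "linear_on S f \<Longrightarrow> linear_on S (\<lambda>x. - f x)"
  by (simp add: linear_on_def)

lemma linear_on_sub: "linear_on S f \<Longrightarrow> linear_on S g \<Longrightarrow> linear_on S (\<lambda>x. f x - g x)"
  using linear_on_add[OF _ linear_on_uminus, of S f g] by simp

lemma linear_on_scaled: "linear_on S f \<Longrightarrow> linear_on S (\<lambda>x. c *\<^sub>C f x)"
  by (simp add: linear_on_def scaleC_add_right scaleC_scaleC mult.commute)

lemma linear_on_rank_one: "linear_on S f \<Longrightarrow> linear_on S (\<lambda>x. f x *\<^sub>C (e::'b::complex_vector))"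
  by (simp add: linear_on_def scaleC_add_left scaleC_scaleC scaleC_complex_def)

text \<open>The filter is arbitrary because limits are taken below both along sequences and along
  the finite subsets of an index set.\<close>

lemma norm_on_limit_unique:
  assumes N: "norm_on F q" and "l \<noteq> bot" "x \<in> F" "y \<in> F" "eventually (\<lambda>i. f i \<in> F) l"
    and x: "((\<lambda>i. q (x - f i)) \<longlongrightarrow> 0) l" and y: "((\<lambda>i. q (y - f i)) \<longlongrightarrow> 0) l"
  shows "x = y"
proof -
  have "((\<lambda>i. q (x - f i) + q (y - f i)) \<longlongrightarrow> 0 + 0) l" by (intro tendsto_add x y)
  moreover have "eventually (\<lambda>i. q (x - y) \<le> q (x - f i) + q (y - f i)) l"
    using assms(5)
  proof (eventually_elim)
    case (elim i)
    then show ?case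
      using norm_on_triangle[OF N, of x "f i" y] norm_on_diff_commute[OF N, of y "f i"] assms(3,4) by auto
  qed
  ultimately have "q (x - y) \<le> 0 + 0"
    by (rule tendsto_lowerbound) (use assms(2) in auto)
  moreover have "x - y \<in> F" using assms(3,4) cvs.subspace_diff[OF norm_on_subspace[OF N]] by blast
  ultimately show ?thesis using norm_on_nonneg[OF N] norm_on_eq_0[OF N, of "x - y"] by force
qed

section \<open>Absolutely summable families in a Banach space\<close>

lemma eventually_sum_in_subspace:
  assumes "cvs.subspace F" "\<And>j. j \<in> J \<Longrightarrow> u j \<in> F"
  shows "eventually (\<lambda>A. sum u A \<in> F) (finite_subsets_at_top J)"
  using cvs.subspace_sum[OF assms(1)] assms(2)
  by (intro eventually_finite_subsets_at_top_weakI) blast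

text \<open>\<open>J\<close> may be uncountable while completeness speaks of sequences. Finite sets
  \<open>A n\<close> that miss less than 1/(n+1) of the total mass give a Cauchy sequence of partial
  sums, and its limit is also the limit along all finite subsets.\<close>

lemma banach_on_sum_exists:
  assumes B: "banach_on F q" and u: "\<And>j. j \<in> J \<Longrightarrow> u j \<in> F"
    and s: "(\<lambda>j. q (u j)) summable_on J"
  shows "\<exists>x\<in>F. ((\<lambda>A. q (x - sum u A)) \<longlongrightarrow> 0) (finite_subsets_at_top J) \<and>
    q x \<le> infsum (\<lambda>j. q (u j)) J"
proof -
  let ?g = "\<lambda>j. q (u j)"
  have N: "norm_on F q" using B by (rule banach_on_norm_on)
  note sub = norm_on_subspace[OF N]
  have g0: "0 \<le> ?g j" if "j \<in> J" for j using norm_on_nonneg[OF N u[OF that]] .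
  have sumF: "sum u A \<in> F" if "A \<subseteq> J" for A
    using that u by (intro cvs.subspace_sum[OF sub]) auto
  define t where "t = infsum ?g J"
  have hs: "(?g has_sum t) J" unfolding t_def using s by (rule has_sum_infsum)
  have "\<exists>A. finite A \<and> A \<subseteq> J \<and> t - sum ?g A < 1 / real (Suc n)" for n
  proof -
    have "eventually (\<lambda>A. dist (sum ?g A) t < 1 / real (Suc n)) (finite_subsets_at_top J)"
      using hs unfolding has_sum_def tendsto_iff by simp
    then obtain X where "finite X" "X \<subseteq> J" "dist (sum ?g X) t < 1 / real (Suc n)"
      unfolding eventually_finite_subsets_at_top by blast
    then show ?thesis unfolding dist_real_def by (intro exI[of _ X]) linarith
  qed
  then obtain A where A: "\<And>n. finite (A n)" "\<And>n. A n \<subseteq> J"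
    "\<And>n. t - sum ?g (A n) < 1 / real (Suc n)" by metis
  \<comment> \<open>\<open>A n\<close> and \<open>B\<close> are disjoint parts of a total mass
    \<open>t\<close>, of which \<open>A n\<close> leaves less than 1/(n+1).\<close>
  have tail: "q (sum u B) < 1 / real (Suc n)" if "finite B" "B \<subseteq> J" "B \<inter> A n = {}" for B n
  proof -
    have "sum ?g (A n \<union> B) \<le> t"
      using that A g0 by (intro finite_sum_le_has_sum[OF hs]) auto
    moreover have "sum ?g (A n \<union> B) = sum ?g (A n) + sum ?g B"
      using that A by (intro sum.union_disjoint) auto
    moreover have "q (sum u B) \<le> sum ?g B" using that u by (intro norm_on_sum[OF N]) auto
    ultimately show ?thesis using A(3)[of n] by linarith
  qed
  define y where "y n = sum u (A n)" for n
  have yF: "y n \<in> F" for n unfolding y_def using sumF A by blast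
  \<comment> \<open>The common part of \<open>A m\<close> and \<open>A n\<close> cancels; each of
    the two remaining sums avoids the other index set and is therefore a tail.\<close>
  have ydiff: "q (y m - y n) < 1 / real (Suc n) + 1 / real (Suc m)" for m n
  proof -
    have "y m = sum u (A m - A n) + sum u (A m \<inter> A n)"
      unfolding y_def using A(1)[of m]
      by (subst add.commute) (rule sum.Int_Diff)
    moreover have "y n = sum u (A n - A m) + sum u (A m \<inter> A n)"
      unfolding y_def using A(1)[of n] by (subst add.commute, subst Int_commute) (rule sum.Int_Diff)
    ultimately have "y m - y n = sum u (A m - A n) - sum u (A n - A m)" by simp
    moreover have "q (sum u (A m - A n) - sum u (A n - A m)) \<le>
        q (sum u (A m - A n)) + q (sum u (A n - A m))"
      using A(2) by (intro norm_on_diff[OF N] sumF) auto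
    moreover have "q (sum u (A m - A n)) < 1 / real (Suc n)" using A by (intro tail) auto
    moreover have "q (sum u (A n - A m)) < 1 / real (Suc m)" using A by (intro tail) auto
    ultimately show ?thesis by simp
  qed
  have "\<exists>M. \<forall>m\<ge>M. \<forall>n\<ge>M. q (y m - y n) < e" if e: "e > 0" for e :: real
  proof -
    obtain M where M: "1 / real (Suc M) < e / 2"
      using reals_Archimedean[OF half_gt_zero[OF e]] by (auto simp: inverse_eq_divide)
    have "1 / real (Suc n) < e / 2" if "n \<ge> M" for n
    proof -
      have "1 / real (Suc n) \<le> 1 / real (Suc M)" using that by (simp add: frac_le)
      then show ?thesis using M by simp
    qed
    then have "q (y m - y n) < e" if "m \<ge> M" "n \<ge> M" for m n
      using ydiff[of m n] that by (smt (verit) field_sum_of_halves)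
    then show ?thesis by blast
  qed
  then obtain x where x: "x \<in> F" "(\<lambda>n. q (y n - x)) \<longlonglongrightarrow> 0"
    using B yF unfolding banach_on_def by blast
  have lim: "((\<lambda>A. q (x - sum u A)) \<longlongrightarrow> 0) (finite_subsets_at_top J)"
    unfolding tendsto_iff
  proof (intro allI impI)
    fix e :: real assume e: "e > 0"
    have "eventually (\<lambda>n. q (y n - x) < e / 2) sequentially"
      using order_tendstoD(2)[OF x(2) half_gt_zero[OF e]] .
    moreover obtain M where M: "1 / real (Suc M) < e / 2"
      using reals_Archimedean[OF half_gt_zero[OF e]] by (auto simp: inverse_eq_divide)
    ultimately obtain n where n: "n \<ge> M" "q (y n - x) < e / 2"
      unfolding eventually_sequentially by (metis nle_le)
    have "1 / real (Suc n) \<le> 1 / real (Suc M)" using n(1) by (simp add: frac_le)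
    then have "1 / real (Suc n) < e / 2" using M by simp
    then have "dist (q (x - sum u A')) 0 < e" if "finite A'" "A n \<subseteq> A'" "A' \<subseteq> J" for A'
    proof -
      have "sum u A' = y n + sum u (A' - A n)"
        unfolding y_def using that by (simp add: sum.subset_diff add.commute)
      then have "q (x - sum u A') \<le> q (x - y n) + q (sum u (A' - A n))"
        using norm_on_diff[OF N, of "x - y n" "sum u (A' - A n)"] sumF[of "A' - A n"] that
          cvs.subspace_diff[OF sub x(1) yF[of n]] by (auto simp: algebra_simps)
      moreover have "q (x - y n) = q (y n - x)" using N x(1) yF by (simp add: norm_on_diff_commute)
      moreover have "q (sum u (A' - A n)) < 1 / real (Suc n)" using that by (intro tail) auto
      moreover have "0 \<le> q (x - sum u A')"
        using that x(1) sumF cvs.subspace_diff[OF sub] by (intro norm_on_nonneg[OF N]) blast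
      ultimately show ?thesis using n(2) \<open>1 / real (Suc n) < e / 2\<close> by (simp add: dist_real_def)
    qed
    then show "eventually (\<lambda>A'. dist (q (x - sum u A')) 0 < e) (finite_subsets_at_top J)"
      unfolding eventually_finite_subsets_at_top using A(1,2)[of n] by (intro exI[of _ "A n"]) simp
  qed
  moreover have "q x \<le> t"
  proof -
    have "((\<lambda>A. q (x - sum u A) + t) \<longlongrightarrow> 0 + t) (finite_subsets_at_top J)"
      by (intro tendsto_add lim tendsto_const)
    moreover have "eventually (\<lambda>A. q x \<le> q (x - sum u A) + t) (finite_subsets_at_top J)"
    proof (rule eventually_finite_subsets_at_top_weakI)
      fix A assume "finite A" "A \<subseteq> J"
      then have "sum ?g A \<le> t" using g0 by (intro finite_sum_le_has_sum[OF hs]) auto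
      moreover have "q (sum u A) \<le> sum ?g A" using \<open>A \<subseteq> J\<close> u by (intro norm_on_sum[OF N]) auto
      moreover have "q x \<le> q (x - sum u A) + q (sum u A)"
        using norm_on_add[OF N, of "x - sum u A" "sum u A"] sumF[OF \<open>A \<subseteq> J\<close>] x(1)
          cvs.subspace_diff[OF sub] by auto
      ultimately show "q x \<le> q (x - sum u A) + t" by linarith
    qed
    ultimately have "q x \<le> 0 + t" by (rule tendsto_lowerbound) simp
    then show ?thesis by simp
  qed
  ultimately show ?thesis using x(1) unfolding t_def by blast
qed

text \<open>Summability is pointwise, because the operators attached to the coordinates of an l^1
  space are in general not summable in operator norm. Linearity of the sum comes from uniqueness of
  limits.\<close>

lemma banach_on_operator_sum:
  fixes D :: "'j \<Rightarrow> 'a::complex_vector \<Rightarrow> 'b::complex_vector"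
  assumes B: "banach_on F q" and S: "cvs.subspace S"
    and lin: "\<And>j. j \<in> J \<Longrightarrow> linear_on S (D j)"
    and inF: "\<And>j x. j \<in> J \<Longrightarrow> x \<in> S \<Longrightarrow> D j x \<in> F"
    and s: "\<And>x. x \<in> S \<Longrightarrow> (\<lambda>j. q (D j x)) summable_on J"
  shows "\<exists>G. linear_on S G \<and> (\<forall>x\<in>S. G x \<in> F \<and>
    ((\<lambda>A. q (G x - (\<Sum>j\<in>A. D j x))) \<longlongrightarrow> 0) (finite_subsets_at_top J) \<and>
    q (G x) \<le> infsum (\<lambda>j. q (D j x)) J)"
proof -
  have N: "norm_on F q" using B by (rule banach_on_norm_on)
  note sub = norm_on_subspace[OF N]
  let ?lim = "\<lambda>x g. ((\<lambda>A. q (g - (\<Sum>j\<in>A. D j x))) \<longlongrightarrow> 0) (finite_subsets_at_top J)"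
  have "\<forall>x\<in>S. \<exists>g. g \<in> F \<and> ?lim x g \<and> q g \<le> infsum (\<lambda>j. q (D j x)) J"
  proof
    fix x assume "x \<in> S"
    then show "\<exists>g. g \<in> F \<and> ?lim x g \<and> q g \<le> infsum (\<lambda>j. q (D j x)) J"
      using banach_on_sum_exists[OF B, of J "\<lambda>j. D j x"] inF s by blast
  qed
  then obtain G where G: "\<And>x. x \<in> S \<Longrightarrow> G x \<in> F" "\<And>x. x \<in> S \<Longrightarrow> ?lim x (G x)"
      "\<And>x. x \<in> S \<Longrightarrow> q (G x) \<le> infsum (\<lambda>j. q (D j x)) J" by metis
  have sumF: "(\<Sum>j\<in>A. D j x) \<in> F" if "A \<subseteq> J" "x \<in> S" for A x
    using that inF by (intro cvs.subspace_sum[OF sub]) auto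
  have uniq: "G x = g" if "x \<in> S" "g \<in> F" "?lim x g" for x g
    using eventually_sum_in_subspace[OF sub, of J "\<lambda>j. D j x"] inF that G
    by (intro norm_on_limit_unique[OF N finite_subsets_at_top_neq_bot]) auto
  have "G (x + y) = G x + G y" if "x \<in> S" "y \<in> S" for x y
  proof (rule uniq)
    show "x + y \<in> S" using that by (rule cvs.subspace_add[OF S])
    show "G x + G y \<in> F" using that G(1) by (intro cvs.subspace_add[OF sub])
    have z: "((\<lambda>A. q (G x - (\<Sum>j\<in>A. D j x)) + q (G y - (\<Sum>j\<in>A. D j y))) \<longlongrightarrow> 0 + 0) (finite_subsets_at_top J)"
      using that by (intro tendsto_add G)
    show "?lim (x + y) (G x + G y)"
    proof (rule tendsto_sandwich[OF _ _ tendsto_const])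
      show "((\<lambda>A. q (G x - (\<Sum>j\<in>A. D j x)) + q (G y - (\<Sum>j\<in>A. D j y))) \<longlongrightarrow> 0) (finite_subsets_at_top J)"
        using z by simp
      have eq: "G x + G y - (\<Sum>j\<in>A. D j (x + y)) = (G x - (\<Sum>j\<in>A. D j x)) + (G y - (\<Sum>j\<in>A. D j y))"
        if "A \<subseteq> J" for A
      proof -
        have "(\<Sum>j\<in>A. D j (x + y)) = (\<Sum>j\<in>A. D j x + D j y)"
          using \<open>A \<subseteq> J\<close> \<open>x \<in> S\<close> \<open>y \<in> S\<close> linear_onD(1)[OF lin] by (intro sum.cong) auto
        then show ?thesis by (simp add: sum.distrib)
      qed
      have mem: "G x - (\<Sum>j\<in>A. D j x) \<in> F" "G y - (\<Sum>j\<in>A. D j y) \<in> F" if "A \<subseteq> J" for A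
        using \<open>A \<subseteq> J\<close> \<open>x \<in> S\<close> \<open>y \<in> S\<close> G(1) sumF cvs.subspace_diff[OF sub] by auto
      show "eventually (\<lambda>A. 0 \<le> q (G x + G y - (\<Sum>j\<in>A. D j (x + y)))) (finite_subsets_at_top J)"
        by (rule eventually_finite_subsets_at_top_weakI, subst eq)
          (auto intro!: norm_on_nonneg[OF N] cvs.subspace_add[OF sub] mem)
      show "eventually (\<lambda>A. q (G x + G y - (\<Sum>j\<in>A. D j (x + y))) \<le>
          q (G x - (\<Sum>j\<in>A. D j x)) + q (G y - (\<Sum>j\<in>A. D j y))) (finite_subsets_at_top J)"
        by (rule eventually_finite_subsets_at_top_weakI, subst eq)
          (auto intro!: norm_on_add[OF N] mem)
    qed
  qed
  moreover have "G (c *\<^sub>C x) = c *\<^sub>C G x" if "x \<in> S" for c x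
  proof (rule uniq)
    show "c *\<^sub>C x \<in> S" using that by (rule cvs.subspace_scale[OF S])
    show "c *\<^sub>C G x \<in> F" using that G(1) by (intro cvs.subspace_scale[OF sub])
    have z: "((\<lambda>A. cmod c * q (G x - (\<Sum>j\<in>A. D j x))) \<longlongrightarrow> cmod c * 0) (finite_subsets_at_top J)"
      using that by (intro tendsto_mult tendsto_const G)
    have "eventually (\<lambda>A. cmod c * q (G x - (\<Sum>j\<in>A. D j x)) = q (c *\<^sub>C G x - (\<Sum>j\<in>A. D j (c *\<^sub>C x)))) (finite_subsets_at_top J)"
    proof (rule eventually_finite_subsets_at_top_weakI)
      fix A assume "A \<subseteq> J"
      then have "(\<Sum>j\<in>A. D j (c *\<^sub>C x)) = (\<Sum>j\<in>A. c *\<^sub>C D j x)"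
        using that linear_onD(2)[OF lin] by (intro sum.cong) auto
      also have "\<dots> = c *\<^sub>C (\<Sum>j\<in>A. D j x)" by (simp add: cvs.scale_sum_right)
      finally show "cmod c * q (G x - (\<Sum>j\<in>A. D j x)) = q (c *\<^sub>C G x - (\<Sum>j\<in>A. D j (c *\<^sub>C x)))"
        using norm_on_scale[OF N, of "G x - (\<Sum>j\<in>A. D j x)" c] \<open>A \<subseteq> J\<close> that G(1) sumF
          cvs.subspace_diff[OF sub] by (simp add: cvs.scale_right_diff_distrib)
    qed
    from Lim_transform_eventually[OF z this] show "?lim (c *\<^sub>C x) (c *\<^sub>C G x)" by simp
  qed
  ultimately have "linear_on S G" unfolding linear_on_def by blast
  then show ?thesis using G by blast
qed

lemma filterlim_lessThan_finite_subsets_at_top: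
  "filterlim lessThan (finite_subsets_at_top (UNIV :: nat set)) sequentially"
  unfolding filterlim_finite_subsets_at_top eventually_sequentially
proof (intro allI impI)
  fix X :: "nat set" assume "finite X \<and> X \<subseteq> UNIV"
  then obtain k where "X \<subseteq> {..<k}" using finite_nat_iff_bounded by blast
  then have "finite {..<n} \<and> X \<subseteq> {..<n} \<and> {..<n} \<subseteq> UNIV" if "n \<ge> k" for n using that by fastforce
  then show "\<exists>N. \<forall>n\<ge>N. finite {..<n} \<and> X \<subseteq> {..<n} \<and> {..<n} \<subseteq> UNIV" by blast
qed

section \<open>Bounded operators and the factorization theorem\<close>

definition bounded_op :: "'a::complex_vector set \<Rightarrow> ('a \<Rightarrow> real) \<Rightarrow> 'b::complex_vector set \<Rightarrow>
    ('b \<Rightarrow> real) \<Rightarrow> ('a \<Rightarrow> 'b) \<Rightarrow> bool" where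
  "bounded_op S p F q D \<longleftrightarrow> linear_on S D \<and> (\<forall>x\<in>S. D x \<in> F) \<and> (\<exists>C. \<forall>x\<in>S. q (D x) \<le> C * p x)"

lemma bounded_opI: "linear_on S D \<Longrightarrow> (\<And>x. x \<in> S \<Longrightarrow> D x \<in> F) \<Longrightarrow> (\<And>x. x \<in> S \<Longrightarrow> q (D x) \<le> C * p x) \<Longrightarrow> bounded_op S p F q D"
  unfolding bounded_op_def by blast

lemma bounded_op_linear: "bounded_op S p F q D \<Longrightarrow> linear_on S D"
  unfolding bounded_op_def by blast

lemma bounded_op_mem: "bounded_op S p F q D \<Longrightarrow> x \<in> S \<Longrightarrow> D x \<in> F"
  unfolding bounded_op_def by blast

lemma bounded_op_bound:
  assumes "norm_on S p" "bounded_op S p F q D"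
  obtains C where "C > 0" "\<And>x. x \<in> S \<Longrightarrow> q (D x) \<le> C * p x"
proof -
  obtain C where C: "\<And>x. x \<in> S \<Longrightarrow> q (D x) \<le> C * p x" using assms(2) unfolding bounded_op_def by blast
  have "q (D x) \<le> max C 1 * p x" if "x \<in> S" for x
    using C[OF that] mult_right_mono[of C "max C 1" "p x"] norm_on_nonneg[OF assms(1) that] by linarith
  then show thesis by (intro that[of "max C 1"]) auto
qed

lemma bounded_op_id: "F \<subseteq> G \<Longrightarrow> (\<And>x. x \<in> F \<Longrightarrow> r x \<le> C * q x) \<Longrightarrow> bounded_op F q G r (\<lambda>x. x)"
  unfolding bounded_op_def using linear_on_id by blast

lemma bounded_op_compose:
  assumes "norm_on S p" "norm_on F q" "bounded_op S p F q D" "bounded_op F q G r D'"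
  shows "bounded_op S p G r (\<lambda>x. D' (D x))"
proof -
  obtain C where C: "C > 0" "\<And>x. x \<in> S \<Longrightarrow> q (D x) \<le> C * p x" using bounded_op_bound[OF assms(1,3)] by metis
  obtain C' where C': "C' > 0" "\<And>x. x \<in> F \<Longrightarrow> r (D' x) \<le> C' * q x" using bounded_op_bound[OF assms(2,4)] by metis
  show ?thesis
  proof (rule bounded_opI)
    show "linear_on S (\<lambda>x. D' (D x))"
      using linear_on_compose[OF bounded_op_linear[OF assms(3)] bounded_op_linear[OF assms(4)]] bounded_op_mem[OF assms(3)] by blast
    fix x assume x: "x \<in> S"
    show "D' (D x) \<in> G" using bounded_op_mem[OF assms(4)] bounded_op_mem[OF assms(3)] x by blast
    have "r (D' (D x)) \<le> C' * q (D x)" using C'(2) bounded_op_mem[OF assms(3) x] by blast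
    also have "\<dots> \<le> C' * (C * p x)" using C(2)[OF x] C'(1) by (intro mult_left_mono) auto
    finally show "r (D' (D x)) \<le> (C' * C) * p x" by (simp add: mult.assoc)
  qed
qed

lemma bounded_op_add:
  assumes "norm_on F q" "bounded_op S p F q D" "bounded_op S p F q D'"
  shows "bounded_op S p F q (\<lambda>x. D x + D' x)"
proof -
  obtain C C' where C: "\<And>x. x \<in> S \<Longrightarrow> q (D x) \<le> C * p x" "\<And>x. x \<in> S \<Longrightarrow> q (D' x) \<le> C' * p x"
    using assms(2,3) unfolding bounded_op_def by metis
  show ?thesis
  proof (rule bounded_opI)
    show "linear_on S (\<lambda>x. D x + D' x)" using assms(2,3) by (intro linear_on_add bounded_op_linear)
    fix x assume x: "x \<in> S"
    note m = bounded_op_mem[OF assms(2) x] bounded_op_mem[OF assms(3) x]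
    show "D x + D' x \<in> F" using m by (rule cvs.subspace_add[OF norm_on_subspace[OF assms(1)]])
    show "q (D x + D' x) \<le> (C + C') * p x"
      using norm_on_add[OF assms(1) m] C(1)[OF x] C(2)[OF x] by (simp add: distrib_right)
  qed
qed

lemma bounded_op_uminus:
  assumes "norm_on F q" "bounded_op S p F q D"
  shows "bounded_op S p F q (\<lambda>x. - D x)"
proof -
  obtain C where C: "\<And>x. x \<in> S \<Longrightarrow> q (D x) \<le> C * p x" using assms(2) unfolding bounded_op_def by metis
  show ?thesis
  proof (rule bounded_opI)
    show "linear_on S (\<lambda>x. - D x)" using assms(2) by (intro linear_on_uminus bounded_op_linear)
    fix x assume x: "x \<in> S"
    show "- D x \<in> F" using bounded_op_mem[OF assms(2) x] by (rule cvs.subspace_neg[OF norm_on_subspace[OF assms(1)]])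
    show "q (- D x) \<le> C * p x"
      using norm_on_minus[OF assms(1) bounded_op_mem[OF assms(2) x]] C[OF x] by simp
  qed
qed

lemma bounded_op_diff:
  assumes "norm_on F q" "bounded_op S p F q D" "bounded_op S p F q D'"
  shows "bounded_op S p F q (\<lambda>x. D x - D' x)"
  using bounded_op_add[OF assms(1,2) bounded_op_uminus[OF assms(1,3)]] by simp

lemma bounded_op_continuous:
  assumes S: "norm_on S p" and F: "norm_on F q" and D: "bounded_op S p F q D"
  shows "continuous_map (norm_topology S p) (norm_topology F q) D"
proof -
  obtain C where C: "C > 0" "\<And>x. x \<in> S \<Longrightarrow> q (D x) \<le> C * p x" using bounded_op_bound[OF S D] by metis
  note sub = norm_on_subspace[OF S]
  have "openin (norm_topology S p) {x \<in> S. D x \<in> U}" if U: "openin (norm_topology F q) U" for U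
    unfolding openin_norm_topology
  proof (intro conjI ballI)
    fix x assume x: "x \<in> {x \<in> S. D x \<in> U}"
    then obtain e where e: "e > 0" "\<And>y. y \<in> F \<Longrightarrow> q (y - D x) < e \<Longrightarrow> y \<in> U"
      using U unfolding openin_norm_topology by blast
    have "D y \<in> U" if y: "y \<in> S" "p (y - x) < e / C" for y
    proof (rule e(2))
      show "D y \<in> F" using bounded_op_mem[OF D] y by blast
      have "q (D y - D x) = q (D (y - x))"
        using linear_on_diff[OF bounded_op_linear[OF D] sub] x y by simp
      also have "\<dots> \<le> C * p (y - x)" using x y cvs.subspace_diff[OF sub] by (intro C(2)) auto
      also have "\<dots> < e" using y(2) C(1) by (simp add: pos_less_divide_eq mult.commute)
      finally show "q (D y - D x) < e" .
    qed
    then show "\<exists>e>0. \<forall>y\<in>S. p (y - x) < e \<longrightarrow> y \<in> {x \<in> S. D x \<in> U}"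
      using e(1) C(1) by (intro exI[of _ "e / C"]) auto
  qed auto
  then show ?thesis unfolding continuous_map_def using bounded_op_mem[OF D] by auto
qed

lemma limitin_norm_continuous:
  assumes f: "continuous_map (norm_topology S p) T f" and x: "x \<in> S"
    and u: "eventually (\<lambda>i. u i \<in> S) l" and lim: "((\<lambda>i. p (u i - x)) \<longlongrightarrow> 0) l"
  shows "limitin T (\<lambda>i. f (u i)) (f x) l"
  unfolding limitin_def
proof (intro conjI allI impI)
  show "f x \<in> topspace T" using f x unfolding continuous_map_def by auto
  fix U assume U: "openin T U \<and> f x \<in> U"
  then have "openin (norm_topology S p) {y \<in> S. f y \<in> U}"
    using f unfolding continuous_map_def by auto
  then obtain e where e: "e > 0" "\<And>y. y \<in> S \<Longrightarrow> p (y - x) < e \<Longrightarrow> f y \<in> U"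
    using U x unfolding openin_norm_topology by blast
  have "eventually (\<lambda>i. p (u i - x) < e) l" using order_tendstoD(2)[OF lim e(1)] .
  with u show "eventually (\<lambda>i. f (u i) \<in> U) l" by eventually_elim (use e(2) in blast)
qed

text \<open>Baire's theorem for the metric p(x - y): the closure of some \<open>A n\<close> has an
  interior point, which is spelled out as approximability of every point of a ball.\<close>

lemma banach_on_Baire:
  fixes A :: "nat \<Rightarrow> 'a::complex_vector set"
  assumes B: "banach_on S p" and S: "S = (\<Union>n. A n)"
  obtains n x0 \<delta> where "x0 \<in> S" "\<delta> > 0"
    "\<And>y \<epsilon>. y \<in> S \<Longrightarrow> p (y - x0) < \<delta> \<Longrightarrow> \<epsilon> > 0 \<Longrightarrow> \<exists>a\<in>A n. p (y - a) < \<epsilon>"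
proof -
  have N: "norm_on S p" using B by (rule banach_on_norm_on)
  note sub = norm_on_subspace[OF N]
  \<comment> \<open>Off \<open>S\<close> the distance is set to 0, because
    \<open>Metric_space\<close> asks for symmetry and nonnegativity on the whole type.\<close>
  define d where "d x y = (if x \<in> S \<and> y \<in> S then p (x - y) else 0)" for x y
  have dS: "d x y = p (x - y)" if "x \<in> S" "y \<in> S" for x y using that by (simp add: d_def)
  have "Metric_space S d"
  proof
    fix x y z
    show "0 \<le> d x y" using norm_on_nonneg[OF N] cvs.subspace_diff[OF sub] by (simp add: d_def)
    show "d x y = d y x" using norm_on_diff_commute[OF N] by (simp add: d_def)
    show "d x y = 0 \<longleftrightarrow> x = y" if "x \<in> S" "y \<in> S"
      using norm_on_eq_0[OF N cvs.subspace_diff[OF sub that]] that by (simp add: d_def)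
    show "d x z \<le> d x y + d y z" if "x \<in> S" "y \<in> S" "z \<in> S"
      using norm_on_triangle[OF N that] that by (simp add: d_def)
  qed
  then interpret Metric_space S d .
  have comp: "mcomplete"
    unfolding mcomplete_def
  proof (intro allI impI)
    fix s assume s: "MCauchy s"
    then have r: "range s \<subseteq> S" by (simp add: MCauchy_def)
    moreover have "\<forall>e>0. \<exists>M. \<forall>m\<ge>M. \<forall>n\<ge>M. p (s m - s n) < e"
    proof (intro allI impI)
      fix e :: real assume "e > 0"
      then obtain M where "\<And>m n. m \<ge> M \<Longrightarrow> n \<ge> M \<Longrightarrow> d (s m) (s n) < e"
        using s unfolding MCauchy_def by meson
      moreover have "d (s m) (s n) = p (s m - s n)" for m n using r by (intro dS) auto
      ultimately show "\<exists>M. \<forall>m\<ge>M. \<forall>n\<ge>M. p (s m - s n) < e" by auto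
    qed
    ultimately obtain x where x: "x \<in> S" "(\<lambda>n. p (s n - x)) \<longlonglongrightarrow> 0"
      using B unfolding banach_on_def by blast
    have "eventually (\<lambda>n. s n \<in> S \<and> d (s n) x < e) sequentially" if "e > 0" for e
      using order_tendstoD(2)[OF x(2) that] r x(1) by (simp add: dS range_subsetD)
    then have "limitin mtopology s x sequentially" unfolding limitin_metric using x(1) by blast
    then show "\<exists>x. limitin mtopology s x sequentially" ..
  qed
  let ?G = "range (\<lambda>n. mtopology closure_of (A n))"
  have "\<exists>n. mtopology interior_of (mtopology closure_of (A n)) \<noteq> {}"
  proof (rule ccontr)
    assume "\<not> ?thesis"
    then have "mtopology interior_of \<Union>?G = {}"
      by (intro metric_Baire_category_alt comp) auto
    moreover have "\<Union>?G = S"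
    proof
      show "\<Union>?G \<subseteq> S" using closure_of_subset_topspace[of mtopology] by auto
      have "A n \<subseteq> \<Union>(range A)" for n by blast
      then have "A n \<subseteq> mtopology closure_of (A n)" for n
        unfolding S[symmetric] by (intro closure_of_subset) simp
      then show "S \<subseteq> \<Union>?G" using S by blast
    qed
    moreover have "mtopology interior_of S = S"
      using interior_of_topspace[of mtopology] by simp
    ultimately show False using cvs.subspace_0[OF sub] by auto
  qed
  then obtain n x0 where x0: "x0 \<in> mtopology interior_of (mtopology closure_of (A n))" by blast
  moreover have "openin mtopology (mtopology interior_of (mtopology closure_of (A n)))" by simp
  ultimately obtain \<delta> where \<delta>: "\<delta> > 0" "mball x0 \<delta> \<subseteq> mtopology interior_of (mtopology closure_of (A n))"
    unfolding openin_mtopology by blast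
  have x0S: "x0 \<in> S"
    using x0 interior_of_subset_topspace[of mtopology] by auto
  show thesis
  proof (rule that[OF x0S \<delta>(1)])
    fix y \<epsilon> assume y: "y \<in> S" "p (y - x0) < \<delta>" and e: "(\<epsilon>::real) > 0"
    then have "y \<in> mball x0 \<delta>" using x0S norm_on_diff_commute[OF N] by (simp add: dS)
    then have "y \<in> mtopology closure_of (A n)"
      by (rule subsetD[OF subset_trans[OF \<delta>(2) interior_of_subset]])
    then obtain a where "a \<in> A n" "a \<in> mball y \<epsilon>" unfolding metric_closure_of using e by auto
    then show "\<exists>a\<in>A n. p (y - a) < \<epsilon>" using y by (auto simp: dS)
  qed
qed

lemma has_sum_geometric_real:
  fixes b c :: real
  assumes "0 \<le> b" "0 \<le> c" "c < 1"
  shows "((\<lambda>n. b * c ^ n) has_sum (b / (1 - c))) UNIV"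
proof -
  have "(\<lambda>n. c ^ n) sums (1 / (1 - c))" using assms by (intro geometric_sums) auto
  then have s: "(\<lambda>n. b * c ^ n) sums (b * (1 / (1 - c)))" by (rule sums_mult)
  moreover have "summable (\<lambda>n. norm (b * c ^ n))" using s assms by (auto simp: sums_iff)
  ultimately show ?thesis using norm_summable_imp_has_sum by fastforce
qed

lemma summable_on_le_has_sum:
  fixes f g :: "'j \<Rightarrow> real"
  assumes "(g has_sum t) J" "\<And>j. j \<in> J \<Longrightarrow> 0 \<le> f j" "\<And>j. j \<in> J \<Longrightarrow> f j \<le> g j"
  shows "f summable_on J" "infsum f J \<le> t"
proof -
  show s: "f summable_on J"
    by (rule summable_on_comparison_test[OF has_sum_imp_summable[OF assms(1)]]) (use assms in auto)
  show "infsum f J \<le> t"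
    by (rule has_sum_mono[OF has_sum_infsum[OF s] assms(1,3)])
qed

text \<open>Grothendieck's factorization theorem, in the form of a closed graph theorem for the
  relation \<open>u x = v w\<close>.\<close>

lemma factorization:
  fixes S :: "'a::complex_vector set" and W :: "nat \<Rightarrow> 'b::complex_vector set"
    and T :: "'c::complex_vector topology"
  assumes B: "banach_on S p" and BW: "\<And>n. banach_on (W n) (q n)" and H: "Hausdorff_space T"
    and u: "linear_on S u" "continuous_map (norm_topology S p) T u"
    and v: "\<And>n. linear_on (W n) v" "\<And>n. continuous_map (norm_topology (W n) (q n)) T v"
    and cover: "\<And>x. x \<in> S \<Longrightarrow> \<exists>n. \<exists>w\<in>W n. v w = u x"
  obtains n C where "C > 0" "\<And>x. x \<in> S \<Longrightarrow> \<exists>w\<in>W n. v w = u x \<and> q n w \<le> C * p x"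
proof -
  have N: "norm_on S p" using B by (rule banach_on_norm_on)
  note sub = norm_on_subspace[OF N]
  \<comment> \<open>A level and a bound are coded as one number to obtain a countable cover of
    \<open>S\<close>: \<open>A i\<close> holds the x that have a partner w in one \<open>W n\<close>
    with norm at most k.\<close>
  define A where "A i = {x \<in> S. \<exists>w\<in>W (fst (prod_decode i)). v w = u x \<and>
    q (fst (prod_decode i)) w \<le> real (snd (prod_decode i))}" for i
  have "S = (\<Union>i. A i)"
  proof
    show "S \<subseteq> (\<Union>i. A i)"
    proof
      fix x assume x: "x \<in> S"
      then obtain n w where w: "w \<in> W n" "v w = u x" using cover by blast
      obtain k where "q n w \<le> real k" using real_arch_simple by blast
      then have "x \<in> A (prod_encode (n, k))" unfolding A_def using x w by auto
      then show "x \<in> (\<Union>i. A i)" by blast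
    qed
  qed (auto simp: A_def)
  from banach_on_Baire[OF B this] obtain i x0 \<delta> where x0: "x0 \<in> S" and \<delta>: "\<delta> > 0"
    and dense: "\<And>y \<epsilon>. y \<in> S \<Longrightarrow> p (y - x0) < \<delta> \<Longrightarrow> \<epsilon> > 0 \<Longrightarrow> \<exists>a\<in>A i. p (y - a) < \<epsilon>"
    by metis
  define n k where "n = fst (prod_decode i)" and "k = real (snd (prod_decode i))"
  have NW: "norm_on (W n) (q n)" using BW by (rule banach_on_norm_on)
  note subW = norm_on_subspace[OF NW]
  have Ai: "x \<in> A i \<longleftrightarrow> x \<in> S \<and> (\<exists>w\<in>W n. v w = u x \<and> q n w \<le> k)" for x
    unfolding A_def n_def k_def by blast
  have k0: "k \<ge> 0" unfolding k_def by simp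
  \<comment> \<open>The ball moves from \<open>x0\<close> to 0 with the same \<open>k\<close>: if a
    is near x0 + y and a' near x0 - y, then (a - a')/2 is near y, and its partner (w - w')/2 has
    norm at most k again.\<close>
  have ball: "\<exists>a\<in>S. \<exists>w\<in>W n. v w = u a \<and> q n w \<le> k \<and> p (y - a) < \<epsilon>"
    if y: "y \<in> S" "p y < \<delta>" and e: "\<epsilon> > 0" for y \<epsilon>
  proof -
    have "\<exists>a\<in>A i. p ((x0 + y) - a) < \<epsilon>"
      using y x0 e by (intro dense cvs.subspace_add[OF sub]) auto
    then obtain a w where a: "a \<in> S" "w \<in> W n" "v w = u a" "q n w \<le> k" "p ((x0 + y) - a) < \<epsilon>"
      using Ai by blast
    have "\<exists>a\<in>A i. p ((x0 - y) - a) < \<epsilon>"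
      using y x0 e norm_on_minus[OF N y(1)] by (intro dense cvs.subspace_diff[OF sub]) auto
    then obtain a' w' where a': "a' \<in> S" "w' \<in> W n" "v w' = u a'" "q n w' \<le> k" "p ((x0 - y) - a') < \<epsilon>"
      using Ai by blast
    let ?h = "\<lambda>z. (1 / 2 :: complex) *\<^sub>C z"
    have m: "?h (a - a') \<in> S" "?h (w - w') \<in> W n"
      using a a' by (auto intro!: cvs.subspace_scale[OF sub] cvs.subspace_diff[OF sub]
        cvs.subspace_scale[OF subW] cvs.subspace_diff[OF subW])
    have "v (?h (w - w')) = u (?h (a - a'))"
      using a a' cvs.subspace_diff[OF sub] cvs.subspace_diff[OF subW]
      by (simp add: linear_onD(2)[OF u(1)] linear_onD(2)[OF v(1)[of n]] linear_on_diff[OF u(1) sub]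
          linear_on_diff[OF v(1)[of n] subW])
    moreover have "q n (?h (w - w')) \<le> k"
      using norm_on_scale[OF NW cvs.subspace_diff[OF subW a(2) a'(2)], of "1 / 2"]
        norm_on_diff[OF NW a(2) a'(2)] a(4) a'(4) by (simp add: norm_divide)
    moreover have "p (y - ?h (a - a')) < \<epsilon>"
    proof -
      let ?z = "(x0 + y - a) - (x0 - y - a')"
      have "?h (y + y) = y" using scaleC_add_left[of "1/2" "1/2" y] by (simp add: scaleC_add_right scaleC_one)
      moreover have "?h ?z = ?h (y + y) - ?h (a - a')"
        unfolding cvs.scale_right_diff_distrib[symmetric] by (simp add: algebra_simps)
      ultimately have "y - ?h (a - a') = ?h ?z" by simp
      moreover have zm: "x0 + y - a \<in> S" "x0 - y - a' \<in> S"
        using x0 y a a' by (auto intro!: cvs.subspace_diff[OF sub] cvs.subspace_add[OF sub])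
      ultimately have "p (y - ?h (a - a')) = 1 / 2 * p ?z"
        using norm_on_scale[OF N cvs.subspace_diff[OF sub zm], of "1 / 2"] by (simp add: norm_divide)
      then show ?thesis using norm_on_diff[OF N zm] a(5) a'(5) by simp
    qed
    ultimately show ?thesis using m by blast
  qed
  \<comment> \<open>Scaling y to norm \<delta>/2 costs the factor t = 2 p(y)/\<delta>, so the
    partner has norm at most t k = c p(y). The accuracy \<delta>/4 before scaling becomes
    p(y)/2.\<close>
  define c where "c = 2 * k / \<delta>"
  have c0: "c \<ge> 0" unfolding c_def using k0 \<delta> by simp
  have step: "\<exists>a w. a \<in> S \<and> w \<in> W n \<and> v w = u a \<and> q n w \<le> c * p y \<and> p (y - a) \<le> p y / 2"
    if y: "y \<in> S" for y
  proof (cases "y = 0")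
    case True
    then show ?thesis
      using cvs.subspace_0[OF sub] cvs.subspace_0[OF subW] linear_on_0[OF u(1) sub]
        linear_on_0[OF v(1) subW] norm_on_zero[OF N] norm_on_zero[OF NW]
      by (intro exI[of _ 0]) simp
  next
    case False
    then have py: "p y > 0" using norm_on_nonneg[OF N y] norm_on_eq_0[OF N y] by linarith
    define t where "t = 2 * p y / \<delta>"
    have t: "t > 0" unfolding t_def using py \<delta> by simp
    let ?y = "complex_of_real (1 / t) *\<^sub>C y"
    have yS: "?y \<in> S" using y by (rule cvs.subspace_scale[OF sub])
    have "p ?y = p y / t" using norm_on_scale[OF N y, of "complex_of_real (1 / t)"] t by (simp add: norm_divide)
    also have "\<dots> = \<delta> / 2" unfolding t_def using py \<delta> by simp
    finally have py': "p ?y = \<delta> / 2" .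
    have "\<exists>a\<in>S. \<exists>w\<in>W n. v w = u a \<and> q n w \<le> k \<and> p (?y - a) < \<delta> / 4"
      using yS py' \<delta> by (intro ball) auto
    then obtain a w where a: "a \<in> S" "w \<in> W n" "v w = u a" "q n w \<le> k" "p (?y - a) < \<delta> / 4" by blast
    let ?t = "complex_of_real t"
    have "p (y - ?t *\<^sub>C a) = t * p (?y - a)"
    proof -
      have "y - ?t *\<^sub>C a = ?t *\<^sub>C (?y - a)"
        using t by (simp add: cvs.scale_right_diff_distrib scaleC_scaleC scaleC_one flip: of_real_mult)
      then show ?thesis using norm_on_scale[OF N cvs.subspace_diff[OF sub yS a(1)], of ?t] t by simp
    qed
    also have "\<dots> \<le> t * (\<delta> / 4)" using a(5) t by (intro mult_left_mono) auto
    also have "\<dots> = p y / 2" unfolding t_def using \<delta> by simp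
    finally have 1: "p (y - ?t *\<^sub>C a) \<le> p y / 2" .
    have "q n (?t *\<^sub>C w) \<le> t * k" using norm_on_scale[OF NW a(2), of ?t] t a(4) by simp
    moreover have "t * k = c * p y" unfolding c_def t_def by simp
    ultimately have 2: "q n (?t *\<^sub>C w) \<le> c * p y" by simp
    have 3: "v (?t *\<^sub>C w) = u (?t *\<^sub>C a)" using a by (simp add: linear_onD(2)[OF u(1)] linear_onD(2)[OF v(1)[of n]])
    show ?thesis using 1 2 3 cvs.subspace_scale[OF sub a(1)] cvs.subspace_scale[OF subW a(2)] by blast
  qed
  then obtain a w where aw: "\<And>y. y \<in> S \<Longrightarrow> a y \<in> S" "\<And>y. y \<in> S \<Longrightarrow> w y \<in> W n"
      "\<And>y. y \<in> S \<Longrightarrow> v (w y) = u (a y)" "\<And>y. y \<in> S \<Longrightarrow> q n (w y) \<le> c * p y"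
      "\<And>y. y \<in> S \<Longrightarrow> p (y - a y) \<le> p y / 2" by metis
  have main: "\<exists>z\<in>W n. v z = u y \<and> q n z \<le> (2 * c) * p y" if y: "y \<in> S" for y
  proof -
    \<comment> \<open>\<open>Y j\<close> is what remains of y after j approximations. It halves each
      time, so the norms of the partners sum to at most 2 c p(y).\<close>
    define Y where "Y j = ((\<lambda>z. z - a z) ^^ j) y" for j
    have Y0: "Y 0 = y" and YS: "Y (Suc j) = Y j - a (Y j)" for j by (simp_all add: Y_def)
    have Ym: "Y j \<in> S" for j
      by (induction j) (auto simp: Y0 YS y intro!: cvs.subspace_diff[OF sub] aw(1))
    have Yp: "p (Y j) \<le> p y * (1 / 2) ^ j" for j
    proof (induction j)
      case (Suc j)
      then show ?case using aw(5)[OF Ym[of j]] by (simp add: YS)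
    qed (simp add: Y0)
    have hs: "((\<lambda>j. (c * p y) * (1 / 2) ^ j) has_sum (c * p y / (1 - 1 / 2))) UNIV"
      using c0 norm_on_nonneg[OF N y] by (intro has_sum_geometric_real) auto
    have le: "q n (w (Y j)) \<le> (c * p y) * (1 / 2) ^ j" for j
      using aw(4)[OF Ym[of j]] mult_left_mono[OF Yp[of j] c0] by (simp add: mult.assoc)
    have ge: "0 \<le> q n (w (Y j))" for j using norm_on_nonneg[OF NW] aw(2) Ym by blast
    note sm = summable_on_le_has_sum[OF hs ge le]
    obtain z where z: "z \<in> W n" "((\<lambda>A. q n (z - sum (\<lambda>j. w (Y j)) A)) \<longlongrightarrow> 0) (finite_subsets_at_top UNIV)"
        "q n z \<le> infsum (\<lambda>j. q n (w (Y j))) UNIV"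
      using banach_on_sum_exists[OF BW[of n], of UNIV "\<lambda>j. w (Y j)"] sm(1) aw(2) Ym by blast
    have wm: "(\<Sum>j<m. w (Y j)) \<in> W n" for m using aw(2) Ym by (intro cvs.subspace_sum[OF subW]) auto
    have "(\<lambda>m. q n (z - (\<Sum>j<m. w (Y j)))) \<longlonglongrightarrow> 0"
      using filterlim_compose[OF z(2) filterlim_lessThan_finite_subsets_at_top] .
    then have limz: "(\<lambda>m. q n ((\<Sum>j<m. w (Y j)) - z)) \<longlonglongrightarrow> 0"
      using norm_on_diff_commute[OF NW wm z(1)] by simp
    have lv: "limitin T (\<lambda>m. v (\<Sum>j<m. w (Y j))) (v z) sequentially"
      using wm limz by (intro limitin_norm_continuous[OF v(2) z(1)]) auto
    have "(\<lambda>m. p y * (1 / 2) ^ m) \<longlonglongrightarrow> p y * 0"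
      by (intro tendsto_mult tendsto_const LIMSEQ_power_zero) simp
    then have half: "(\<lambda>m. p y * (1 / 2) ^ m) \<longlonglongrightarrow> 0" by simp
    have "(\<lambda>m. p (Y m)) \<longlonglongrightarrow> 0"
      by (rule tendsto_sandwich[OF _ _ tendsto_const half])
        (simp_all only: norm_on_nonneg[OF N Ym] Yp eventually_True)
    then have "(\<lambda>m. p ((y - Y m) - y)) \<longlonglongrightarrow> 0" using norm_on_minus[OF N Ym] by simp
    then have lu: "limitin T (\<lambda>m. u (y - Y m)) (u y) sequentially"
      using y Ym cvs.subspace_diff[OF sub] by (intro limitin_norm_continuous[OF u(2) y]) auto
    \<comment> \<open>The left side tends to v z and the right side to u y, both in the Hausdorff
      space \<open>T\<close>.\<close>
    have "v (\<Sum>j<m. w (Y j)) = u (y - Y m)" for m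
    proof (induction m)
      case 0
      then show ?case using linear_on_0[OF v(1) subW] linear_on_0[OF u(1) sub] by (simp add: Y0)
    next
      case (Suc m)
      have "v (\<Sum>j<Suc m. w (Y j)) = u (y - Y m) + u (a (Y m))"
        using linear_onD(1)[OF v(1) wm aw(2)[OF Ym]] Suc aw(3)[OF Ym] by simp
      also have "\<dots> = u ((y - Y m) + a (Y m))"
        using linear_onD(1)[OF u(1)] cvs.subspace_diff[OF sub y Ym] aw(1)[OF Ym] by simp
      finally show ?case by (simp add: YS algebra_simps)
    qed
    then have "v z = u y"
      using lv lu by (intro limitin_Hausdorff_unique[OF _ _ trivial_limit_sequentially H]) simp_all
    moreover have "q n z \<le> (2 * c) * p y" using z(3) sm(2) by (simp add: field_simps)
    ultimately show ?thesis using z(1) by blast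
  qed
  \<comment> \<open>The added 1 keeps the constant positive when \<open>k\<close> is 0.\<close>
  show thesis
  proof (rule that[of "2 * c + 1" n])
    show "2 * c + 1 > 0" using c0 by simp
    fix x assume x: "x \<in> S"
    have "(2 * c) * p x \<le> (2 * c + 1) * p x" using norm_on_nonneg[OF N x] by (intro mult_right_mono) auto
    then show "\<exists>w\<in>W n. v w = u x \<and> q n w \<le> (2 * c + 1) * p x" using main[OF x] by force
  qed
qed

section \<open>The Hahn--Banach theorem\<close>

definition sublinear_on :: "'a::complex_vector set \<Rightarrow> ('a \<Rightarrow> real) \<Rightarrow> bool" where
  "sublinear_on S P \<longleftrightarrow> P 0 = 0 \<and> (\<forall>x\<in>S. \<forall>y\<in>S. P (x + y) \<le> P x + P y) \<and>
     (\<forall>t>0. \<forall>x\<in>S. P (complex_of_real t *\<^sub>C x) \<le> t * P x)"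

lemma sublinear_onD:
  assumes "sublinear_on S P"
  shows "P 0 = 0" "x \<in> S \<Longrightarrow> y \<in> S \<Longrightarrow> P (x + y) \<le> P x + P y"
    "t > 0 \<Longrightarrow> x \<in> S \<Longrightarrow> P (complex_of_real t *\<^sub>C x) \<le> t * P x"
  using assms unfolding sublinear_on_def by blast+

lemma sublinear_on_lower:
  assumes "cvs.subspace S" "sublinear_on S P" "x \<in> S"
  shows "- P (- x) \<le> P x"
  using sublinear_onD(2)[OF assms(2,3), of "- x"] sublinear_onD(1)[OF assms(2)]
    cvs.subspace_neg[OF assms(1,3)] by simp

lemma sublinear_on_scale:
  assumes S: "cvs.subspace S" and P: "sublinear_on S P" and "t \<ge> 0" "x \<in> S"
  shows "P (complex_of_real t *\<^sub>C x) = t * P x"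
proof (cases "t = 0")
  case True
  then show ?thesis using sublinear_onD(1)[OF P] by simp
next
  case False
  then have t: "t > 0" using assms by simp
  have "P x = P (complex_of_real (1 / t) *\<^sub>C (complex_of_real t *\<^sub>C x))"
    using t by (simp add: scaleC_scaleC scaleC_one)
  also have "\<dots> \<le> (1 / t) * P (complex_of_real t *\<^sub>C x)"
    using t assms by (intro sublinear_onD(3)[OF P] cvs.subspace_scale[OF S]) auto
  finally have "t * P x \<le> P (complex_of_real t *\<^sub>C x)" using t by (simp add: field_simps)
  then show ?thesis using sublinear_onD(3)[OF P t] assms by force
qed

text \<open>Zorn's lemma for the pointwise order; minimality will force additivity. A chain is
  bounded below by its infimum, which exists because every member is at least -P(-x) at x.\<close>

lemma sublinear_on_minimal:
  assumes S: "cvs.subspace S" and P: "sublinear_on S P"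
  obtains m where "sublinear_on S m" "\<And>x. x \<in> S \<Longrightarrow> m x \<le> P x"
    "\<forall>n. sublinear_on S n \<longrightarrow> (\<forall>x\<in>S. n x \<le> m x) \<longrightarrow> (\<forall>x\<in>S. n x = m x)"
proof -
  \<comment> \<open>Values off \<open>S\<close> are fixed to 0 so that comparison on
    \<open>S\<close> is antisymmetric.\<close>
  define A where "A = {Q. sublinear_on S Q \<and> (\<forall>x\<in>S. Q x \<le> P x) \<and> (\<forall>x. x \<notin> S \<longrightarrow> Q x = 0)}"
  define R where "R Q u \<longleftrightarrow> (\<forall>x\<in>S. u x \<le> Q x)" for Q u :: "'a \<Rightarrow> real"
  have Ain: "sublinear_on S Q" "x \<in> S \<Longrightarrow> Q x \<le> P x" "x \<notin> S \<Longrightarrow> Q x = 0" if "Q \<in> A" for Q x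
    using that unfolding A_def by auto
  have lower: "- P (- x) \<le> Q x" if "Q \<in> A" "x \<in> S" for Q x
    using sublinear_on_lower[OF S Ain(1)[OF that(1)] that(2)] Ain(2)[OF that(1) cvs.subspace_neg[OF S that(2)]]
    by linarith
  have po: "partial_order_on A (relation_of R A)"
  proof (rule partial_order_on_relation_ofI)
    show "R a a" for a unfolding R_def by simp
    show "R a c" if "R a b" "R b c" for a b c using that unfolding R_def by force
    show "a = b" if "a \<in> A" "b \<in> A" "R a b" "R b a" for a b
    proof
      fix x
      show "a x = b x" using that Ain(3)[of a x] Ain(3)[of b x] unfolding R_def by (cases "x \<in> S") (auto intro: antisym)
    qed
  qed
  have "\<exists>u\<in>A. \<forall>a\<in>C. R a u" if C: "C \<in> Chains (relation_of R A)" for C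
  proof (cases "C = {}")
    case True
    let ?P = "\<lambda>x. if x \<in> S then P x else 0"
    have "sublinear_on S ?P"
      using P cvs.subspace_0[OF S] cvs.subspace_add[OF S] cvs.subspace_scale[OF S]
      unfolding sublinear_on_def by simp
    then have "?P \<in> A" unfolding A_def by simp
    then show ?thesis using True by blast
  next
    case False
    have CA: "Q \<in> A" if "Q \<in> C" for Q using C that unfolding Chains_def relation_of_def by blast
    have Ctot: "R Q Q' \<or> R Q' Q" if "Q \<in> C" "Q' \<in> C" for Q Q'
      using C that unfolding Chains_def relation_of_def by blast
    define u where "u x = (if x \<in> S then (INF Q\<in>C. Q x) else 0)" for x
    have bdd: "bdd_below ((\<lambda>Q. Q x) ` C)" if "x \<in> S" for x
      using lower[OF CA that] by (intro bdd_belowI[of _ "- P (- x)"]) auto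
    have ule: "u x \<le> Q x" if "x \<in> S" "Q \<in> C" for x Q
      unfolding u_def using that bdd by (auto intro: cINF_lower)
    have uge: "r \<le> u x" if "x \<in> S" "\<And>Q. Q \<in> C \<Longrightarrow> r \<le> Q x" for r x
      unfolding u_def using that False by (auto intro: cINF_greatest)
    have "sublinear_on S u"
      unfolding sublinear_on_def
    proof (intro conjI ballI allI impI)
      have "(INF Q\<in>C. Q 0) = (INF Q\<in>C. (0::real))"
        using Ain(1)[OF CA] sublinear_onD(1) by (intro INF_cong) auto
      then show "u 0 = 0" unfolding u_def using cvs.subspace_0[OF S] False by simp
    next
      fix x y assume x: "x \<in> S" and y: "y \<in> S"
      note xy = cvs.subspace_add[OF S x y]
      \<comment> \<open>\<open>Q\<close> and \<open>Q'\<close> are comparable, so the smaller of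
        them serves both summands; this makes the infimum of the chain subadditive.\<close>
      have 1: "u (x + y) \<le> Q x + Q' y" if QQ: "Q \<in> C" "Q' \<in> C" for Q Q'
      proof -
        have a: "u (x + y) \<le> Q x + Q y" "u (x + y) \<le> Q' x + Q' y"
          using ule[OF xy QQ(1)] ule[OF xy QQ(2)] sublinear_onD(2)[OF Ain(1)[OF CA[OF QQ(1)]] x y]
            sublinear_onD(2)[OF Ain(1)[OF CA[OF QQ(2)]] x y] by linarith+
        from Ctot[OF QQ] show ?thesis
        proof
          assume "R Q Q'"
          then have "Q' x \<le> Q x" unfolding R_def using x by blast
          then show ?thesis using a by linarith
        next
          assume "R Q' Q"
          then have "Q y \<le> Q' y" unfolding R_def using y by blast
          then show ?thesis using a by linarith
        qed
      qed
      have "u (x + y) - Q' y \<le> u x" if "Q' \<in> C" for Q'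
        using 1[OF _ that] by (intro uge[OF x]) (simp add: algebra_simps)
      then have "u (x + y) - u x \<le> u y" by (intro uge[OF y]) (simp add: algebra_simps)
      then show "u (x + y) \<le> u x + u y" by simp
    next
      fix t x assume t: "(t::real) > 0" and x: "x \<in> S"
      have "u (complex_of_real t *\<^sub>C x) / t \<le> u x"
      proof (rule uge[OF x])
        fix Q assume Q: "Q \<in> C"
        have "u (complex_of_real t *\<^sub>C x) \<le> t * Q x"
          using ule[OF cvs.subspace_scale[OF S x] Q] sublinear_onD(3)[OF Ain(1)[OF CA[OF Q]] t x]
          by (meson order_trans)
        then show "u (complex_of_real t *\<^sub>C x) / t \<le> Q x" using t by (simp add: field_simps)
      qed
      then show "u (complex_of_real t *\<^sub>C x) \<le> t * u x" using t by (simp add: field_simps)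
    qed
    moreover have "u x \<le> P x" if "x \<in> S" for x
    proof -
      obtain Q where "Q \<in> C" using False by blast
      then show ?thesis using ule[OF that] Ain(2)[OF CA] that by force
    qed
    ultimately have "u \<in> A" unfolding A_def by (simp add: u_def)
    moreover have "R Q u" if "Q \<in> C" for Q unfolding R_def using ule that by blast
    ultimately show ?thesis by blast
  qed
  from predicate_Zorn[OF po this] obtain m where m: "m \<in> A" "\<And>a. a \<in> A \<Longrightarrow> R m a \<Longrightarrow> a = m" by blast
  show thesis
  proof (rule that)
    show "sublinear_on S m" "\<And>x. x \<in> S \<Longrightarrow> m x \<le> P x" using Ain m(1) by auto
    show "\<forall>n. sublinear_on S n \<longrightarrow> (\<forall>x\<in>S. n x \<le> m x) \<longrightarrow> (\<forall>x\<in>S. n x = m x)"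
    proof (intro allI impI ballI)
      fix n x assume n: "sublinear_on S n" "\<forall>x\<in>S. n x \<le> m x" and x: "x \<in> S"
      let ?n = "\<lambda>x. if x \<in> S then n x else 0"
      have "sublinear_on S ?n"
        using n(1) cvs.subspace_0[OF S] cvs.subspace_add[OF S] cvs.subspace_scale[OF S]
        unfolding sublinear_on_def by simp
      moreover have "?n y \<le> P y" if "y \<in> S" for y using n(2) Ain(2)[OF m(1) that] that by force
      ultimately have "?n \<in> A" unfolding A_def by simp
      moreover have "R m ?n" unfolding R_def using n(2) by simp
      ultimately have "?n = m" using m(2) by blast
      from fun_cong[OF this, of x] show "n x = m x" using x by simp
    qed
  qed
qed

text \<open>A minimal sublinear \<open>m\<close> is additive: for fixed y the functional n(x), the
  infimum over t >= 0 of m(x + t y) - t m(y), is sublinear and at most \<open>m\<close>, hence equal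
  to \<open>m\<close>, and t = 1 gives m(x) + m(y) <= m(x + y).\<close>

lemma sublinear_on_dominates_linear:
  assumes S: "cvs.subspace S" and P: "sublinear_on S P"
  obtains \<psi> where "linear_on S \<psi>" "\<And>x. x \<in> S \<Longrightarrow> Re (\<psi> x) \<le> P x"
proof -
  obtain m where m: "sublinear_on S m" "\<And>x. x \<in> S \<Longrightarrow> m x \<le> P x"
    and min: "\<forall>n. sublinear_on S n \<longrightarrow> (\<forall>x\<in>S. n x \<le> m x) \<longrightarrow> (\<forall>x\<in>S. n x = m x)"
    using sublinear_on_minimal[OF S P] by blast
  note sc = cvs.subspace_scale[OF S] and ad = cvs.subspace_add[OF S]
  have super: "m x + m y \<le> m (x + y)" if x: "x \<in> S" and y: "y \<in> S" for x y
  proof -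
    let ?g = "\<lambda>x t. m (x + complex_of_real t *\<^sub>C y) - t * m y"
    define n where "n x = (INF t\<in>{0..}. ?g x t)" for x
    have lower: "- m (- x) \<le> ?g x t" if "x \<in> S" "t \<ge> 0" for x t
    proof -
      have "t * m y = m ((x + complex_of_real t *\<^sub>C y) + (- x))"
        using sublinear_on_scale[OF S m(1) that(2) y] by simp
      also have "\<dots> \<le> m (x + complex_of_real t *\<^sub>C y) + m (- x)"
        using that y by (intro sublinear_onD(2)[OF m(1)] ad sc cvs.subspace_neg[OF S])
      finally show ?thesis by simp
    qed
    have bdd: "bdd_below (?g x ` {0..})" if "x \<in> S" for x
      using lower[OF that] by (intro bdd_belowI[of _ "- m (- x)"]) auto
    have nle: "n x \<le> ?g x t" if "x \<in> S" "t \<ge> 0" for x t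
      unfolding n_def using that bdd by (auto intro: cINF_lower)
    have nge: "r \<le> n x" if "\<And>t. t \<ge> 0 \<Longrightarrow> r \<le> ?g x t" for r x
      unfolding n_def using that by (auto intro: cINF_greatest)
    have nm: "n x \<le> m x" if "x \<in> S" for x using nle[OF that, of 0] by simp
    have "sublinear_on S n"
      unfolding sublinear_on_def
    proof (intro conjI ballI allI impI)
      have "0 \<le> n 0" by (rule nge) (simp add: sublinear_on_scale[OF S m(1) _ y])
      then show "n 0 = 0" using nm[OF cvs.subspace_0[OF S]] sublinear_onD(1)[OF m(1)] by simp
    next
      fix u v assume u: "u \<in> S" and v: "v \<in> S"
      have 1: "n (u + v) \<le> ?g u s + ?g v t" if "s \<ge> 0" "t \<ge> 0" for s t
      proof -
        have "n (u + v) \<le> ?g (u + v) (s + t)" using that u v by (intro nle ad) auto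
        also have "u + v + complex_of_real (s + t) *\<^sub>C y =
            (u + complex_of_real s *\<^sub>C y) + (v + complex_of_real t *\<^sub>C y)"
          by (simp add: scaleC_add_left)
        also have "m \<dots> \<le> m (u + complex_of_real s *\<^sub>C y) + m (v + complex_of_real t *\<^sub>C y)"
          using u v y by (intro sublinear_onD(2)[OF m(1)] ad sc)
        finally show ?thesis by (simp add: algebra_simps)
      qed
      have "n (u + v) - ?g v t \<le> n u" if "t \<ge> 0" for t
        using 1[OF _ that] by (intro nge) (simp add: algebra_simps)
      then have "n (u + v) - n u \<le> n v" by (intro nge) (simp add: algebra_simps)
      then show "n (u + v) \<le> n u + n v" by simp
    next
      fix r u assume r: "(r::real) > 0" and u: "u \<in> S"
      have "n (complex_of_real r *\<^sub>C u) / r \<le> n u"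
      proof (rule nge)
        fix t :: real assume t: "t \<ge> 0"
        have "n (complex_of_real r *\<^sub>C u) \<le> ?g (complex_of_real r *\<^sub>C u) (r * t)"
          using r t u by (intro nle sc) auto
        also have "complex_of_real r *\<^sub>C u + complex_of_real (r * t) *\<^sub>C y =
            complex_of_real r *\<^sub>C (u + complex_of_real t *\<^sub>C y)"
          by (simp add: scaleC_add_right scaleC_scaleC)
        also have "m \<dots> = r * m (u + complex_of_real t *\<^sub>C y)"
          using r u y by (intro sublinear_on_scale[OF S m(1)] ad sc) auto
        finally show "n (complex_of_real r *\<^sub>C u) / r \<le> ?g u t" using r by (simp add: field_simps)
      qed
      then show "n (complex_of_real r *\<^sub>C u) \<le> r * n u" using r by (simp add: field_simps)
    qed
    then have "n x = m x" using min nm x by blast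
    then show ?thesis using nle[OF x, of 1] by (simp add: scaleC_one)
  qed
  have madd: "m (x + y) = m x + m y" if "x \<in> S" "y \<in> S" for x y
    using super[OF that] sublinear_onD(2)[OF m(1) that] by simp
  have mneg: "m (- x) = - m x" if "x \<in> S" for x
    using madd[OF that cvs.subspace_neg[OF S that]] sublinear_onD(1)[OF m(1)] by simp
  have mscale: "m (complex_of_real t *\<^sub>C x) = t * m x" if "x \<in> S" for t x
  proof (cases "t \<ge> 0")
    case True
    then show ?thesis using sublinear_on_scale[OF S m(1) _ that] by blast
  next
    case False
    then have "m (complex_of_real (- t) *\<^sub>C x) = - t * m x"
      using sublinear_on_scale[OF S m(1) _ that, of "- t"] by simp
    then show ?thesis using mneg[OF sc[OF that, of "complex_of_real t"]] by simp
  qed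
  \<comment> \<open>Complex linearity leaves only one choice for the imaginary part once the real
    part is \<open>m\<close>.\<close>
  define \<psi> where "\<psi> x = Complex (m x) (- m (\<i> *\<^sub>C x))" for x
  have mc: "m (c *\<^sub>C x) = Re c * m x + Im c * m (\<i> *\<^sub>C x)" if x: "x \<in> S" for c x
  proof -
    have "c *\<^sub>C x = complex_of_real (Re c) *\<^sub>C x + complex_of_real (Im c) *\<^sub>C (\<i> *\<^sub>C x)"
      unfolding scaleC_scaleC scaleC_add_left[symmetric]
      by (rule arg_cong[where f = "\<lambda>c. c *\<^sub>C x"]) (simp add: complex_eq_iff)
    then show ?thesis
      using madd[OF sc[OF x] sc[OF sc[OF x]], of "complex_of_real (Re c)" "complex_of_real (Im c)" \<i>]
        mscale[OF x, of "Re c"] mscale[OF sc[OF x], of "Im c" \<i>] by simp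
  qed
  have "linear_on S \<psi>"
    unfolding linear_on_def
  proof (intro conjI ballI allI)
    fix x y assume xy: "x \<in> S" "y \<in> S"
    show "\<psi> (x + y) = \<psi> x + \<psi> y"
      using madd[OF xy] madd[OF sc[OF xy(1)] sc[OF xy(2)], of \<i> \<i>]
      by (simp add: \<psi>_def complex_eq_iff scaleC_add_right)
  next
    fix c x assume x: "x \<in> S"
    show "\<psi> (c *\<^sub>C x) = c *\<^sub>C \<psi> x"
      using mc[OF x, of c] mc[OF x, of "\<i> * c"]
      by (simp add: \<psi>_def complex_eq_iff scaleC_complex_def scaleC_scaleC)
  qed
  then show thesis using m(2) by (intro that[of \<psi>]) (simp_all add: \<psi>_def)
qed

section \<open>Decomposition and extension of complex functionals\<close>

definition seminorm_on :: "'a::complex_vector set \<Rightarrow> ('a \<Rightarrow> real) \<Rightarrow> bool" where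
  "seminorm_on S p \<longleftrightarrow> cvs.subspace S \<and> (\<forall>c. \<forall>x\<in>S. p (c *\<^sub>C x) = cmod c * p x) \<and>
     (\<forall>x\<in>S. \<forall>y\<in>S. p (x + y) \<le> p x + p y)"

lemma seminorm_onD:
  assumes "seminorm_on S p"
  shows "cvs.subspace S" "x \<in> S \<Longrightarrow> p (c *\<^sub>C x) = cmod c * p x"
    "x \<in> S \<Longrightarrow> y \<in> S \<Longrightarrow> p (x + y) \<le> p x + p y"
  using assms unfolding seminorm_on_def by blast+

lemma seminorm_on_minus: "seminorm_on S p \<Longrightarrow> x \<in> S \<Longrightarrow> p (- x) = p x"
  using seminorm_onD(2)[of S p x "-1"] by (simp add: scaleC_one)

lemma seminorm_on_0: "seminorm_on S p \<Longrightarrow> p 0 = 0"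
  using seminorm_onD(2)[of S p 0 0] cvs.subspace_0[OF seminorm_onD(1), of S p] by simp

lemma norm_on_seminorm_on: "norm_on S p \<Longrightarrow> seminorm_on S p"
  unfolding norm_on_def seminorm_on_def by blast

lemma seminorm_on_cmult: "seminorm_on S p \<Longrightarrow> 0 \<le> r \<Longrightarrow> seminorm_on S (\<lambda>x. r * p x)"
  unfolding seminorm_on_def
  by (auto simp: distrib_left[symmetric] mult_left_mono mult.left_commute)

lemma seminorm_on_zero: "cvs.subspace S \<Longrightarrow> seminorm_on S (\<lambda>x. 0)"
  unfolding seminorm_on_def by simp

text \<open>Multiplying x by the conjugate phase of f(x) makes the value real and leaves p(x)
  unchanged.\<close>

lemma cmod_le_seminorm:
  assumes f: "linear_on S f" and p: "seminorm_on S p" and le: "\<And>x. x \<in> S \<Longrightarrow> Re (f x) \<le> p x"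
    and x: "x \<in> S"
  shows "cmod (f x) \<le> p x"
proof (cases "f x = 0")
  case True
  then show ?thesis using le[OF x] by simp
next
  case False
  define c where "c = cnj (f x) / cmod (f x)"
  have "f (c *\<^sub>C x) = cmod (f x)"
    using linear_onD(2)[OF f x, of c] False
    by (simp add: c_def scaleC_complex_def complex_norm_square[symmetric] mult.commute power2_eq_square)
  moreover have "cmod c = 1" using False by (simp add: c_def norm_divide)
  ultimately show ?thesis
    using le[OF cvs.subspace_scale[OF seminorm_onD(1)[OF p] x], of c] seminorm_onD(2)[OF p x, of c] by simp
qed

text \<open>This turns an inequality between norms into a splitting of functionals, the form in
  which (D\<Omega>) will be used; one part is extended from \<open>W\<close> to \<open>S\<close> on
  the way. The functional \<open>P\<close> is made for two test points: z = 0 gives P <= b, and z =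
  -w gives P(w) <= a(w) + Re f(w) on \<open>W\<close>.\<close>

lemma functional_decomposition:
  assumes W: "W \<subseteq> S" and a: "seminorm_on W a" and b: "seminorm_on S b"
    and f: "linear_on W f" and le: "\<And>z. z \<in> W \<Longrightarrow> cmod (f z) \<le> a z + b z"
  obtains \<psi> where "linear_on S \<psi>" "\<And>x. x \<in> S \<Longrightarrow> cmod (\<psi> x) \<le> b x"
    "\<And>z. z \<in> W \<Longrightarrow> cmod (f z - \<psi> z) \<le> a z"
proof -
  note subS = seminorm_onD(1)[OF b] and subW = seminorm_onD(1)[OF a]
  let ?g = "\<lambda>w z. b (w + z) + a z - Re (f z)"
  define P where "P w = (INF z\<in>W. ?g w z)" for w
  have W0: "0 \<in> W" by (rule cvs.subspace_0[OF subW])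
  have lower: "- b w \<le> ?g w z" if "w \<in> S" "z \<in> W" for w z
  proof -
    have zS: "z \<in> S" using that W by blast
    have "b z \<le> b (w + z) + b (- w)"
      using seminorm_onD(3)[OF b cvs.subspace_add[OF subS that(1) zS] cvs.subspace_neg[OF subS that(1)]] by simp
    moreover have "b (- w) = b w" using seminorm_on_minus[OF b that(1)] .
    ultimately show ?thesis using le[OF that(2)] complex_Re_le_cmod[of "f z"] by linarith
  qed
  have bdd: "bdd_below (?g w ` W)" if "w \<in> S" for w
    using lower[OF that] by (intro bdd_belowI[of _ "- b w"]) auto
  have Ple: "P w \<le> ?g w z" if "w \<in> S" "z \<in> W" for w z
    unfolding P_def using that bdd by (auto intro: cINF_lower)
  have Pge: "r \<le> P w" if "\<And>z. z \<in> W \<Longrightarrow> r \<le> ?g w z" for r w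
    unfolding P_def using that W0 by (auto intro: cINF_greatest)
  have "sublinear_on S P"
    unfolding sublinear_on_def
  proof (intro conjI ballI allI impI)
    have "0 \<le> P 0" using lower[OF cvs.subspace_0[OF subS]] seminorm_on_0[OF b] by (intro Pge) simp
    then show "P 0 = 0"
      using Ple[OF cvs.subspace_0[OF subS] W0] seminorm_on_0[OF a] seminorm_on_0[OF b] linear_on_0[OF f subW] by simp
  next
    fix u v assume u: "u \<in> S" and v: "v \<in> S"
    have 1: "P (u + v) \<le> ?g u z + ?g v y" if zy: "z \<in> W" "y \<in> W" for z y
    proof -
      have "P (u + v) \<le> ?g (u + v) (z + y)" using zy u v by (intro Ple cvs.subspace_add[OF subS] cvs.subspace_add[OF subW])
      moreover have "b ((u + z) + (v + y)) \<le> b (u + z) + b (v + y)"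
        using zy W u v by (intro seminorm_onD(3)[OF b] cvs.subspace_add[OF subS]) auto
      moreover have "a (z + y) \<le> a z + a y" using seminorm_onD(3)[OF a zy] .
      moreover have "f (z + y) = f z + f y" using linear_onD(1)[OF f zy] .
      ultimately show ?thesis by (simp add: algebra_simps)
    qed
    have "P (u + v) - ?g v y \<le> P u" if "y \<in> W" for y
      using 1[OF _ that] by (intro Pge) (simp add: algebra_simps)
    then have "P (u + v) - P u \<le> P v" by (intro Pge) (simp add: algebra_simps)
    then show "P (u + v) \<le> P u + P v" by simp
  next
    fix r u assume r: "(r::real) > 0" and u: "u \<in> S"
    have "P (complex_of_real r *\<^sub>C u) / r \<le> P u"
    proof (rule Pge)
      fix z assume z: "z \<in> W"
      let ?r = "complex_of_real r"
      have "P (?r *\<^sub>C u) \<le> ?g (?r *\<^sub>C u) (?r *\<^sub>C z)"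
        using z u by (intro Ple cvs.subspace_scale[OF subS] cvs.subspace_scale[OF subW])
      also have "b (?r *\<^sub>C u + ?r *\<^sub>C z) = r * b (u + z)"
        unfolding scaleC_add_right[symmetric]
        using z u W r seminorm_onD(2)[OF b cvs.subspace_add[OF subS u], of z ?r] by auto
      also have "a (?r *\<^sub>C z) = r * a z" using seminorm_onD(2)[OF a z, of ?r] r by simp
      also have "Re (f (?r *\<^sub>C z)) = r * Re (f z)"
        using linear_onD(2)[OF f z, of ?r] by (simp add: scaleC_complex_def)
      finally show "P (?r *\<^sub>C u) / r \<le> ?g u z" using r by (simp add: field_simps)
    qed
    then show "P (complex_of_real r *\<^sub>C u) \<le> r * P u" using r by (simp add: field_simps)
  qed
  from sublinear_on_dominates_linear[OF subS this] obtain \<psi> where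
    \<psi>: "linear_on S \<psi>" "\<And>x. x \<in> S \<Longrightarrow> Re (\<psi> x) \<le> P x" by blast
  show thesis
  proof (rule that[OF \<psi>(1)])
    fix x assume x: "x \<in> S"
    have "Re (\<psi> y) \<le> b y" if "y \<in> S" for y
      using \<psi>(2)[OF that] Ple[OF that W0] seminorm_on_0[OF a] linear_on_0[OF f subW] by simp
    then show "cmod (\<psi> x) \<le> b x" using cmod_le_seminorm[OF \<psi>(1) b] x by blast
  next
    fix z assume z: "z \<in> W"
    have \<psi>W: "linear_on W \<psi>" using linear_on_subset[OF \<psi>(1) W] .
    have "Re (\<psi> y - f y) \<le> a y" if "y \<in> W" for y
    proof -
      have "y \<in> S" using that W by blast
      have "P y \<le> ?g y (- y)" using \<open>y \<in> S\<close> that by (intro Ple cvs.subspace_neg[OF subW])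
      then show ?thesis
        using \<psi>(2)[OF \<open>y \<in> S\<close>] seminorm_on_0[OF b] seminorm_on_minus[OF a that] linear_on_minus[OF f that] by simp
    qed
    then have "cmod (\<psi> z - f z) \<le> a z"
      using cmod_le_seminorm[OF linear_on_sub[OF \<psi>W f] a _ z] by blast
    then show "cmod (f z - \<psi> z) \<le> a z" by (simp add: norm_minus_commute)
  qed
qed

lemma functional_extension:
  assumes W: "W \<subseteq> S" "cvs.subspace W" and b: "seminorm_on S b"
    and f: "linear_on W f" and le: "\<And>z. z \<in> W \<Longrightarrow> cmod (f z) \<le> b z"
  obtains \<psi> where "linear_on S \<psi>" "\<And>x. x \<in> S \<Longrightarrow> cmod (\<psi> x) \<le> b x" "\<And>z. z \<in> W \<Longrightarrow> \<psi> z = f z"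
proof -
  have le': "cmod (f z) \<le> 0 + b z" if "z \<in> W" for z using le[OF that] by simp
  show thesis
  proof (rule functional_decomposition[OF W(1) seminorm_on_zero[OF W(2)] b f le'])
    fix \<psi> assume \<psi>: "linear_on S \<psi>" "\<And>x. x \<in> S \<Longrightarrow> cmod (\<psi> x) \<le> b x"
      "\<And>z. z \<in> W \<Longrightarrow> cmod (f z - \<psi> z) \<le> 0"
    have "\<psi> z = f z" if "z \<in> W" for z using \<psi>(3)[OF that] by simp
    with \<psi>(1,2) show thesis by (rule that)
  qed
qed

section \<open>Banach pieces of locally convex spaces\<close>

definition banach_piece :: "'a::complex_vector topology \<Rightarrow> 'a set \<Rightarrow> ('a \<Rightarrow> real) \<Rightarrow> bool" where
  "banach_piece T F q \<longleftrightarrow> banach_on F q \<and> continuous_map (norm_topology F q) T (\<lambda>x. x)"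

text \<open>Unlike a spectrum with its inductive limit, this does not determine the topology of
  \<open>T\<close>. It passes along isomorphisms, and together with the factorization theorem it
  yields every comparison of norms between levels.\<close>

definition exhaustion :: "'a::complex_vector topology \<Rightarrow> (nat \<Rightarrow> 'a set) \<Rightarrow> (nat \<Rightarrow> 'a \<Rightarrow> real) \<Rightarrow> bool" where
  "exhaustion T S p \<longleftrightarrow> (\<forall>n. banach_piece T (S n) (p n) \<and> S n \<subseteq> S (Suc n)) \<and> topspace T = (\<Union>n. S n)"

lemma banach_pieceD:
  assumes "banach_piece T F q"
  shows "banach_on F q" "continuous_map (norm_topology F q) T (\<lambda>x. x)" "F \<subseteq> topspace T" "norm_on F q"
    "cvs.subspace F"
  using assms continuous_map_image_subset_topspace[of "norm_topology F q" T "\<lambda>x. x"]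
    banach_on_norm_on[of F q] norm_on_subspace[of F q]
  unfolding banach_piece_def by auto

lemma exhaustionD:
  assumes "exhaustion T S p"
  shows "banach_piece T (S n) (p n)" "topspace T = (\<Union>n. S n)" "norm_on (S n) (p n)" "banach_on (S n) (p n)"
    "cvs.subspace (S n)" "S n \<subseteq> topspace T"
  using assms banach_pieceD[of T "S n" "p n"] unfolding exhaustion_def by blast+

lemma exhaustion_mono:
  assumes "exhaustion T S p" "m \<le> n"
  shows "S m \<subseteq> S n"
  by (rule lift_Suc_mono_le[OF _ assms(2)]) (use assms(1) in \<open>simp add: exhaustion_def\<close>)

text \<open>A closed graph argument: both inclusions into the Hausdorff space \<open>T\<close> are
  continuous and agree on \<open>F\<close>, so the factorization theorem with every
  \<open>W n\<close> equal to \<open>G\<close> bounds \<open>r\<close> by a multiple of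
  \<open>q\<close>.\<close>

lemma banach_piece_embedding:
  assumes H: "Hausdorff_space T" and F: "banach_piece T F q" and G: "banach_piece T G r" and sub: "F \<subseteq> G"
  shows "bounded_op F q G r (\<lambda>x. x)"
proof (rule factorization[OF banach_pieceD(1)[OF F] banach_pieceD(1)[OF G] H linear_on_id banach_pieceD(2)[OF F] linear_on_id banach_pieceD(2)[OF G]])
  fix n :: nat and C assume C: "C > 0" "\<And>x. x \<in> F \<Longrightarrow> \<exists>w\<in>G. w = x \<and> r w \<le> C * q x"
  show ?thesis using sub C(2) by (intro bounded_op_id) auto
qed (use sub in auto)

lemma exhaustion_embedding:
  assumes "Hausdorff_space T" "exhaustion T S p" "m \<le> n"
  shows "bounded_op (S m) (p m) (S n) (p n) (\<lambda>x. x)"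
  by (rule banach_piece_embedding[OF assms(1) exhaustionD(1)[OF assms(2)] exhaustionD(1)[OF assms(2)] exhaustion_mono[OF assms(2,3)]])

text \<open>Factorization through the levels of \<open>Y\<close>. The y belonging to x need not
  depend linearly on x. Later \<open>v\<close> is \<open>\<iota>\<close>, \<open>Q\<close> or the
  identity.\<close>

lemma exhaustion_lift:
  assumes H: "Hausdorff_space T" and Y: "exhaustion Y S p" and F: "banach_on F q"
    and u: "linear_on F u" "continuous_map (norm_topology F q) T u"
    and v: "linear_on (topspace Y) v" "continuous_map Y T v"
    and cover: "\<And>x. x \<in> F \<Longrightarrow> \<exists>y\<in>topspace Y. v y = u x"
  obtains n C where "C > 0" "\<And>x. x \<in> F \<Longrightarrow> \<exists>y\<in>S n. v y = u x \<and> p n y \<le> C * q x"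
proof (rule factorization[OF F exhaustionD(4)[OF Y] H u])
  show "linear_on (S n) v" for n using v(1) exhaustionD(6)[OF Y] linear_on_subset by blast
  show "continuous_map (norm_topology (S n) (p n)) T v" for n
    using continuous_map_compose[OF banach_pieceD(2)[OF exhaustionD(1)[OF Y]] v(2)] by (simp add: o_def)
  show "\<exists>n. \<exists>w\<in>S n. v w = u x" if "x \<in> F" for x
    using cover[OF that] exhaustionD(2)[OF Y] by blast
qed (rule that)

lemma exhaustion_lift_ge:
  assumes H: "Hausdorff_space T" and HY: "Hausdorff_space Y" and Y: "exhaustion Y S p" and F: "banach_on F q"
    and u: "linear_on F u" "continuous_map (norm_topology F q) T u"
    and v: "linear_on (topspace Y) v" "continuous_map Y T v"
    and cover: "\<And>x. x \<in> F \<Longrightarrow> \<exists>y\<in>topspace Y. v y = u x"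
  obtains n C where "n \<ge> n0" "C > 0" "\<And>x. x \<in> F \<Longrightarrow> \<exists>y\<in>S n. v y = u x \<and> p n y \<le> C * q x"
proof -
  obtain n C where C: "C > 0" "\<And>x. x \<in> F \<Longrightarrow> \<exists>y\<in>S n. v y = u x \<and> p n y \<le> C * q x"
    using exhaustion_lift[OF H Y F u v cover] by blast
  let ?n = "max n n0"
  obtain C' where C': "C' > 0" "\<And>y. y \<in> S n \<Longrightarrow> p ?n y \<le> C' * p n y"
    by (rule bounded_op_bound[OF exhaustionD(3)[OF Y] exhaustion_embedding[OF HY Y, of n ?n]]) auto
  show thesis
  proof (rule that[of ?n "C' * C"])
    fix x assume "x \<in> F"
    then obtain y where y: "y \<in> S n" "v y = u x" "p n y \<le> C * q x" using C(2) by blast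
    have "p ?n y \<le> C' * p n y" using C'(2)[OF y(1)] .
    also have "\<dots> \<le> C' * (C * q x)" using y(3) C'(1) by (intro mult_left_mono) auto
    finally have "p ?n y \<le> C' * C * q x" by (simp add: mult.assoc)
    moreover have "y \<in> S ?n" using exhaustion_mono[OF Y, of n ?n] y(1) by auto
    ultimately show "\<exists>y\<in>S ?n. v y = u x \<and> p ?n y \<le> C' * C * q x" using y(2) by blast
  qed (use C C' in auto)
qed

text \<open>With \<open>u\<close> the inclusion of a Banach piece, the piece sits in one level,
  beyond any prescribed \<open>n0\<close>. Hence two exhaustions of a Hausdorff space are
  interleaved by bounded inclusions.\<close>

lemma exhaustion_factor:
  assumes H: "Hausdorff_space T" and Z: "exhaustion T S p" and F: "banach_on F q"
    and u: "linear_on F u" "continuous_map (norm_topology F q) T u"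
  obtains n where "n \<ge> n0" "bounded_op F q (S n) (p n) u"
proof (rule exhaustion_lift_ge[OF H H Z F u linear_on_id])
  show "continuous_map T T (\<lambda>x. x)" using continuous_map_id[of T] by (simp add: id_def)
  show "\<exists>y\<in>topspace T. y = u x" if "x \<in> F" for x
    using continuous_map_image_subset_topspace[OF u(2)] that by auto
  fix n C assume n: "n \<ge> n0" and C: "C > 0" "\<And>x. x \<in> F \<Longrightarrow> \<exists>y\<in>S n. y = u x \<and> p n y \<le> C * q x"
  show thesis using C(2) by (intro that[OF n] bounded_opI[OF u(1), of _ _ C]) auto
qed

lemma exhaustion_Ind:
  assumes B: "\<And>n. banach_on (S n) (p n)" and inc: "\<And>n. S n \<subseteq> S (Suc n)"
  shows "exhaustion (Ind S p) S p"
  using Ind_candidate[of S p, OF banach_on_subspace[OF B] inc] inc B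
  unfolding ind_candidate_def exhaustion_def banach_piece_def by simp

lemma banach_spectrum_exhaustion:
  assumes "banach_spectrum S p"
  shows "exhaustion (Ind S p) S p"
  using assms unfolding banach_spectrum_def by (intro exhaustion_Ind) blast+

text \<open>\<open>Ind\<close> is the supremum of the candidate topologies, so it is enough that the
  pullback of the topology of \<open>E\<close> along \<open>T\<close> is a candidate. It is locally
  convex because \<open>T\<close> is linear.\<close>

lemma Ind_continuous:
  assumes S: "banach_spectrum S p" and E: "locally_convex E"
    and T: "linear_on (\<Union>n. S n) T" "\<And>n. continuous_map (norm_topology (S n) (p n)) E T"
  shows "continuous_map (Ind S p) E T"
proof -
  have spec: "exhaustion (Ind S p) S p" using S by (rule banach_spectrum_exhaustion)
  have sub: "cvs.subspace (S n)" and inc: "S n \<subseteq> S (Suc n)" for n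
    using S banach_on_subspace unfolding banach_spectrum_def by blast+
  let ?V = "\<Union>n. S n"
  have "ind_candidate S p (Ind S p)" by (rule Ind_candidate[of S p, OF sub inc])
  then have subV: "cvs.subspace ?V" and tI: "topspace (Ind S p) = ?V"
    unfolding ind_candidate_def locally_convex_def by auto
  have TE: "T x \<in> topspace E" if "x \<in> ?V" for x
    using continuous_map_image_subset_topspace[OF T(2)] that by auto
  let ?P = "pullback_topology ?V T E"
  have tP: "topspace ?P = ?V" unfolding topspace_pullback_topology using TE by blast
  have cT: "continuous_map ?P E T"
  proof -
    have "continuous_map ?P E ((\<lambda>x. x) \<circ> T)"
      using continuous_map_id[of E] by (intro continuous_map_pullback) (simp add: id_def)
    then show ?thesis by (simp add: o_def)
  qed
  have Tadd: "T (a + b) = T a + T b" if "a \<in> S i" "b \<in> S j" for a b i j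
    using that linear_onD(1)[OF T(1), of a b] by blast
  have Tscale: "T (c *\<^sub>C a) = c *\<^sub>C T a" if "a \<in> S i" for a c i
    using that linear_onD(2)[OF T(1), of a c] by blast
  have into: "continuous_map X ?P g" if "continuous_map X E (\<lambda>x. T (g x))" "\<And>x. x \<in> topspace X \<Longrightarrow> g x \<in> ?V"
    for X :: "'c topology" and g
    using that by (intro continuous_map_pullback') (auto simp: o_def)
  have add: "continuous_map (prod_topology ?P ?P) ?P (\<lambda>(x, y). x + y)"
  proof (rule into)
    have "continuous_map (prod_topology ?P ?P) (prod_topology E E) (\<lambda>z. (T (fst z), T (snd z)))"
      using continuous_map_compose[OF continuous_map_fst cT] continuous_map_compose[OF continuous_map_snd cT]
      by (intro continuous_map_pairedI) (simp_all add: o_def)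
    moreover have "continuous_map (prod_topology E E) E (\<lambda>(x, y). x + y)"
      using E unfolding locally_convex_def by blast
    ultimately have "continuous_map (prod_topology ?P ?P) E ((\<lambda>(x, y). x + y) \<circ> (\<lambda>z. (T (fst z), T (snd z))))"
      by (rule continuous_map_compose)
    then show "continuous_map (prod_topology ?P ?P) E (\<lambda>z. T (case z of (x, y) \<Rightarrow> x + y))"
      by (rule continuous_map_eq) (auto simp: tP Tadd)
    fix z assume "z \<in> topspace (prod_topology ?P ?P)"
    then have "fst z \<in> ?V" "snd z \<in> ?V" unfolding topspace_prod_topology tP by auto
    then have "fst z + snd z \<in> ?V" by (rule cvs.subspace_add[OF subV])
    then show "(case z of (x, y) \<Rightarrow> x + y) \<in> ?V" by (simp add: split_def)
  qed
  have scale: "continuous_map (prod_topology euclidean ?P) ?P (\<lambda>(c, x). c *\<^sub>C x)"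
  proof (rule into)
    have "continuous_map (prod_topology euclidean ?P) (prod_topology euclidean E) (\<lambda>z. (fst z, T (snd z)))"
      using continuous_map_compose[OF continuous_map_snd cT]
      by (intro continuous_map_pairedI continuous_map_fst) (simp_all add: o_def)
    moreover have "continuous_map (prod_topology euclidean E) E (\<lambda>(c, x). c *\<^sub>C x)"
      using E unfolding locally_convex_def by blast
    ultimately have "continuous_map (prod_topology euclidean ?P) E ((\<lambda>(c, x). c *\<^sub>C x) \<circ> (\<lambda>z. (fst z, T (snd z))))"
      by (rule continuous_map_compose)
    then show "continuous_map (prod_topology euclidean ?P) E (\<lambda>z. T (case z of (c, x) \<Rightarrow> c *\<^sub>C x))"
      by (rule continuous_map_eq) (auto simp: tP Tscale)
    fix z :: "complex \<times> 'a" assume "z \<in> topspace (prod_topology euclidean ?P)"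
    then have "snd z \<in> ?V" unfolding topspace_prod_topology tP by auto
    then have "fst z *\<^sub>C snd z \<in> ?V" by (rule cvs.subspace_scale[OF subV])
    then show "(case z of (c, x) \<Rightarrow> c *\<^sub>C x) \<in> ?V" by (simp add: split_def)
  qed
  have conv: "\<exists>W. openin ?P W \<and> 0 \<in> W \<and> cconvex W \<and> W \<subseteq> U" if U: "openin ?P U" "0 \<in> U" for U
  proof -
    obtain U' where U': "openin E U'" "U = T -` U' \<inter> ?V" using U unfolding openin_pullback_topology by blast
    have "0 \<in> U'" using U(2) U'(2) linear_on_0[OF T(1) subV] by auto
    then obtain W where W: "openin E W" "0 \<in> W" "cconvex W" "W \<subseteq> U'"
      using E U'(1) unfolding locally_convex_def by meson
    have "cconvex (T -` W \<inter> ?V)"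
      unfolding cconvex_def
    proof (intro ballI)
      fix x y and t :: real assume x: "x \<in> T -` W \<inter> ?V" and y: "y \<in> T -` W \<inter> ?V" and t: "t \<in> {0..1}"
      let ?z = "complex_of_real (1 - t) *\<^sub>C x + complex_of_real t *\<^sub>C y"
      have xV: "x \<in> ?V" and yV: "y \<in> ?V" using x y by blast+
      note sc = cvs.subspace_scale[OF subV]
      have "T ?z = complex_of_real (1 - t) *\<^sub>C T x + complex_of_real t *\<^sub>C T y"
        using linear_onD(1)[OF T(1) sc[OF xV] sc[OF yV]] linear_onD(2)[OF T(1) xV] linear_onD(2)[OF T(1) yV] by simp
      also have "\<dots> \<in> W" using W(3) x y t unfolding cconvex_def by blast
      finally have "?z \<in> T -` W" by simp
      moreover have "?z \<in> ?V" using xV yV by (intro cvs.subspace_add[OF subV] sc)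
      ultimately show "?z \<in> T -` W \<inter> ?V" by blast
    qed
    moreover have "openin ?P (T -` W \<inter> ?V)" unfolding openin_pullback_topology using W(1) by blast
    moreover have "0 \<in> T -` W \<inter> ?V" using W(2) linear_on_0[OF T(1) subV] cvs.subspace_0[OF subV] by simp
    moreover have "T -` W \<inter> ?V \<subseteq> U" using W(4) U'(2) by blast
    ultimately show ?thesis by blast
  qed
  have "ind_candidate S p ?P"
    unfolding ind_candidate_def
  proof (intro conjI allI)
    show "locally_convex ?P" unfolding locally_convex_def using add scale conv subV tP by simp
    show "topspace ?P = ?V" by (rule tP)
    show "continuous_map (norm_topology (S n) (p n)) ?P (\<lambda>x. x)" for n
      using T(2) by (intro into) auto
  qed
  then have open_Ind: "openin (Ind S p) U" if "openin ?P U" for U using Ind_finest that by blast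
  show ?thesis
    unfolding continuous_map_def
  proof (intro conjI allI impI)
    show "T \<in> topspace (Ind S p) \<rightarrow> topspace E" using TE tI by auto
    fix U assume "openin E U"
    then have "openin ?P (T -` U \<inter> ?V)" unfolding openin_pullback_topology by blast
    moreover have "{x \<in> topspace (Ind S p). T x \<in> U} = T -` U \<inter> ?V" using tI by blast
    ultimately show "openin (Ind S p) {x \<in> topspace (Ind S p). T x \<in> U}" using open_Ind by simp
  qed
qed

section \<open>Bounded sets, Banach disks and directedness of Banach pieces\<close>

lemma bounded_in_image_ball:
  assumes N: "norm_on S p" and u: "linear_on S u" "continuous_map (norm_topology S p) E u" and r: "r > 0"
  shows "bounded_in E (u ` {x \<in> S. p x \<le> r})"
  unfolding bounded_in_def
proof (intro conjI allI impI)
  show "u ` {x \<in> S. p x \<le> r} \<subseteq> topspace E"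
    using continuous_map_image_subset_topspace[OF u(2)] by auto
  note sub = norm_on_subspace[OF N]
  fix U assume U: "openin E U \<and> 0 \<in> U"
  then have "openin (norm_topology S p) {x \<in> S. u x \<in> U}" using u(2) unfolding continuous_map_def by auto
  moreover have "0 \<in> {x \<in> S. u x \<in> U}" using U linear_on_0[OF u(1) sub] cvs.subspace_0[OF sub] by simp
  ultimately obtain e where e: "e > 0" "\<And>y. y \<in> S \<Longrightarrow> p (y - 0) < e \<Longrightarrow> u y \<in> U"
    unfolding openin_norm_topology by blast
  define t where "t = 2 * r / e"
  have t: "t > 0" unfolding t_def using e r by simp
  have "u x \<in> scale_set t U" if x: "x \<in> S" "p x \<le> r" for x
  proof -
    let ?y = "complex_of_real (1 / t) *\<^sub>C x"
    have "?y \<in> S" using x(1) by (rule cvs.subspace_scale[OF sub])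
    moreover have "p ?y < e"
    proof -
      have "p ?y = p x / t"
        using norm_on_scale[OF N x(1), of "complex_of_real (1 / t)"] t by (simp add: norm_divide)
      also have "\<dots> \<le> r / t" using x(2) t by (intro divide_right_mono) auto
      also have "\<dots> < e" unfolding t_def using e r by simp
      finally show ?thesis .
    qed
    ultimately have "u ?y \<in> U" using e(2) by simp
    moreover have "u x = complex_of_real t *\<^sub>C u ?y"
    proof -
      have "complex_of_real t *\<^sub>C u ?y = (complex_of_real t * complex_of_real (1 / t)) *\<^sub>C u x"
        using linear_onD(2)[OF u(1) x(1)] by (simp add: scaleC_scaleC)
      also have "complex_of_real t * complex_of_real (1 / t) = 1"
        unfolding of_real_mult[symmetric] using t by simp
      finally show ?thesis by (simp add: scaleC_one)
    qed
    ultimately show ?thesis unfolding scale_set_def by blast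
  qed
  then show "\<exists>r'>0. u ` {x \<in> S. p x \<le> r} \<subseteq> scale_set r' U" using t by blast
qed

text \<open>\<open>bounded_in\<close> provides one dilation factor per set, and a larger factor need
  not do for an arbitrary neighbourhood. The dilations of a convex \<open>V\<close> containing 0
  increase, so inside such a \<open>V\<close> the larger of the two factors serves both
  sets.\<close>

lemma bounded_in_Un:
  assumes E: "locally_convex E" and A: "bounded_in E A" and B: "bounded_in E B"
  shows "bounded_in E (A \<union> B)"
  unfolding bounded_in_def
proof (intro conjI allI impI)
  show "A \<union> B \<subseteq> topspace E" using A B unfolding bounded_in_def by blast
  fix U assume "openin E U \<and> 0 \<in> U"
  then obtain V where V: "openin E V" "0 \<in> V" "cconvex V" "V \<subseteq> U"
    using E unfolding locally_convex_def by meson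
  then obtain r s where rs: "r > 0" "s > 0" "A \<subseteq> scale_set r V" "B \<subseteq> scale_set s V"
    using A B unfolding bounded_in_def by meson
  have mono: "scale_set t V \<subseteq> scale_set t' U" if t: "0 < t" "t \<le> t'" for t t'
  proof
    fix x assume "x \<in> scale_set t V"
    then obtain v where v: "v \<in> V" "x = complex_of_real t *\<^sub>C v" unfolding scale_set_def by blast
    let ?w = "complex_of_real (1 - t / t') *\<^sub>C 0 + complex_of_real (t / t') *\<^sub>C v"
    have "t / t' \<in> {0..1}" using t by auto
    then have "?w \<in> V" using V(2,3) v(1) unfolding cconvex_def by blast
    moreover have "complex_of_real t' * complex_of_real (t / t') = complex_of_real t"
      unfolding of_real_mult[symmetric] using t by simp
    then have "x = complex_of_real t' *\<^sub>C ?w"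
      by (simp only: scaleC_add_right scaleC_scaleC cvs.scale_zero_right add_0_left v(2))
    ultimately show "x \<in> scale_set t' U" using V(4) unfolding scale_set_def by blast
  qed
  have "A \<union> B \<subseteq> scale_set (max r s) U"
    using mono[of r "max r s"] mono[of s "max r s"] rs by fastforce
  then show "\<exists>r>0. A \<union> B \<subseteq> scale_set r U" using rs(1) by (intro exI[of _ "max r s"]) auto
qed

lemma absolutely_convex_span_absorbing:
  assumes D: "absolutely_convex D" and x: "x \<in> cvs.span D"
  shows "\<exists>t>0. x \<in> scale_set t D"
proof -
  let ?A = "{x. \<exists>t>0. x \<in> scale_set t D}"
  have comb: "a *\<^sub>C x + b *\<^sub>C y \<in> D" if "x \<in> D" "y \<in> D" "cmod a + cmod b \<le> 1" for x y a b
    using D that unfolding absolutely_convex_def by blast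
  have bal: "a *\<^sub>C x \<in> D" if "x \<in> D" "cmod a \<le> 1" for x a
    using comb[OF that(1) that(1), of a 0] that(2) by simp
  obtain d where d: "d \<in> D" using D unfolding absolutely_convex_def by blast
  have "cvs.subspace ?A"
  proof (rule cvs.subspaceI)
    have "0 \<in> D" using bal[OF d, of 0] by simp
    then show "0 \<in> ?A" unfolding scale_set_def by (auto intro!: exI[of _ 1] image_eqI[of _ _ 0])
  next
    fix x y assume "x \<in> ?A" "y \<in> ?A"
    then obtain t s u v where ts: "t > 0" "s > 0" "u \<in> D" "v \<in> D"
      "x = complex_of_real t *\<^sub>C u" "y = complex_of_real s *\<^sub>C v" unfolding scale_set_def by blast
    let ?w = "complex_of_real (t / (t + s)) *\<^sub>C u + complex_of_real (s / (t + s)) *\<^sub>C v"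
    have "cmod (complex_of_real (t / (t + s))) + cmod (complex_of_real (s / (t + s))) = 1"
      unfolding norm_of_real using ts by (simp add: add_divide_distrib[symmetric])
    then have "?w \<in> D" using ts by (intro comb) auto
    moreover have "x + y = complex_of_real (t + s) *\<^sub>C ?w"
      using ts unfolding scaleC_add_right scaleC_scaleC of_real_mult[symmetric] by simp
    ultimately show "x + y \<in> ?A" using ts(1,2) unfolding scale_set_def by (auto intro!: exI[of _ "t + s"])
  next
    fix c x assume "x \<in> ?A"
    then obtain t u where t: "t > 0" "u \<in> D" "x = complex_of_real t *\<^sub>C u" unfolding scale_set_def by blast
    \<comment> \<open>Dividing by |c| + 1 instead of |c| covers c = 0.\<close>
    let ?w = "(c / complex_of_real (cmod c + 1)) *\<^sub>C u"
    have "cmod (c / complex_of_real (cmod c + 1)) \<le> 1"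
      unfolding norm_divide norm_of_real using norm_ge_zero[of c] by (subst divide_le_eq_1) linarith
    then have "?w \<in> D" using t by (intro bal) auto
    moreover have "c *\<^sub>C x = complex_of_real (t * (cmod c + 1)) *\<^sub>C ?w"
    proof -
      have "complex_of_real (cmod c + 1) \<noteq> 0" by (metis add_nonneg_pos norm_ge_zero of_real_eq_0_iff order_less_irrefl zero_less_one)
      then have "complex_of_real (t * (cmod c + 1)) * (c / complex_of_real (cmod c + 1)) = c * complex_of_real t"
        unfolding of_real_mult by simp
      then show ?thesis using t(3) by (simp add: scaleC_scaleC)
    qed
    ultimately have "c *\<^sub>C x \<in> scale_set (t * (cmod c + 1)) D" unfolding scale_set_def by (intro image_eqI)
    moreover have "t * (cmod c + 1) > 0" using t(1) norm_ge_zero[of c] by (intro mult_pos_pos) linarith+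
    ultimately show "c *\<^sub>C x \<in> ?A" by blast
  qed
  moreover have "D \<subseteq> ?A"
    unfolding scale_set_def by (auto intro!: exI[of _ 1] simp: scaleC_one image_iff)
  ultimately show ?thesis using cvs.span_minimal[of D ?A] x by blast
qed

lemma minkowski_le: "t > 0 \<Longrightarrow> x \<in> scale_set t D \<Longrightarrow> minkowski D x \<le> t"
  unfolding minkowski_def by (intro cInf_lower bdd_belowI[of _ 0]) auto

text \<open>Continuity at x: translating \<open>U\<close> by -x gives a neighbourhood of 0, some
  dilation of it by r contains \<open>D\<close>, and then every y whose difference to x has gauge
  below 1/r lies in \<open>U\<close>.\<close>

lemma banach_disk_banach_piece:
  assumes E: "locally_convex E" and D: "banach_disk E D"
  shows "banach_piece E (cvs.span D) (minkowski D)"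
proof -
  let ?S = "cvs.span D"
  have ac: "absolutely_convex D" and bd: "bounded_in E D" using D unfolding banach_disk_def by auto
  have "cvs.subspace (topspace E)" using E unfolding locally_convex_def by blast
  then have St: "?S \<subseteq> topspace E" using bd cvs.span_minimal[of D "topspace E"] unfolding bounded_in_def by blast
  have "openin (norm_topology ?S (minkowski D)) {x \<in> ?S. x \<in> U}" if U: "openin E U" for U
    unfolding openin_norm_topology
  proof (intro conjI ballI)
    fix x assume x: "x \<in> {x \<in> ?S. x \<in> U}"
    let ?V = "{y \<in> topspace E. x + y \<in> U}"
    have "continuous_map E (prod_topology E E) (\<lambda>y. (x, y))"
      using x St continuous_map_id[of E] by (intro continuous_map_pairedI) (auto simp: id_def)
    moreover have "continuous_map (prod_topology E E) E (\<lambda>(x, y). x + y)"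
      using E unfolding locally_convex_def by blast
    ultimately have "continuous_map E E ((\<lambda>(x, y). x + y) \<circ> (\<lambda>y. (x, y)))"
      by (rule continuous_map_compose)
    then have "openin E ?V" using U unfolding continuous_map_def by (simp add: o_def)
    moreover have "0 \<in> ?V" using x \<open>cvs.subspace (topspace E)\<close> cvs.subspace_0 by simp
    ultimately obtain r where r: "r > 0" "D \<subseteq> scale_set r ?V" using bd unfolding bounded_in_def by meson
    have "y \<in> U" if y: "y \<in> ?S" "minkowski D (y - x) < 1 / r" for y
    proof -
      have "y - x \<in> ?S" using y x cvs.span_diff by blast
      then have "{t. 0 < t \<and> y - x \<in> scale_set t D} \<noteq> {}"
        using absolutely_convex_span_absorbing[OF ac] by blast
      then obtain t where t: "t > 0" "y - x \<in> scale_set t D" "t < 1 / r"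
        using cInf_lessD y(2) unfolding minkowski_def by (metis (mono_tags, lifting) mem_Collect_eq)
      then obtain d where d: "d \<in> D" "y - x = complex_of_real t *\<^sub>C d" unfolding scale_set_def by blast
      have "cmod (complex_of_real (t * r)) + cmod 0 \<le> 1"
        unfolding norm_of_real using t r by (simp add: field_simps)
      then have "complex_of_real (t * r) *\<^sub>C d + 0 *\<^sub>C d \<in> D"
        using ac d(1) unfolding absolutely_convex_def by blast
      then have "complex_of_real (t * r) *\<^sub>C d \<in> scale_set r ?V" using r(2) by auto
      then obtain v where v: "v \<in> ?V" "complex_of_real (t * r) *\<^sub>C d = complex_of_real r *\<^sub>C v"
        unfolding scale_set_def by blast
      have "complex_of_real r *\<^sub>C (y - x) = complex_of_real r *\<^sub>C v"
        unfolding d(2) v(2)[symmetric] scaleC_scaleC by (simp add: mult.commute)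
      then have "y - x = v" using r(1) by simp
      then show ?thesis using v(1) by auto
    qed
    then show "\<exists>e>0. \<forall>y\<in>?S. minkowski D (y - x) < e \<longrightarrow> y \<in> {x \<in> ?S. x \<in> U}"
      using r(1) by (intro exI[of _ "1 / r"]) auto
  qed auto
  then show ?thesis using D St unfolding banach_piece_def banach_disk_def continuous_map_def by auto
qed

text \<open>All dilations of \<open>B\<close> are covered at once, because (A) delivers its summands
  in dilated bounded sets.\<close>

lemma bounded_in_banach_piece:
  assumes E: "locally_convex E" "locally_complete E" and B: "bounded_in E B"
  obtains F q where "banach_piece E F q" "\<And>t x. t > 0 \<Longrightarrow> x \<in> scale_set t B \<Longrightarrow> x \<in> F \<and> q x \<le> t"
proof -
  obtain D where D: "banach_disk E D" "B \<subseteq> D" using E(2) B unfolding locally_complete_def by blast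
  show thesis
  proof (rule that[OF banach_disk_banach_piece[OF E(1) D(1)]])
    fix t x assume t: "(t::real) > 0" "x \<in> scale_set t B"
    then have "x \<in> scale_set t D" using D(2) unfolding scale_set_def by blast
    moreover from this have "x \<in> cvs.span D"
      unfolding scale_set_def using cvs.span_scale cvs.span_base by blast
    ultimately show "x \<in> cvs.span D \<and> minkowski D x \<le> t" using minkowski_le[OF t(1)] by blast
  qed
qed

lemma scale_set_UnI: "x \<in> scale_set t A \<Longrightarrow> x \<in> scale_set t (A \<union> B)" "x \<in> scale_set t B \<Longrightarrow> x \<in> scale_set t (A \<union> B)"
  unfolding scale_set_def by blast+

lemma scale_set_ball:
  assumes N: "norm_on F q" and x: "x \<in> F" "x \<noteq> 0"
  shows "q x > 0" "x \<in> scale_set (q x) {x \<in> F. q x \<le> 1}"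
proof -
  show q: "q x > 0" using norm_on_nonneg[OF N x(1)] norm_on_eq_0[OF N x(1)] x(2) by linarith
  let ?y = "complex_of_real (1 / q x) *\<^sub>C x"
  have "?y \<in> F" using x(1) by (rule cvs.subspace_scale[OF norm_on_subspace[OF N]])
  moreover have "q ?y = 1"
    using norm_on_scale[OF N x(1), of "complex_of_real (1 / q x)"] q unfolding norm_of_real by simp
  moreover have "x = complex_of_real (q x) *\<^sub>C ?y" using q by (simp add: scaleC_scaleC scaleC_one)
  ultimately show "x \<in> scale_set (q x) {x \<in> F. q x \<le> 1}"
    unfolding scale_set_def by (intro image_eqI[of _ _ ?y]) auto
qed

lemma banach_piece_ball_bounded: "banach_piece E F q \<Longrightarrow> bounded_in E {x \<in> F. q x \<le> 1}"
  using bounded_in_image_ball[OF banach_pieceD(4)[of E F q] linear_on_id banach_pieceD(2)[of E F q], of 1] by simp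

lemma banach_piece_ball_absorbed:
  assumes F: "banach_piece E F q" and G: "banach_piece E G r"
    and le: "\<And>t x. t > 0 \<Longrightarrow> x \<in> scale_set t {x \<in> F. q x \<le> 1} \<Longrightarrow> x \<in> G \<and> r x \<le> t" and x: "x \<in> F"
  shows "x \<in> G \<and> r x \<le> q x"
proof (cases "x = 0")
  case True
  then show ?thesis
    using norm_on_zero[OF banach_pieceD(4)[OF F]] norm_on_zero[OF banach_pieceD(4)[OF G]] cvs.subspace_0[OF banach_pieceD(5)[OF G]] by simp
next
  case False
  then show ?thesis using le scale_set_ball[OF banach_pieceD(4)[OF F] x] by blast
qed

text \<open>Local completeness is applied to the union of both unit balls and \<open>B\<close>. As
  the balls themselves lie in the new disk, both inclusions have norm at most 1, which saves
  constants later.\<close>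

lemma banach_piece_directed:
  assumes E: "locally_convex E" "locally_complete E" and F: "banach_piece E F q" and G: "banach_piece E G r" and B: "bounded_in E B"
  obtains H s where "banach_piece E H s" "\<And>x. x \<in> F \<Longrightarrow> x \<in> H \<and> s x \<le> q x" "\<And>x. x \<in> G \<Longrightarrow> x \<in> H \<and> s x \<le> r x"
    "\<And>t x. t > 0 \<Longrightarrow> x \<in> scale_set t B \<Longrightarrow> x \<in> H \<and> s x \<le> t"
proof -
  let ?A = "{x \<in> F. q x \<le> 1}" and ?C = "{x \<in> G. r x \<le> 1}"
  have "bounded_in E ((?A \<union> ?C) \<union> B)"
    by (intro bounded_in_Un[OF E(1)] banach_piece_ball_bounded F G B)
  then obtain H s where H: "banach_piece E H s" "\<And>t x. t > 0 \<Longrightarrow> x \<in> scale_set t ((?A \<union> ?C) \<union> B) \<Longrightarrow> x \<in> H \<and> s x \<le> t"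
    using bounded_in_banach_piece[OF E, of "(?A \<union> ?C) \<union> B"] by blast
  show thesis
  proof (rule that[OF H(1)])
    show "x \<in> H \<and> s x \<le> q x" if "x \<in> F" for x
      by (rule banach_piece_ball_absorbed[OF F H(1) _ that]) (intro H(2) scale_set_UnI, auto)
    show "x \<in> H \<and> s x \<le> r x" if "x \<in> G" for x
      by (rule banach_piece_ball_absorbed[OF G H(1) _ that]) (rule H(2), simp, rule scale_set_UnI(1), rule scale_set_UnI(2))
    show "x \<in> H \<and> s x \<le> t" if "t > 0" "x \<in> scale_set t B" for t x
      using that by (intro H(2) scale_set_UnI) auto
  qed
qed

text \<open>The image of the unit ball is bounded, hence contained in a Banach disk; this reduces
  maps into \<open>E\<close> to operators between Banach spaces.\<close>

lemma continuous_bounded_op_into_banach_piece: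
  assumes E: "locally_convex E" "locally_complete E" and N: "norm_on S p"
    and u: "linear_on S u" "continuous_map (norm_topology S p) E u"
  obtains F q where "banach_piece E F q" "bounded_op S p F q u"
proof -
  let ?B = "u ` {x \<in> S. p x \<le> 1}"
  have "bounded_in E ?B" by (rule bounded_in_image_ball[OF N u]) simp
  then obtain F q where F: "banach_piece E F q" "\<And>t x. t > 0 \<Longrightarrow> x \<in> scale_set t ?B \<Longrightarrow> x \<in> F \<and> q x \<le> t"
    using bounded_in_banach_piece[OF E, of ?B] by blast
  have "u x \<in> F \<and> q (u x) \<le> p x" if x: "x \<in> S" for x
  proof (cases "x = 0")
    case True
    then show ?thesis
      using linear_on_0[OF u(1) norm_on_subspace[OF N]] norm_on_zero[OF N] norm_on_zero[OF banach_pieceD(4)[OF F(1)]]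
        cvs.subspace_0[OF banach_pieceD(5)[OF F(1)]] by simp
  next
    case False
    note b = scale_set_ball[OF N x False]
    from b(2) obtain y where y: "y \<in> S" "p y \<le> 1" "x = complex_of_real (p x) *\<^sub>C y" unfolding scale_set_def by blast
    have "u x = complex_of_real (p x) *\<^sub>C u y" using linear_onD(2)[OF u(1) y(1), of "complex_of_real (p x)"] y(3) by metis
    then have "u x \<in> scale_set (p x) ?B" unfolding scale_set_def using y(1,2) by blast
    then show ?thesis using F(2)[OF b(1)] by blast
  qed
  then have "bounded_op S p F q u" by (intro bounded_opI[OF u(1), of _ _ 1]) auto
  then show thesis by (rule that[OF F(1)])
qed

text \<open>Condition (A) with \<open>F0\<close> in the role of B_N, \<open>F\<close> of B_M and
  \<open>F1\<close> of B_K. \<open>F0\<close> comes before \<open>F\<close> and \<nu>, so that \<nu>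
  can be adapted to (D\<Omega>). The contractive inclusions make \<open>F1\<close> a common space in
  which limits are compared.\<close>

definition condA_piece :: "'e::complex_vector topology \<Rightarrow> 'e set \<Rightarrow> ('e \<Rightarrow> real) \<Rightarrow> bool" where
  "condA_piece E F0 q0 \<longleftrightarrow> banach_piece E F0 q0 \<and> (\<forall>F q \<nu>. banach_piece E F q \<longrightarrow> \<nu> > 0 \<longrightarrow>
     (\<exists>F1 q1 C. banach_piece E F1 q1 \<and> C > 0 \<and> (\<forall>x\<in>F. x \<in> F1 \<and> q1 x \<le> q x) \<and> (\<forall>x\<in>F0. x \<in> F1 \<and> q1 x \<le> q0 x) \<and>
        (\<forall>e\<in>F. q e \<le> 1 \<longrightarrow> (\<forall>r>0. \<exists>x\<in>F1. \<exists>y\<in>F0. e = x + y \<and> q1 x \<le> r \<and> q0 y \<le> C / r powr \<nu>))))"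

lemma condition_A_piece:
  assumes E: "locally_convex E" "locally_complete E" and A: "condition_A E"
  obtains F0 q0 where "condA_piece E F0 q0"
proof -
  obtain B N where B: "fundamental_bounded E B" "\<And>N. B N \<subseteq> B (Suc N)"
    and AN: "\<And>M \<nu>. M \<ge> N \<Longrightarrow> \<nu> > 0 \<Longrightarrow> \<exists>K\<ge>M. \<exists>C>0::real. \<forall>r>0::real.
        B M \<subseteq> {x + y | x y. x \<in> scale_set r (B K) \<and> y \<in> scale_set (C / r powr \<nu>) (B N)}"
    using A unfolding condition_A_def by blast
  have Bm: "B m \<subseteq> B n" if "m \<le> n" for m n using B(2) that by (rule lift_Suc_mono_le)
  have bd: "bounded_in E (B n)" for n using B(1) unfolding fundamental_bounded_def by blast
  obtain F0 q0 where F0: "banach_piece E F0 q0" "\<And>t x. t > 0 \<Longrightarrow> x \<in> scale_set t (B N) \<Longrightarrow> x \<in> F0 \<and> q0 x \<le> t"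
    using bounded_in_banach_piece[OF E bd[of N]] by blast
  have "\<exists>F1 q1 C. banach_piece E F1 q1 \<and> C > 0 \<and> (\<forall>x\<in>F. x \<in> F1 \<and> q1 x \<le> q x) \<and> (\<forall>x\<in>F0. x \<in> F1 \<and> q1 x \<le> q0 x) \<and>
        (\<forall>e\<in>F. q e \<le> 1 \<longrightarrow> (\<forall>r>0. \<exists>x\<in>F1. \<exists>y\<in>F0. e = x + y \<and> q1 x \<le> r \<and> q0 y \<le> C / r powr \<nu>))"
    if F: "banach_piece E F q" and \<nu>: "\<nu> > 0" for F q \<nu>
  proof -
    obtain M0 where M0: "{x \<in> F. q x \<le> 1} \<subseteq> B M0"
      using B(1) banach_piece_ball_bounded[OF F] unfolding fundamental_bounded_def by blast
    \<comment> \<open>The index of a bounded set containing the ball of \<open>F\<close> is raised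
      to at least \<open>N\<close>, since (A) speaks of such indices.\<close>
    let ?M = "max M0 N"
    obtain K C where K: "C > 0" "\<And>r::real. r > 0 \<Longrightarrow>
        B ?M \<subseteq> {x + y | x y. x \<in> scale_set r (B K) \<and> y \<in> scale_set (C / r powr \<nu>) (B N)}"
      using AN[OF _ \<nu>, of ?M] by auto
    obtain F1 q1 where F1: "banach_piece E F1 q1" "\<And>x. x \<in> F \<Longrightarrow> x \<in> F1 \<and> q1 x \<le> q x" "\<And>x. x \<in> F0 \<Longrightarrow> x \<in> F1 \<and> q1 x \<le> q0 x"
      "\<And>t x. t > 0 \<Longrightarrow> x \<in> scale_set t (B K) \<Longrightarrow> x \<in> F1 \<and> q1 x \<le> t"
      using banach_piece_directed[OF E F F0(1) bd[of K]] by metis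
    have "\<exists>x\<in>F1. \<exists>y\<in>F0. e = x + y \<and> q1 x \<le> r \<and> q0 y \<le> C / r powr \<nu>" if e: "e \<in> F" "q e \<le> 1" and r: "r > 0" for e r
    proof -
      have "e \<in> B ?M" using e M0 Bm[of M0 ?M] by auto
      then obtain x y where xy: "e = x + y" "x \<in> scale_set r (B K)" "y \<in> scale_set (C / r powr \<nu>) (B N)"
        using K(2)[OF r] by blast
      have "C / r powr \<nu> > 0" using K(1) r by simp
      then show ?thesis using F1(4)[OF r xy(2)] F0(2)[OF _ xy(3)] xy(1) by blast
    qed
    then show ?thesis using F1(1-3) K(1) by blast
  qed
  then show thesis by (intro that[of F0 q0]) (simp add: condA_piece_def F0(1))
qed

lemma homeomorphic_exhaustion:
  assumes f: "linear_on (topspace E) f" "homeomorphic_map E K f" and E: "cvs.subspace (topspace E)" and K: "exhaustion K S p"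
  shows "exhaustion E (\<lambda>n. {x \<in> topspace E. f x \<in> S n}) (\<lambda>n x. p n (f x))"
proof -
  obtain g where g: "homeomorphic_maps E K f g" using f(2) homeomorphic_map_maps by blast
  then have gf: "\<And>x. x \<in> topspace E \<Longrightarrow> g (f x) = x" and fg: "\<And>y. y \<in> topspace K \<Longrightarrow> f (g y) = y"
    and cf: "continuous_map E K f" and cg: "continuous_map K E g" unfolding homeomorphic_maps_def by auto
  have fE: "f x \<in> topspace K" if "x \<in> topspace E" for x using continuous_map_image_subset_topspace[OF cf] that by blast
  have gK: "g y \<in> topspace E" if "y \<in> topspace K" for y using continuous_map_image_subset_topspace[OF cg] that by blast
  let ?S = "\<lambda>n. {x \<in> topspace E. f x \<in> S n}"
  have N: "norm_on (?S n) (\<lambda>x. p n (f x))" for n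
  proof -
    note NS = exhaustionD(3)[OF K, of n] and sub = exhaustionD(5)[OF K, of n]
    have "f x = 0 \<longleftrightarrow> x = 0" if "x \<in> topspace E" for x
      using gf[OF that] gf[OF cvs.subspace_0[OF E]] linear_on_0[OF f(1) E] by metis
    moreover have "cvs.subspace (?S n)"
      using cvs.subspace_0[OF E] cvs.subspace_add[OF E] cvs.subspace_scale[OF E] linear_on_0[OF f(1) E]
        cvs.subspace_0[OF sub] cvs.subspace_add[OF sub] cvs.subspace_scale[OF sub]
      by (intro cvs.subspaceI) (auto simp: linear_onD[OF f(1)])
    ultimately show ?thesis
      unfolding norm_on_def
      using norm_on_nonneg[OF NS] norm_on_eq_0[OF NS] norm_on_scale[OF NS] norm_on_add[OF NS]
      by (simp add: linear_onD[OF f(1)])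
  qed
  have B: "banach_on (?S n) (\<lambda>x. p n (f x))" for n
    unfolding banach_on_def
  proof (intro conjI N allI impI)
    fix u :: "nat \<Rightarrow> 'a"
    assume u: "range u \<subseteq> ?S n \<and> (\<forall>e>0. \<exists>M. \<forall>i\<ge>M. \<forall>j\<ge>M. p n (f (u i - u j)) < e)"
    have uE: "u i \<in> topspace E" "f (u i) \<in> S n" for i using u by auto
    have d: "f (u i - u j) = f (u i) - f (u j)" for i j using linear_on_diff[OF f(1) E uE(1) uE(1)] .
    have "range (\<lambda>i. f (u i)) \<subseteq> S n \<and> (\<forall>e>0. \<exists>M. \<forall>i\<ge>M. \<forall>j\<ge>M. p n (f (u i) - f (u j)) < e)"
      using u unfolding d by auto
    then obtain z where z: "z \<in> S n" "(\<lambda>i. p n (f (u i) - z)) \<longlonglongrightarrow> 0"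
      using exhaustionD(4)[OF K, of n] unfolding banach_on_def by blast
    have zK: "z \<in> topspace K" using z(1) exhaustionD(6)[OF K] by blast
    have "f (u i - g z) = f (u i) - z" for i using linear_on_diff[OF f(1) E uE(1) gK[OF zK]] fg[OF zK] by simp
    then show "\<exists>x\<in>?S n. (\<lambda>i. p n (f (u i - x))) \<longlonglongrightarrow> 0"
      using z zK gK fg by (intro bexI[of _ "g z"]) auto
  qed
  have c: "continuous_map (norm_topology (?S n) (\<lambda>x. p n (f x))) E (\<lambda>x. x)" for n
  proof -
    have "bounded_op (?S n) (\<lambda>x. p n (f x)) (S n) (p n) f"
      using linear_on_subset[OF f(1)] by (intro bounded_opI[of _ _ _ _ 1]) auto
    then have "continuous_map (norm_topology (?S n) (\<lambda>x. p n (f x))) (norm_topology (S n) (p n)) f"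
      using N exhaustionD(3)[OF K] by (intro bounded_op_continuous)
    then have "continuous_map (norm_topology (?S n) (\<lambda>x. p n (f x))) E (g \<circ> ((\<lambda>x. x) \<circ> f))"
      using continuous_map_compose[OF _ continuous_map_compose[OF banach_pieceD(2)[OF exhaustionD(1)[OF K]] cg]] by (simp add: o_def)
    then show ?thesis by (rule continuous_map_eq) (simp add: gf)
  qed
  show ?thesis
    unfolding exhaustion_def banach_piece_def
    using B c exhaustion_mono[OF K le_SucI[OF order_refl]] fE exhaustionD(2)[OF K] by fastforce
qed

section \<open>Approximation of rank one operators\<close>

text \<open>The product inequality of (D\<Omega>) in additive form, with a free scale l and s =
  \<theta>/(1 - \<theta>). A functional can be split along a sum of two seminorms, and this form
  survives a change of the norms by constants.\<close>

definition interp_ineq :: "(nat \<Rightarrow> 'a set) \<Rightarrow> (nat \<Rightarrow> 'a \<Rightarrow> real) \<Rightarrow> nat \<Rightarrow> nat \<Rightarrow> nat \<Rightarrow> bool" where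
  "interp_ineq S p n m k \<longleftrightarrow> (\<exists>s>0. \<exists>C>0. \<forall>l>0. \<forall>z\<in>S n. p m z \<le> C * (l * p n z + l powr (- s) * p k z))"

definition DOmega :: "(nat \<Rightarrow> 'a set) \<Rightarrow> (nat \<Rightarrow> 'a \<Rightarrow> real) \<Rightarrow> bool" where
  "DOmega S p \<longleftrightarrow> (\<forall>n. \<exists>m\<ge>n. \<forall>k\<ge>m. interp_ineq S p n m k)"

text \<open>For u = l a and w = l^(-s) b, where s = \<theta>/(1 - \<theta>), the powers of l cancel
  in u^\<theta> w^(1 - \<theta>), and a weighted geometric mean of u and w is at most their
  maximum.\<close>

lemma powr_interpolation_le:
  fixes a b l \<theta> :: real
  assumes a: "0 \<le> a" and b: "0 \<le> b" and \<theta>: "0 < \<theta>" "\<theta> < 1" and l: "0 < l"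
  shows "a powr \<theta> * b powr (1 - \<theta>) \<le> l * a + l powr (- (\<theta> / (1 - \<theta>))) * b"
proof -
  let ?s = "\<theta> / (1 - \<theta>)"
  define u w where "u = l * a" and "w = l powr (- ?s) * b"
  have u: "0 \<le> u" and w: "0 \<le> w" unfolding u_def w_def using a b l by simp_all
  have "u powr \<theta> * w powr (1 - \<theta>) = (l powr \<theta> * l powr (- ?s * (1 - \<theta>))) * (a powr \<theta> * b powr (1 - \<theta>))"
    unfolding u_def w_def using a b l by (simp add: powr_mult powr_powr)
  also have "l powr \<theta> * l powr (- ?s * (1 - \<theta>)) = 1"
    unfolding powr_add[symmetric] using l \<theta> by simp
  finally have eq: "a powr \<theta> * b powr (1 - \<theta>) = u powr \<theta> * w powr (1 - \<theta>)" by simp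
  have "u powr \<theta> * w powr (1 - \<theta>) \<le> max u w powr \<theta> * max u w powr (1 - \<theta>)"
    using u w \<theta> by (intro mult_mono powr_mono2) auto
  also have "\<dots> = max u w" unfolding powr_add[symmetric] using u w by simp
  also have "\<dots> \<le> u + w" using u w by simp
  finally show ?thesis unfolding eq u_def w_def .
qed

text \<open>The given exhaustion is interleaved with the spectrum for which the condition holds:
  level \<open>n\<close> goes into \<open>n'\<close>, the condition gives \<open>m'\<close>, which
  goes back into \<open>m\<close>, and each \<open>k\<close> goes into some \<open>k'\<close>. The
  levels \<open>n'\<close>, \<open>m'\<close>, \<open>m\<close> are fixed before \<open>k\<close>,
  as the quantifiers require.\<close>

lemma condition_DOmega_transfer:
  assumes H: "Hausdorff_space Z" and D: "condition_DOmega Z" and S: "exhaustion Z S p"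
  shows "DOmega S p"
  unfolding DOmega_def
proof
  fix n
  obtain S' p' where sp': "banach_spectrum S' p'" "Z = Ind S' p'"
    and D': "\<And>n. \<exists>m\<ge>n. \<forall>k\<ge>m. \<exists>\<theta>\<in>{0<..<1::real}. \<exists>C>0::real. \<forall>z\<in>S' n.
        p' m z \<le> C * p' n z powr \<theta> * p' k z powr (1 - \<theta>)"
    using D unfolding condition_DOmega_def by blast
  have S': "exhaustion Z S' p'" using banach_spectrum_exhaustion sp' by simp
  note fac = exhaustion_factor[OF H _ exhaustionD(4) linear_on_id banach_pieceD(2)[OF exhaustionD(1)]]
  obtain n' where n': "bounded_op (S n) (p n) (S' n') (p' n') (\<lambda>x. x)" by (rule fac[OF S' S S])
  obtain m' where m': "m' \<ge> n'" "\<And>k. k \<ge> m' \<Longrightarrow> \<exists>\<theta>\<in>{0<..<1::real}. \<exists>C>0::real. \<forall>z\<in>S' n'.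
        p' m' z \<le> C * p' n' z powr \<theta> * p' k z powr (1 - \<theta>)" using D' by blast
  obtain m where m: "m \<ge> n" "bounded_op (S' m') (p' m') (S m) (p m) (\<lambda>x. x)" by (rule fac[OF S S' S'])
  obtain c1 where c1: "c1 > 0" "\<And>x. x \<in> S n \<Longrightarrow> p' n' x \<le> c1 * p n x" by (rule bounded_op_bound[OF exhaustionD(3)[OF S] n']) blast
  obtain c2 where c2: "c2 > 0" "\<And>x. x \<in> S' m' \<Longrightarrow> p m x \<le> c2 * p' m' x" by (rule bounded_op_bound[OF exhaustionD(3)[OF S'] m(2)]) blast
  have "interp_ineq S p n m k" if k: "k \<ge> m" for k
  proof -
    obtain k' where k': "k' \<ge> m'" "bounded_op (S k) (p k) (S' k') (p' k') (\<lambda>x. x)" by (rule fac[OF S' S S])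
    obtain c3 where c3: "c3 > 0" "\<And>x. x \<in> S k \<Longrightarrow> p' k' x \<le> c3 * p k x" by (rule bounded_op_bound[OF exhaustionD(3)[OF S] k'(2)]) blast
    obtain \<theta> C where \<theta>: "0 < \<theta>" "\<theta> < 1" and C: "C > 0" and
      le: "\<And>z. z \<in> S' n' \<Longrightarrow> p' m' z \<le> C * p' n' z powr \<theta> * p' k' z powr (1 - \<theta>)"
      using m'(2)[OF k'(1)] by auto
    let ?s = "\<theta> / (1 - \<theta>)"
    have "p m z \<le> (c2 * C * (c1 + c3)) * (l * p n z + l powr (- ?s) * p k z)" if l: "l > 0" and z: "z \<in> S n" for l z
    proof -
      have z': "z \<in> S' n'" using bounded_op_mem[OF n' z] .
      have zm: "z \<in> S' m'" "z \<in> S' k'" using z' exhaustion_mono[OF S' m'(1)] exhaustion_mono[OF S', of n' k'] m'(1) k'(1) by auto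
      have zk: "z \<in> S k" using z exhaustion_mono[OF S, of n k] m(1) k by auto
      have nn: "0 \<le> p n z" "0 \<le> p k z" "0 \<le> p' n' z" "0 \<le> p' k' z"
        using norm_on_nonneg[OF exhaustionD(3)[OF S] z] norm_on_nonneg[OF exhaustionD(3)[OF S] zk]
          norm_on_nonneg[OF exhaustionD(3)[OF S'] z'] norm_on_nonneg[OF exhaustionD(3)[OF S'] zm(2)] by blast+
      have "p m z \<le> c2 * p' m' z" using c2(2)[OF zm(1)] .
      also have "p' m' z \<le> C * (p' n' z powr \<theta> * p' k' z powr (1 - \<theta>))" using le[OF z'] by (simp add: mult.assoc)
      also have "p' n' z powr \<theta> * p' k' z powr (1 - \<theta>) \<le> l * p' n' z + l powr (- ?s) * p' k' z"
        by (rule powr_interpolation_le[OF nn(3,4) \<theta> l])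
      also have "\<dots> \<le> l * (c1 * p n z) + l powr (- ?s) * (c3 * p k z)"
        using c1(2)[OF z] c3(2)[OF zk] l by (intro add_mono mult_left_mono) auto
      also have "\<dots> \<le> l * ((c1 + c3) * p n z) + l powr (- ?s) * ((c1 + c3) * p k z)"
        using c1(1) c3(1) nn l by (intro add_mono mult_left_mono mult_right_mono) auto
      finally show ?thesis using c2(1) C by (simp add: algebra_simps)
    qed
    moreover have "c2 * C * (c1 + c3) > 0" using c1 c2 c3 C by simp
    moreover have "?s > 0" using \<theta> by simp
    ultimately show ?thesis unfolding interp_ineq_def by blast
  qed
  then show "\<exists>m\<ge>n. \<forall>k\<ge>m. interp_ineq S p n m k" using m(1) by blast
qed

lemma banach_on_operator_series:
  fixes D :: "nat \<Rightarrow> 'a::complex_vector \<Rightarrow> 'b::complex_vector"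
  assumes B: "banach_on F q" and N: "norm_on S p"
    and lin: "\<And>j. linear_on S (D j)" and inF: "\<And>j x. x \<in> S \<Longrightarrow> D j x \<in> F"
    and le: "\<And>j x. x \<in> S \<Longrightarrow> q (D j x) \<le> g j * p x" and g: "(g has_sum t) UNIV"
  shows "\<exists>G. linear_on S G \<and> (\<forall>x\<in>S. G x \<in> F \<and> q (G x) \<le> t * p x \<and>
    (\<lambda>n. q (G x - (\<Sum>j<n. D j x))) \<longlonglongrightarrow> 0)"
proof -
  have hs: "((\<lambda>j. g j * p x) has_sum (t * p x)) UNIV" for x using g by (rule has_sum_cmult_left)
  note sm = summable_on_le_has_sum[OF hs norm_on_nonneg[OF banach_on_norm_on[OF B] inF] le]
  have s: "(\<lambda>j. q (D j x)) summable_on UNIV" "infsum (\<lambda>j. q (D j x)) UNIV \<le> t * p x" if "x \<in> S" for x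
    using sm[OF that that] by blast+
  obtain G where G: "linear_on S G" "\<forall>x\<in>S. G x \<in> F \<and>
    ((\<lambda>A. q (G x - (\<Sum>j\<in>A. D j x))) \<longlongrightarrow> 0) (finite_subsets_at_top UNIV) \<and> q (G x) \<le> infsum (\<lambda>j. q (D j x)) UNIV"
    using banach_on_operator_sum[OF B norm_on_subspace[OF N], of UNIV D] lin inF s(1) by blast
  have "G x \<in> F \<and> q (G x) \<le> t * p x \<and> (\<lambda>n. q (G x - (\<Sum>j<n. D j x))) \<longlonglongrightarrow> 0" if x: "x \<in> S" for x
  proof (intro conjI)
    show "G x \<in> F" using G(2) x by blast
    have "q (G x) \<le> infsum (\<lambda>j. q (D j x)) UNIV" using G(2) x by blast
    then show "q (G x) \<le> t * p x" using s(2)[OF x] by linarith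
    have "((\<lambda>A. q (G x - (\<Sum>j\<in>A. D j x))) \<longlongrightarrow> 0) (finite_subsets_at_top UNIV)" using G(2) x by blast
    then show "(\<lambda>n. q (G x - (\<Sum>j<n. D j x))) \<longlonglongrightarrow> 0"
      by (rule filterlim_compose[OF _ filterlim_lessThan_finite_subsets_at_top])
  qed
  with G(1) show ?thesis by blast
qed

lemma tendsto_0_le:
  fixes f g :: "'i \<Rightarrow> real"
  assumes "(g \<longlongrightarrow> 0) l" "eventually (\<lambda>i. 0 \<le> f i) l" "eventually (\<lambda>i. f i \<le> g i) l"
  shows "(f \<longlongrightarrow> 0) l"
  by (rule tendsto_sandwich[OF assms(2,3) tendsto_const assms(1)])

text \<open>The piece \<open>F1\<close> depends neither on \<open>\<epsilon>\<close> nor on \<open>\<phi>\<close> and \<open>e\<close>, and \<open>C\<close> does not depend on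
  \<open>\<phi>\<close> and \<open>e\<close>; this is what allows the approximants of the terms of a series to be summed.\<close>

definition rank_one_approx :: "'e::complex_vector set \<Rightarrow> ('e \<Rightarrow> real) \<Rightarrow> 'e set \<Rightarrow> ('e \<Rightarrow> real) \<Rightarrow> 'e set \<Rightarrow> ('e \<Rightarrow> real) \<Rightarrow>
    (nat \<Rightarrow> 'z::complex_vector set) \<Rightarrow> (nat \<Rightarrow> 'z \<Rightarrow> real) \<Rightarrow> nat \<Rightarrow> nat \<Rightarrow> nat \<Rightarrow> bool" where
  "rank_one_approx F0 q0 F q F1 q1 S p n m k \<longleftrightarrow> (\<forall>\<epsilon>>0. \<exists>C>0. \<forall>\<phi> e. linear_on (S m) \<phi> \<longrightarrow>
     (\<forall>z\<in>S m. cmod (\<phi> z) \<le> p m z) \<longrightarrow> e \<in> F \<longrightarrow> q e \<le> 1 \<longrightarrow>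
     (\<exists>D. linear_on (S k) D \<and> (\<forall>z\<in>S k. D z \<in> F1 \<and> q1 (D z) \<le> C * p k z) \<and>
       (\<forall>z\<in>S n. \<phi> z *\<^sub>C e - D z \<in> F0 \<and> q0 (\<phi> z *\<^sub>C e - D z) \<le> \<epsilon> * p n z)))"

text \<open>Splitting \<open>\<phi>\<close> at the scales \<open>\<tau> 4\<^sup>-\<^sup>l\<close> gives a telescoping series of functionals; the vector
  \<open>e\<close> is split at scales \<open>r l\<close> for which the two resulting series of rank one operators, with values
  in \<open>F1\<close> and in \<open>F0\<close>, both converge geometrically.\<close>

lemma rank_one_approximation:
  fixes E :: "'e::complex_vector topology" and Z :: "'z::complex_vector topology"
  assumes A: "condA_piece E F0 q0" and S: "exhaustion Z S p" and nmk: "n \<le> m" "m \<le> k"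
    and I: "interp_ineq S p n m k" and F: "banach_piece E F q"
  shows "\<exists>F1 q1. banach_piece E F1 q1 \<and> (\<forall>x\<in>F. x \<in> F1 \<and> q1 x \<le> q x) \<and> (\<forall>x\<in>F0. x \<in> F1 \<and> q1 x \<le> q0 x) \<and>
    rank_one_approx F0 q0 F q F1 q1 S p n m k"
proof -
  obtain s C where s: "s > 0" and C: "C > 0"
    and ineq: "\<And>l z. l > 0 \<Longrightarrow> z \<in> S n \<Longrightarrow> p m z \<le> C * (l * p n z + l powr (- s) * p k z)"
    using I unfolding interp_ineq_def by blast
  \<comment> \<open>Chosen after \<open>s\<close> so that the second parts of the split vector grow
    like 2^l: with 4 g = 4^(s+1) one has (4 g)^(\<nu> l) = 2^l.\<close>
  define \<nu> where "\<nu> = 1 / (2 * (s + 1))"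
  have \<nu>: "\<nu> > 0" unfolding \<nu>_def using s by simp
  have F0: "banach_piece E F0 q0" using A unfolding condA_piece_def by blast
  have "\<exists>F1 q1 C. banach_piece E F1 q1 \<and> C > 0 \<and> (\<forall>x\<in>F. x \<in> F1 \<and> q1 x \<le> q x) \<and> (\<forall>x\<in>F0. x \<in> F1 \<and> q1 x \<le> q0 x) \<and>
      (\<forall>e\<in>F. q e \<le> 1 \<longrightarrow> (\<forall>r>0. \<exists>x\<in>F1. \<exists>y\<in>F0. e = x + y \<and> q1 x \<le> r \<and> q0 y \<le> C / r powr \<nu>))"
    using conjunct2[OF A[unfolded condA_piece_def], rule_format, OF F \<nu>] .
  then obtain F1 q1 CA where F1: "banach_piece E F1 q1" and CA: "CA > 0" and FF1': "\<forall>x\<in>F. x \<in> F1 \<and> q1 x \<le> q x"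
    and F0F1': "\<forall>x\<in>F0. x \<in> F1 \<and> q1 x \<le> q0 x"
    and dec': "\<forall>e\<in>F. q e \<le> 1 \<longrightarrow> (\<forall>r>0. \<exists>x\<in>F1. \<exists>y\<in>F0. e = x + y \<and> q1 x \<le> r \<and> q0 y \<le> CA / r powr \<nu>)"
    by (elim exE conjE)
  note FF1 = bspec[OF FF1'] and F0F1 = bspec[OF F0F1'] and dec = dec'[rule_format]
  note NF1 = banach_pieceD(4)[OF F1] and NF0 = banach_pieceD(4)[OF F0]
  note sF1 = banach_pieceD(5)[OF F1] and sF0 = banach_pieceD(5)[OF F0]
  note Nn = exhaustionD(3)[OF S, of n] and Nk = exhaustionD(3)[OF S, of k]
  have Snk: "S n \<subseteq> S k" and Snm: "S n \<subseteq> S m" using exhaustion_mono[OF S] nmk by auto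
  \<comment> \<open>The factor by which the power -s of the scale grows when the scale is
    quartered.\<close>
  define g where "g = 4 powr s"
  have g1: "g \<ge> 1" unfolding g_def using s by (simp add: ge_one_powr_ge_zero)
  \<comment> \<open>g^-l compensates the growth of the functionals on \<open>S k\<close>; the
    additional 4^-l makes the series in \<open>F1\<close> converge.\<close>
  define r where "r l = (1 / (4 * g)) ^ l" for l :: nat
  have r0: "r l > 0" for l unfolding r_def using g1 by simp
  have rbase: "(1 / (4 * g)) powr \<nu> = 1 / 2"
  proof -
    have "4 * g = 4 powr (s + 1)" unfolding g_def by (simp add: powr_add)
    then have "(1 / (4 * g)) powr \<nu> = (4 powr (- (s + 1))) powr \<nu>" by (simp only: powr_minus_divide)
    also have "\<dots> = 4 powr (- (s + 1) * \<nu>)" by (rule powr_powr)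
    also have "- (s + 1) * \<nu> = - (1 / 2)"
    proof -
      have "(s + 1) * (1 / (2 * (s + 1))) = 1 / 2" using s by (simp add: divide_simps)
      then show ?thesis unfolding \<nu>_def minus_mult_left[symmetric] by (rule arg_cong)
    qed
    also have "4 powr (- (1 / 2)) = (1 / 2 :: real)" by (simp add: powr_minus_divide powr_half_sqrt)
    finally show ?thesis .
  qed
  have rp: "r l powr \<nu> = (1 / 2) ^ l" for l
  proof (induction l)
    case (Suc l)
    have "r (Suc l) powr \<nu> = (1 / (4 * g)) powr \<nu> * r l powr \<nu>"
      unfolding r_def power_Suc using g1 by (intro powr_mult)
    then show ?case using Suc rbase by simp
  qed (simp add: r_def)
  have "rank_one_approx F0 q0 F q F1 q1 S p n m k"
    unfolding rank_one_approx_def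
  proof (intro allI impI)
    fix \<epsilon> :: real assume \<epsilon>: "\<epsilon> > 0"
    \<comment> \<open>The series in \<open>F0\<close> will be bounded by 2 C \<tau> CA / (1 - 1/2) =
      4 C CA \<tau>, and this has to be \<epsilon>.\<close>
    define \<tau> where "\<tau> = \<epsilon> / (4 * C * CA)"
    have \<tau>: "\<tau> > 0" unfolding \<tau>_def using \<epsilon> C CA by simp
    define lam where "lam l = \<tau> * (1 / 4) ^ l" for l :: nat
    have lam0: "lam l > 0" for l unfolding lam_def using \<tau> by simp
    define G where "G = \<tau> powr (- s)"
    have G0: "G > 0" unfolding G_def using \<tau> by simp
    have quarter: "(1 / 4) powr (- s) = g" unfolding g_def by (simp add: powr_minus powr_divide inverse_eq_divide)
    have lams: "lam l powr (- s) = G * g ^ l" for l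
    proof (induction l)
      case (Suc l)
      have "lam (Suc l) = (1 / 4) * lam l" unfolding lam_def by simp
      then have "lam (Suc l) powr (- s) = (1 / 4) powr (- s) * lam l powr (- s)"
        using lam0[of l] by (simp only: powr_mult)
      then show ?case using Suc quarter by (simp only: power_Suc mult_ac)
    qed (simp add: lam_def G_def)
    \<comment> \<open>The first summand bounds \<open>\<psi> 0\<close> times e, the second the
      series of the \<open>\<delta> l\<close> times \<open>x l\<close>, a geometric series of ratio
      1/4.\<close>
    define B where "B = C * G + 2 * C * G * g * (4 / 3)"
    have B0: "B > 0" unfolding B_def using C G0 g1 by (intro add_pos_pos mult_pos_pos) auto
    have main: "\<exists>D. linear_on (S k) D \<and> (\<forall>z\<in>S k. D z \<in> F1 \<and> q1 (D z) \<le> B * p k z) \<and>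
       (\<forall>z\<in>S n. \<phi> z *\<^sub>C e - D z \<in> F0 \<and> q0 (\<phi> z *\<^sub>C e - D z) \<le> \<epsilon> * p n z)"
      if \<phi>: "linear_on (S m) \<phi>" "\<forall>z\<in>S m. cmod (\<phi> z) \<le> p m z" and e: "e \<in> F" "q e \<le> 1" for \<phi> e
    proof -
      \<comment> \<open>\<open>\<psi> l\<close> is the part of \<phi> at scale \<open>lam l\<close>
        that extends to \<open>S k\<close>; the rest is of size \<open>lam l\<close> on
        \<open>S n\<close>.\<close>
      have "\<exists>\<psi>. linear_on (S k) \<psi> \<and> (\<forall>z\<in>S k. cmod (\<psi> z) \<le> (C * (G * g ^ l)) * p k z) \<and>
          (\<forall>z\<in>S n. cmod (\<phi> z - \<psi> z) \<le> (C * lam l) * p n z)" for l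
      proof (rule functional_decomposition[OF Snk])
        show "seminorm_on (S n) (\<lambda>z. (C * lam l) * p n z)"
          using C lam0[of l] by (intro seminorm_on_cmult norm_on_seminorm_on[OF Nn]) auto
        show "seminorm_on (S k) (\<lambda>z. (C * (G * g ^ l)) * p k z)"
          using C G0 g1 by (intro seminorm_on_cmult norm_on_seminorm_on[OF Nk]) auto
        show "linear_on (S n) \<phi>" using linear_on_subset[OF \<phi>(1) Snm] .
        show "cmod (\<phi> z) \<le> (C * lam l) * p n z + (C * (G * g ^ l)) * p k z" if "z \<in> S n" for z
        proof -
          have "cmod (\<phi> z) \<le> p m z" using \<phi>(2) that Snm by blast
          also have "\<dots> \<le> C * (lam l * p n z + lam l powr (- s) * p k z)" by (rule ineq[OF lam0 that])
          finally show ?thesis unfolding lams by (simp add: algebra_simps)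
        qed
      qed blast
      then obtain \<psi> where \<psi>: "\<And>l. linear_on (S k) (\<psi> l)" "\<And>l z. z \<in> S k \<Longrightarrow> cmod (\<psi> l z) \<le> (C * (G * g ^ l)) * p k z"
        "\<And>l z. z \<in> S n \<Longrightarrow> cmod (\<phi> z - \<psi> l z) \<le> (C * lam l) * p n z" by metis
      have "\<exists>x y. x \<in> F1 \<and> y \<in> F0 \<and> e = x + y \<and> q1 x \<le> r l \<and> q0 y \<le> CA / r l powr \<nu>" for l
        using dec[OF e r0] by blast
      then obtain x y where xy: "\<And>l. x l \<in> F1" "\<And>l. y l \<in> F0" "\<And>l. e = x l + y l" "\<And>l. q1 (x l) \<le> r l"
        "\<And>l. q0 (y l) \<le> CA / r l powr \<nu>" by metis
      have y2: "q0 (y l) \<le> CA * 2 ^ l" for l using xy(5)[of l] unfolding rp by (simp add: power_one_over)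
      \<comment> \<open>On \<open>S n\<close> the functional \<phi> is \<open>\<psi> 0\<close> plus
        the sum of all \<open>\<delta> l\<close>. These are small on \<open>S n\<close> and grow at
        most like g^l on \<open>S k\<close>.\<close>
      define \<delta> where "\<delta> l z = \<psi> (Suc l) z - \<psi> l z" for l z
      have \<delta>lin: "linear_on (S k) (\<delta> l)" for l unfolding \<delta>_def using \<psi>(1) by (intro linear_on_sub)
      have \<delta>k: "cmod (\<delta> l z) \<le> (2 * C * G * g) * g ^ l * p k z" if z: "z \<in> S k" for l z
      proof -
        have "cmod (\<delta> l z) \<le> cmod (\<psi> (Suc l) z) + cmod (\<psi> l z)" unfolding \<delta>_def by (rule norm_triangle_ineq4)
        also have "\<dots> \<le> (C * (G * g ^ Suc l)) * p k z + (C * (G * g ^ l)) * p k z" by (intro add_mono \<psi>(2) z)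
        also have "(C * (G * g ^ l)) * p k z \<le> (C * (G * g ^ Suc l)) * p k z"
          using C G0 g1 norm_on_nonneg[OF Nk z] by (intro mult_right_mono mult_left_mono) auto
        finally show ?thesis by (simp add: algebra_simps)
      qed
      have \<delta>n: "cmod (\<delta> l z) \<le> (2 * C * \<tau>) * (1 / 4) ^ l * p n z" if z: "z \<in> S n" for l z
      proof -
        have "\<delta> l z = (\<phi> z - \<psi> l z) - (\<phi> z - \<psi> (Suc l) z)" unfolding \<delta>_def by simp
        then have "cmod (\<delta> l z) \<le> cmod (\<phi> z - \<psi> l z) + cmod (\<phi> z - \<psi> (Suc l) z)" by (simp only: norm_triangle_ineq4)
        also have "\<dots> \<le> (C * lam l) * p n z + (C * lam (Suc l)) * p n z" by (intro add_mono \<psi>(3) z)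
        also have "(C * lam (Suc l)) * p n z \<le> (C * lam l) * p n z"
          using C \<tau> norm_on_nonneg[OF Nn z] unfolding lam_def by (intro mult_right_mono mult_left_mono) auto
        finally show ?thesis unfolding lam_def by (simp add: algebra_simps)
      qed
      have hs1: "((\<lambda>l. (2 * C * G * g) * (1 / 4) ^ l) has_sum (2 * C * G * g / (1 - 1 / 4))) UNIV"
        using C G0 g1 by (intro has_sum_geometric_real) auto
      have le1: "q1 (\<delta> l z *\<^sub>C x l) \<le> ((2 * C * G * g) * (1 / 4) ^ l) * p k z" if z: "z \<in> S k" for l z
      proof -
        have "q1 (\<delta> l z *\<^sub>C x l) = cmod (\<delta> l z) * q1 (x l)" by (rule norm_on_scale[OF NF1 xy(1)])
        also have "\<dots> \<le> ((2 * C * G * g) * g ^ l * p k z) * r l"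
          using \<delta>k[OF z] xy(4) norm_on_nonneg[OF NF1 xy(1)] C G0 g1 norm_on_nonneg[OF Nk z] by (intro mult_mono) auto
        also have "\<dots> = ((2 * C * G * g) * (g ^ l * r l)) * p k z" by (simp only: mult_ac)
        also have "g ^ l * r l = (1 / 4) ^ l" unfolding r_def power_mult_distrib[symmetric] using g1 by simp
        finally show ?thesis .
      qed
      have in1: "\<delta> l z *\<^sub>C x l \<in> F1" if "z \<in> S k" for l z by (rule cvs.subspace_scale[OF sF1 xy(1)])
      have "\<exists>G1. linear_on (S k) G1 \<and> (\<forall>z\<in>S k. G1 z \<in> F1 \<and> q1 (G1 z) \<le> (2 * C * G * g / (1 - 1 / 4)) * p k z \<and>
          (\<lambda>L. q1 (G1 z - (\<Sum>l<L. \<delta> l z *\<^sub>C x l))) \<longlonglongrightarrow> 0)"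
        by (rule banach_on_operator_series[OF banach_pieceD(1)[OF F1] Nk linear_on_rank_one[OF \<delta>lin] in1 le1 hs1])
      then obtain G1 where G1: "linear_on (S k) G1" "\<forall>z\<in>S k. G1 z \<in> F1 \<and> q1 (G1 z) \<le> (2 * C * G * g / (1 - 1 / 4)) * p k z \<and>
          (\<lambda>L. q1 (G1 z - (\<Sum>l<L. \<delta> l z *\<^sub>C x l))) \<longlonglongrightarrow> 0" by (elim exE conjE)
      have G1F: "G1 z \<in> F1" and G1le: "q1 (G1 z) \<le> (2 * C * G * g / (1 - 1 / 4)) * p k z"
        and G1lim: "(\<lambda>L. q1 (G1 z - (\<Sum>l<L. \<delta> l z *\<^sub>C x l))) \<longlonglongrightarrow> 0" if "z \<in> S k" for z
        using bspec[OF G1(2) that] by blast+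
      have hs2: "((\<lambda>l. (2 * C * \<tau> * CA) * (1 / 2) ^ l) has_sum (2 * C * \<tau> * CA / (1 - 1 / 2))) UNIV"
        using C \<tau> CA by (intro has_sum_geometric_real) auto
      have le2: "q0 (\<delta> l z *\<^sub>C y l) \<le> ((2 * C * \<tau> * CA) * (1 / 2) ^ l) * p n z" if z: "z \<in> S n" for l z
      proof -
        have "q0 (\<delta> l z *\<^sub>C y l) = cmod (\<delta> l z) * q0 (y l)" by (rule norm_on_scale[OF NF0 xy(2)])
        also have "\<dots> \<le> ((2 * C * \<tau>) * (1 / 4) ^ l * p n z) * (CA * 2 ^ l)"
          using \<delta>n[OF z] y2 norm_on_nonneg[OF NF0 xy(2)] C \<tau> norm_on_nonneg[OF Nn z] by (intro mult_mono) auto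
        also have "\<dots> = ((2 * C * \<tau> * CA) * ((1 / 4) ^ l * 2 ^ l)) * p n z" by (simp only: mult_ac)
        also have "(1 / 4) ^ l * 2 ^ l = ((1 / 2) ^ l :: real)" unfolding power_mult_distrib[symmetric] by simp
        finally show ?thesis .
      qed
      have in2: "\<delta> l z *\<^sub>C y l \<in> F0" if "z \<in> S n" for l z by (rule cvs.subspace_scale[OF sF0 xy(2)])
      have "\<exists>R. linear_on (S n) R \<and> (\<forall>z\<in>S n. R z \<in> F0 \<and> q0 (R z) \<le> (2 * C * \<tau> * CA / (1 - 1 / 2)) * p n z \<and>
          (\<lambda>L. q0 (R z - (\<Sum>l<L. \<delta> l z *\<^sub>C y l))) \<longlonglongrightarrow> 0)"
        by (rule banach_on_operator_series[OF banach_pieceD(1)[OF F0] Nn linear_on_rank_one[OF linear_on_subset[OF \<delta>lin Snk]] in2 le2 hs2])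
      then obtain R where R: "linear_on (S n) R" "\<forall>z\<in>S n. R z \<in> F0 \<and> q0 (R z) \<le> (2 * C * \<tau> * CA / (1 - 1 / 2)) * p n z \<and>
          (\<lambda>L. q0 (R z - (\<Sum>l<L. \<delta> l z *\<^sub>C y l))) \<longlonglongrightarrow> 0" by (elim exE conjE)
      have RF: "R z \<in> F0" and Rle: "q0 (R z) \<le> (2 * C * \<tau> * CA / (1 - 1 / 2)) * p n z"
        and Rlim: "(\<lambda>L. q0 (R z - (\<Sum>l<L. \<delta> l z *\<^sub>C y l))) \<longlonglongrightarrow> 0" if "z \<in> S n" for z
        using bspec[OF R(2) that] by blast+
      have eF1: "e \<in> F1" "q1 e \<le> 1" using FF1[OF e(1)] e(2) by auto
      \<comment> \<open>Of \<phi> times e the part carried by the \<open>x l\<close> is kept,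
        \<open>G1\<close> being the sum of \<open>\<delta> l\<close> times \<open>x l\<close>.
        Formally the difference is the sum of \<open>\<delta> l\<close> times \<open>y l\<close>, a
        series in \<open>F0\<close>.\<close>
      define D where "D z = \<psi> 0 z *\<^sub>C e + G1 z" for z
      have Dlin: "linear_on (S k) D" unfolding D_def by (intro linear_on_add linear_on_rank_one \<psi>(1) G1(1))
      have DF: "D z \<in> F1" if "z \<in> S k" for z
        unfolding D_def by (intro cvs.subspace_add[OF sF1] cvs.subspace_scale[OF sF1] eF1 G1F that)
      have Dle: "q1 (D z) \<le> B * p k z" if z: "z \<in> S k" for z
      proof -
        have "q1 (D z) \<le> q1 (\<psi> 0 z *\<^sub>C e) + q1 (G1 z)"
          unfolding D_def by (intro norm_on_add[OF NF1] cvs.subspace_scale[OF sF1] eF1 G1F z)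
        also have "q1 (\<psi> 0 z *\<^sub>C e) = cmod (\<psi> 0 z) * q1 e" by (rule norm_on_scale[OF NF1 eF1(1)])
        also have "\<dots> \<le> (C * (G * g ^ 0) * p k z) * 1"
          using \<psi>(2)[OF z, of 0] eF1 norm_on_nonneg[OF NF1 eF1(1)] C G0 norm_on_nonneg[OF Nk z] by (intro mult_mono) auto
        finally show ?thesis using G1le[OF z] unfolding B_def by (simp add: algebra_simps)
      qed
      \<comment> \<open>The comparison takes place in \<open>F1\<close>, which contains
        \<open>F0\<close>: subtracting the L-th partial sum of the second series from the left side
        leaves (\<phi> - \<psi> L) e minus a tail of the first series, and both tend to 0.\<close>
      have eq: "\<phi> z *\<^sub>C e - D z = R z" if z: "z \<in> S n" for z
      proof -
        have zk: "z \<in> S k" using z Snk by blast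
        let ?f = "\<lambda>L. \<Sum>l<L. \<delta> l z *\<^sub>C y l"
        have fF0: "?f L \<in> F0" for L by (intro cvs.subspace_sum[OF sF0] cvs.subspace_scale[OF sF0] xy(2))
        have gF1: "(\<Sum>l<L. \<delta> l z *\<^sub>C x l) \<in> F1" for L by (intro cvs.subspace_sum[OF sF1] cvs.subspace_scale[OF sF1] xy(1))
        have Rf: "(\<lambda>L. q1 (R z - ?f L)) \<longlonglongrightarrow> 0"
        proof (rule tendsto_0_le[OF Rlim[OF z]])
          have m: "R z - ?f L \<in> F0" for L by (intro cvs.subspace_diff[OF sF0] RF z fF0)
          show "eventually (\<lambda>L. 0 \<le> q1 (R z - ?f L)) sequentially"
            using norm_on_nonneg[OF NF1] F0F1 m by (intro always_eventually) blast
          show "eventually (\<lambda>L. q1 (R z - ?f L) \<le> q0 (R z - ?f L)) sequentially"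
            using F0F1 m by (intro always_eventually) blast
        qed
        have id: "\<phi> z *\<^sub>C e - D z - ?f L = (\<phi> z - \<psi> L z) *\<^sub>C e - (G1 z - (\<Sum>l<L. \<delta> l z *\<^sub>C x l))" for L
        proof -
          have "(\<Sum>l<L. \<delta> l z *\<^sub>C x l) + ?f L = (\<Sum>l<L. \<delta> l z *\<^sub>C e)"
            unfolding sum.distrib[symmetric] scaleC_add_right[symmetric] xy(3)[symmetric] ..
          also have "\<dots> = (\<Sum>l<L. \<delta> l z) *\<^sub>C e" by (simp add: cvs.scale_sum_left)
          also have "(\<Sum>l<L. \<delta> l z) = \<psi> L z - \<psi> 0 z" unfolding \<delta>_def by (rule sum_lessThan_telescope)
          finally have "?f L = (\<psi> L z - \<psi> 0 z) *\<^sub>C e - (\<Sum>l<L. \<delta> l z *\<^sub>C x l)" by (simp add: algebra_simps)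
          then show ?thesis unfolding D_def by (simp add: cvs.scale_left_diff_distrib)
        qed
        have "(\<lambda>L. (C * \<tau> * p n z) * (1 / 4) ^ L) \<longlonglongrightarrow> (C * \<tau> * p n z) * 0"
          by (intro tendsto_mult tendsto_const LIMSEQ_power_zero) simp
        then have "(\<lambda>L. (C * \<tau> * p n z) * (1 / 4) ^ L + q1 (G1 z - (\<Sum>l<L. \<delta> l z *\<^sub>C x l))) \<longlonglongrightarrow> (C * \<tau> * p n z) * 0 + 0"
          using G1lim[OF zk] by (rule tendsto_add)
        then have lim: "(\<lambda>L. (C * \<tau> * p n z) * (1 / 4) ^ L + q1 (G1 z - (\<Sum>l<L. \<delta> l z *\<^sub>C x l))) \<longlonglongrightarrow> 0" by simp
        have mem: "(\<phi> z - \<psi> L z) *\<^sub>C e \<in> F1" "G1 z - (\<Sum>l<L. \<delta> l z *\<^sub>C x l) \<in> F1" for L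
          by (intro cvs.subspace_scale[OF sF1] eF1 cvs.subspace_diff[OF sF1] G1F zk gF1)+
        have Df: "(\<lambda>L. q1 (\<phi> z *\<^sub>C e - D z - ?f L)) \<longlonglongrightarrow> 0"
        proof (rule tendsto_0_le[OF lim])
          show "eventually (\<lambda>L. 0 \<le> q1 (\<phi> z *\<^sub>C e - D z - ?f L)) sequentially"
            unfolding id by (intro always_eventually allI norm_on_nonneg[OF NF1] cvs.subspace_diff[OF sF1] mem)
          have "q1 ((\<phi> z - \<psi> L z) *\<^sub>C e) \<le> (C * \<tau> * p n z) * (1 / 4) ^ L" for L
          proof -
            have "q1 ((\<phi> z - \<psi> L z) *\<^sub>C e) = cmod (\<phi> z - \<psi> L z) * q1 e" by (rule norm_on_scale[OF NF1 eF1(1)])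
            also have "\<dots> \<le> ((C * lam L) * p n z) * 1"
              using \<psi>(3)[OF z, of L] eF1 norm_on_nonneg[OF NF1 eF1(1)] C lam0[of L] norm_on_nonneg[OF Nn z] by (intro mult_mono) auto
            finally show ?thesis unfolding lam_def by (simp add: mult_ac)
          qed
          then have "q1 (\<phi> z *\<^sub>C e - D z - ?f L) \<le> (C * \<tau> * p n z) * (1 / 4) ^ L + q1 (G1 z - (\<Sum>l<L. \<delta> l z *\<^sub>C x l))" for L
            unfolding id using norm_on_diff[OF NF1 mem[of L]] by (meson add_right_mono order_trans)
          then show "eventually (\<lambda>L. q1 (\<phi> z *\<^sub>C e - D z - ?f L) \<le> (C * \<tau> * p n z) * (1 / 4) ^ L + q1 (G1 z - (\<Sum>l<L. \<delta> l z *\<^sub>C x l))) sequentially"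
            by (intro always_eventually) blast
        qed
        show ?thesis
        proof (rule norm_on_limit_unique[OF NF1 trivial_limit_sequentially _ _ _ Df Rf])
          show "\<phi> z *\<^sub>C e - D z \<in> F1" by (intro cvs.subspace_diff[OF sF1] cvs.subspace_scale[OF sF1] eF1 DF zk)
          show "R z \<in> F1" using F0F1 RF[OF z] by blast
          show "eventually (\<lambda>L. ?f L \<in> F1) sequentially" using F0F1 fF0 by (intro always_eventually) blast
        qed
      qed
      have "2 * C * \<tau> * CA / (1 - 1 / 2) = \<epsilon>" unfolding \<tau>_def using C CA by simp
      then show ?thesis
        using Dlin DF Dle eq RF Rle by (intro exI[of _ D]) simp
    qed
    show "\<exists>C>0. \<forall>\<phi> e. linear_on (S m) \<phi> \<longrightarrow> (\<forall>z\<in>S m. cmod (\<phi> z) \<le> p m z) \<longrightarrow> e \<in> F \<longrightarrow> q e \<le> 1 \<longrightarrow>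
     (\<exists>D. linear_on (S k) D \<and> (\<forall>z\<in>S k. D z \<in> F1 \<and> q1 (D z) \<le> C * p k z) \<and>
       (\<forall>z\<in>S n. \<phi> z *\<^sub>C e - D z \<in> F0 \<and> q0 (\<phi> z *\<^sub>C e - D z) \<le> \<epsilon> * p n z))"
      by (rule exI[of _ B], intro conjI B0 allI impI main)
  qed
  with F1 FF1' F0F1' show ?thesis by (intro exI[of _ F1] exI[of _ q1] conjI)
qed

section \<open>Nuclear operators\<close>

lemma bounded_op_tendsto:
  assumes F: "norm_on F q" and G: "norm_on G r" and A: "bounded_op F q G r A" and x: "x \<in> F"
    and f: "eventually (\<lambda>i. f i \<in> F) l" and lim: "((\<lambda>i. q (x - f i)) \<longlongrightarrow> 0) l"
  shows "((\<lambda>i. r (A x - A (f i))) \<longlongrightarrow> 0) l"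
proof -
  obtain C where C: "C > 0" "\<And>x. x \<in> F \<Longrightarrow> r (A x) \<le> C * q x" using bounded_op_bound[OF F A] by blast
  note sF = norm_on_subspace[OF F]
  have "((\<lambda>i. C * q (x - f i)) \<longlongrightarrow> C * 0) l" by (intro tendsto_mult tendsto_const lim)
  then have "((\<lambda>i. C * q (x - f i)) \<longlongrightarrow> 0) l" by simp
  then show ?thesis
  proof (rule tendsto_0_le)
    show "eventually (\<lambda>i. 0 \<le> r (A x - A (f i))) l"
      using f by eventually_elim
        (intro norm_on_nonneg[OF G] cvs.subspace_diff[OF norm_on_subspace[OF G]] bounded_op_mem[OF A] x)
    show "eventually (\<lambda>i. r (A x - A (f i)) \<le> C * q (x - f i)) l"
      using f
    proof eventually_elim
      case (elim i)
      have "A x - A (f i) = A (x - f i)" using linear_on_diff[OF bounded_op_linear[OF A] sF x elim] by simp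
      then show ?case using C(2)[OF cvs.subspace_diff[OF sF x elim]] by simp
    qed
  qed
qed

lemma tendsto_norm_on_diff:
  assumes F: "norm_on F q" and xy: "x \<in> F" "y \<in> F"
    and f: "eventually (\<lambda>i. f i \<in> F) l" "((\<lambda>i. q (x - f i)) \<longlongrightarrow> 0) l"
    and g: "eventually (\<lambda>i. g i \<in> F) l" "((\<lambda>i. q (y - g i)) \<longlongrightarrow> 0) l"
  shows "((\<lambda>i. q ((x - y) - (f i - g i))) \<longlongrightarrow> 0) l"
proof -
  note sF = cvs.subspace_diff[OF norm_on_subspace[OF F]]
  have "((\<lambda>i. q (x - f i) + q (y - g i)) \<longlongrightarrow> 0 + 0) l" by (intro tendsto_add f g)
  then have "((\<lambda>i. q (x - f i) + q (y - g i)) \<longlongrightarrow> 0) l" by simp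
  then show ?thesis
  proof (rule tendsto_0_le)
    have eq: "(x - y) - (f i - g i) = (x - f i) - (y - g i)" for i by simp
    show "eventually (\<lambda>i. 0 \<le> q ((x - y) - (f i - g i))) l"
      using f(1) g(1) by eventually_elim (intro norm_on_nonneg[OF F] sF xy)
    show "eventually (\<lambda>i. q ((x - y) - (f i - g i)) \<le> q (x - f i) + q (y - g i)) l"
      using f(1) g(1) unfolding eq by eventually_elim (intro norm_on_diff[OF F] sF xy)
  qed
qed

text \<open>The infimum is attained: dividing by p(x) shows that it is an admissible bound
  itself.\<close>

lemma dual_norm_bound:
  assumes N: "norm_on S p" and \<phi>: "\<phi> \<in> dual_on S p"
  shows "0 \<le> dual_norm S p \<phi>" "x \<in> S \<Longrightarrow> cmod (\<phi> x) \<le> dual_norm S p \<phi> * p x"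
proof -
  let ?A = "{C. 0 \<le> C \<and> (\<forall>x\<in>S. cmod (\<phi> x) \<le> C * p x)}"
  obtain C where C: "\<And>x. x \<in> S \<Longrightarrow> cmod (\<phi> x) \<le> C * p x" and lin: "linear_on S \<phi>"
    using \<phi> unfolding dual_on_def by blast
  have "cmod (\<phi> x) \<le> max C 0 * p x" if "x \<in> S" for x
    using C[OF that] mult_right_mono[of C "max C 0" "p x"] norm_on_nonneg[OF N that] by linarith
  then have ne: "?A \<noteq> {}" by (intro ex_in_conv[THEN iffD1] exI[of _ "max C 0"]) auto
  show "0 \<le> dual_norm S p \<phi>" unfolding dual_norm_def using ne by (intro cInf_greatest) auto
  show "cmod (\<phi> x) \<le> dual_norm S p \<phi> * p x" if x: "x \<in> S"
  proof (cases "x = 0")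
    case True
    then show ?thesis using linear_on_0[OF lin norm_on_subspace[OF N]] norm_on_zero[OF N] by simp
  next
    case False
    then have px: "p x > 0" using norm_on_nonneg[OF N x] norm_on_eq_0[OF N x] by linarith
    have "cmod (\<phi> x) / p x \<le> dual_norm S p \<phi>"
      unfolding dual_norm_def using x px by (intro cInf_greatest[OF ne]) (auto simp: pos_divide_le_eq)
    then show ?thesis using px by (simp add: pos_divide_le_eq)
  qed
qed

text \<open>In contrast to \<^const>\<open>nuclear_on\<close>, the vectors \<open>e i\<close> are normalized and the weights are
  carried by the functionals.\<close>

definition nuclear_op :: "'a::complex_vector set \<Rightarrow> ('a \<Rightarrow> real) \<Rightarrow> 'b::complex_vector set \<Rightarrow> ('b \<Rightarrow> real) \<Rightarrow> ('a \<Rightarrow> 'b) \<Rightarrow> bool" where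
  "nuclear_op S p F q D \<longleftrightarrow> (\<exists>(\<phi> :: nat \<Rightarrow> 'a \<Rightarrow> complex) e t.
     (\<forall>i. linear_on S (\<phi> i) \<and> (\<forall>x\<in>S. cmod (\<phi> i x) \<le> t i * p x) \<and> e i \<in> F \<and> q (e i) \<le> 1 \<and> 0 \<le> t i) \<and>
     t summable_on UNIV \<and>
     (\<forall>x\<in>S. D x \<in> F \<and> (\<lambda>n. q (D x - (\<Sum>i<n. \<phi> i x *\<^sub>C e i))) \<longlonglongrightarrow> 0))"

lemma nuclear_opE:
  assumes "nuclear_op S p F q D"
  obtains \<phi> :: "nat \<Rightarrow> 'a::complex_vector \<Rightarrow> complex" and e :: "nat \<Rightarrow> 'b::complex_vector" and t T
  where "\<And>i. linear_on S (\<phi> i)" "\<And>i x. x \<in> S \<Longrightarrow> cmod (\<phi> i x) \<le> t i * p x" "\<And>i. e i \<in> F" "\<And>i. q (e i) \<le> 1"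
    "\<And>i. 0 \<le> t i" "(t has_sum T) UNIV" "0 \<le> T" "\<And>x. x \<in> S \<Longrightarrow> D x \<in> F"
    "\<And>x. x \<in> S \<Longrightarrow> (\<lambda>n. q (D x - (\<Sum>i<n. \<phi> i x *\<^sub>C e i))) \<longlonglongrightarrow> 0"
proof -
  obtain \<phi> e t where 1: "\<forall>i. linear_on S (\<phi> i) \<and> (\<forall>x\<in>S. cmod (\<phi> i x) \<le> t i * p x) \<and> e i \<in> F \<and> q (e i) \<le> 1 \<and> 0 \<le> t i"
     "t summable_on UNIV"
     "\<forall>x\<in>S. D x \<in> F \<and> (\<lambda>n. q (D x - (\<Sum>i<n. \<phi> i x *\<^sub>C e i))) \<longlonglongrightarrow> 0"
    using assms unfolding nuclear_op_def by (elim exE conjE)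
  have "0 \<le> infsum t UNIV" using 1(1) by (intro infsum_nonneg) auto
  then show thesis using 1 has_sum_infsum[OF 1(2)] by (intro that[of \<phi> t e "infsum t UNIV"]) auto
qed

lemma nuclear_on_nuclear_op:
  assumes S: "norm_on S p" and F: "norm_on F q" and D: "nuclear_on S p F q D"
  shows "nuclear_op S p F q D"
proof -
  obtain \<phi> y where \<phi>: "\<And>k. \<phi> k \<in> dual_on S p" "\<And>k. y k \<in> F"
    and s: "summable (\<lambda>k. dual_norm S p (\<phi> k) * q (y k))"
    and lim: "\<And>x. x \<in> S \<Longrightarrow> D x \<in> F \<and> (\<lambda>n. q (D x - (\<Sum>k<n. \<phi> k x *\<^sub>C y k))) \<longlonglongrightarrow> 0"
    using D unfolding nuclear_on_def by blast
  define t where "t k = dual_norm S p (\<phi> k) * q (y k)" for k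
  define \<psi> where "\<psi> k x = complex_of_real (q (y k)) *\<^sub>C \<phi> k x" for k x
  \<comment> \<open>For y k = 0 the factor is 1/0 = 0 and \<open>e k\<close> is 0, so no case has to
    be excluded.\<close>
  define e where "e k = complex_of_real (1 / q (y k)) *\<^sub>C y k" for k
  have qy: "0 \<le> q (y k)" for k using norm_on_nonneg[OF F \<phi>(2)] .
  have t0: "0 \<le> t k" for k unfolding t_def using qy dual_norm_bound(1)[OF S \<phi>(1)] by simp
  have eq: "\<psi> k x *\<^sub>C e k = \<phi> k x *\<^sub>C y k" for k x
  proof (cases "y k = 0")
    case False
    then have "q (y k) \<noteq> 0" using norm_on_eq_0[OF F \<phi>(2)] by blast
    then show ?thesis unfolding \<psi>_def e_def by (simp add: scaleC_complex_def scaleC_scaleC)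
  qed (simp add: e_def)
  have "linear_on S (\<psi> k)" for k
    unfolding \<psi>_def using \<phi>(1)[of k] by (intro linear_on_scaled) (simp add: dual_on_def)
  moreover have "cmod (\<psi> k x) \<le> t k * p x" if "x \<in> S" for k x
    using mult_left_mono[OF dual_norm_bound(2)[OF S \<phi>(1) that] qy, of k k] qy
    by (simp add: \<psi>_def t_def scaleC_complex_def norm_mult mult_ac)
  moreover have "e k \<in> F" for k unfolding e_def by (intro cvs.subspace_scale[OF norm_on_subspace[OF F]] \<phi>(2))
  moreover have "q (e k) \<le> 1" for k
    unfolding e_def norm_on_scale[OF F \<phi>(2)] norm_of_real using qy[of k] by simp
  moreover have "t summable_on UNIV"
    using s t0 by (intro norm_summable_imp_summable_on) (simp add: t_def[symmetric])
  ultimately show ?thesis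
    unfolding nuclear_op_def using t0 lim by (intro exI[of _ \<psi>] exI[of _ e] exI[of _ t]) (simp add: eq)
qed

lemma nuclear_op_compose_right:
  assumes S: "norm_on S p" and S': "norm_on S' p'" and D: "nuclear_op S p F q D" and A: "bounded_op S' p' S p A"
  shows "nuclear_op S' p' F q (\<lambda>x. D (A x))"
proof -
  obtain C where C: "C > 0" "\<And>x. x \<in> S' \<Longrightarrow> p (A x) \<le> C * p' x" using bounded_op_bound[OF S' A] by blast
  obtain \<phi> e t T where 1: "\<And>i. linear_on S (\<phi> i)" "\<And>i x. x \<in> S \<Longrightarrow> cmod (\<phi> i x) \<le> t i * p x" "\<And>i. e i \<in> F" "\<And>i. q (e i) \<le> 1"
    "\<And>i. 0 \<le> t i" "(t has_sum T) UNIV" "0 \<le> T" "\<And>x. x \<in> S \<Longrightarrow> D x \<in> F"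
    "\<And>x. x \<in> S \<Longrightarrow> (\<lambda>n. q (D x - (\<Sum>i<n. \<phi> i x *\<^sub>C e i))) \<longlonglongrightarrow> 0"
    using D by (rule nuclear_opE) blast
  have m: "A x \<in> S" if "x \<in> S'" for x using bounded_op_mem[OF A that] .
  have "linear_on S' (\<lambda>x. \<phi> i (A x))" for i by (rule linear_on_compose[OF bounded_op_linear[OF A] 1(1) m])
  moreover have "cmod (\<phi> i (A x)) \<le> (t i * C) * p' x" if "x \<in> S'" for i x
    using 1(2)[OF m[OF that], of i] mult_left_mono[OF C(2)[OF that] 1(5)[of i]] by (simp add: mult.assoc)
  moreover have "(\<lambda>i. t i * C) summable_on UNIV"
    using has_sum_imp_summable[OF has_sum_cmult_left[OF 1(6), of C]] .
  ultimately show ?thesis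
    unfolding nuclear_op_def using 1 m C(1)
    by (intro exI[of _ "\<lambda>i x. \<phi> i (A x)"] exI[of _ e] exI[of _ "\<lambda>i. t i * C"]) simp
qed

lemma nuclear_op_compose_left:
  assumes F: "norm_on F q" and G: "norm_on G r" and D: "nuclear_op S p F q D" and A: "bounded_op F q G r A"
  shows "nuclear_op S p G r (\<lambda>x. A (D x))"
proof -
  obtain C where C: "C > 0" "\<And>x. x \<in> F \<Longrightarrow> r (A x) \<le> C * q x" using bounded_op_bound[OF F A] by blast
  obtain \<phi> e t T where 1: "\<And>i. linear_on S (\<phi> i)" "\<And>i x. x \<in> S \<Longrightarrow> cmod (\<phi> i x) \<le> t i * p x" "\<And>i. e i \<in> F" "\<And>i. q (e i) \<le> 1"
    "\<And>i. 0 \<le> t i" "(t has_sum T) UNIV" "0 \<le> T" "\<And>x. x \<in> S \<Longrightarrow> D x \<in> F"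
    "\<And>x. x \<in> S \<Longrightarrow> (\<lambda>n. q (D x - (\<Sum>i<n. \<phi> i x *\<^sub>C e i))) \<longlonglongrightarrow> 0"
    using D by (rule nuclear_opE) blast
  note sF = norm_on_subspace[OF F] and sG = norm_on_subspace[OF G]
  \<comment> \<open>The norm of \<open>A\<close> is moved from the vectors to the functionals, to
    keep the vectors in the unit ball.\<close>
  define \<psi> where "\<psi> i x = complex_of_real C *\<^sub>C \<phi> i x" for i x
  define d where "d i = complex_of_real (1 / C) *\<^sub>C A (e i)" for i
  have eq: "\<psi> i x *\<^sub>C d i = A (\<phi> i x *\<^sub>C e i)" for i x
    unfolding \<psi>_def d_def linear_onD(2)[OF bounded_op_linear[OF A] 1(3)] using C(1) by (simp add: scaleC_complex_def scaleC_scaleC)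
  have sumF: "(\<Sum>i<n. \<phi> i x *\<^sub>C e i) \<in> F" for n x by (intro cvs.subspace_sum[OF sF] cvs.subspace_scale[OF sF] 1(3))
  have sum: "(\<Sum>i<n. \<psi> i x *\<^sub>C d i) = A (\<Sum>i<n. \<phi> i x *\<^sub>C e i)" for n x
    unfolding eq by (rule linear_on_sum[OF bounded_op_linear[OF A] sF, symmetric]) (intro cvs.subspace_scale[OF sF] 1(3))
  have "linear_on S (\<psi> i)" for i unfolding \<psi>_def by (intro linear_on_scaled 1(1))
  moreover have "cmod (\<psi> i x) \<le> (t i * C) * p x" if "x \<in> S" for i x
    using mult_right_mono[OF 1(2)[OF that, of i], of C] C(1) by (simp add: \<psi>_def scaleC_complex_def norm_mult mult_ac)
  moreover have "d i \<in> G" for i unfolding d_def by (intro cvs.subspace_scale[OF sG] bounded_op_mem[OF A] 1(3))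
  moreover have "r (d i) \<le> 1" for i
  proof -
    have "r (d i) = (1 / C) * r (A (e i))"
      unfolding d_def norm_on_scale[OF G bounded_op_mem[OF A 1(3)]] norm_of_real using C(1) by simp
    also have "\<dots> \<le> (1 / C) * (C * q (e i))" using C(1) C(2)[OF 1(3)] by (intro mult_left_mono) auto
    also have "\<dots> = q (e i)" using C(1) by simp
    finally show ?thesis using 1(4)[of i] by simp
  qed
  moreover have "(\<lambda>i. t i * C) summable_on UNIV"
    using has_sum_imp_summable[OF has_sum_cmult_left[OF 1(6), of C]] .
  moreover have "(\<lambda>n. r (A (D x) - (\<Sum>i<n. \<psi> i x *\<^sub>C d i))) \<longlonglongrightarrow> 0" if "x \<in> S" for x
    unfolding sum using sumF by (intro bounded_op_tendsto[OF F G A 1(8)[OF that] _ 1(9)[OF that]]) auto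
  moreover have "A (D x) \<in> G" if "x \<in> S" for x using bounded_op_mem[OF A 1(8)[OF that]] .
  ultimately show ?thesis
    unfolding nuclear_op_def using 1(5) C(1)
    by (intro exI[of _ \<psi>] exI[of _ d] exI[of _ "\<lambda>i. t i * C"]) simp
qed

text \<open>Each term is normalized and approximated by itself. As the piece \<open>F1\<close> and
  the constant \<open>C\<close> are common to all terms, the weights \<open>t i\<close> make both
  the approximants and the errors summable.\<close>

lemma nuclear_op_approximation:
  assumes R: "rank_one_approx F0 q0 F q F1 q1 S p n m k"
    and F0: "banach_piece E F0 q0" and F: "banach_piece E F q" and F1: "banach_piece E F1 q1"
    and FF1: "\<And>x. x \<in> F \<Longrightarrow> x \<in> F1 \<and> q1 x \<le> q x" and F0F1: "\<And>x. x \<in> F0 \<Longrightarrow> x \<in> F1 \<and> q1 x \<le> q0 x"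
    and S: "exhaustion Z S p" and nmk: "n \<le> m" "m \<le> k"
    and D: "nuclear_op (S m) (p m) F q D" and \<epsilon>: "\<epsilon> > 0"
  shows "\<exists>D'. bounded_op (S k) (p k) F1 q1 D' \<and> (\<forall>z\<in>S n. D z - D' z \<in> F0 \<and> q0 (D z - D' z) \<le> \<epsilon> * p n z)"
proof -
  obtain \<phi> e t T where 1: "\<And>i. linear_on (S m) (\<phi> i)" "\<And>i x. x \<in> S m \<Longrightarrow> cmod (\<phi> i x) \<le> t i * p m x" "\<And>i. e i \<in> F" "\<And>i. q (e i) \<le> 1"
    "\<And>i. 0 \<le> t i" "(t has_sum T) UNIV" "0 \<le> T" "\<And>x. x \<in> S m \<Longrightarrow> D x \<in> F"
    "\<And>x. x \<in> S m \<Longrightarrow> (\<lambda>n. q (D x - (\<Sum>i<n. \<phi> i x *\<^sub>C e i))) \<longlonglongrightarrow> 0"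
    using D by (rule nuclear_opE) blast
  note NF = banach_pieceD(4)[OF F] and NF1 = banach_pieceD(4)[OF F1] and NF0 = banach_pieceD(4)[OF F0]
  note sF = banach_pieceD(5)[OF F] and sF1 = banach_pieceD(5)[OF F1] and sF0 = banach_pieceD(5)[OF F0]
  note Nn = exhaustionD(3)[OF S, of n] and Nm = exhaustionD(3)[OF S, of m] and Nk = exhaustionD(3)[OF S, of k]
  have Snk: "S n \<subseteq> S k" and Snm: "S n \<subseteq> S m" using exhaustion_mono[OF S] nmk by auto
  \<comment> \<open>The errors add up to at most T \<epsilon>'; the added 1 covers T = 0.\<close>
  define \<epsilon>' where "\<epsilon>' = \<epsilon> / (T + 1)"
  have \<epsilon>': "\<epsilon>' > 0" unfolding \<epsilon>'_def using \<epsilon> 1(7) by simp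
  \<comment> \<open>For t i = 0 the functional \<open>\<phi> i\<close> vanishes on
    \<open>S m\<close>, in accordance with 1/0 = 0.\<close>
  define \<psi> where "\<psi> i x = complex_of_real (1 / t i) *\<^sub>C \<phi> i x" for i x
  obtain C where C: "C > 0" and app: "\<forall>\<phi> e. linear_on (S m) \<phi> \<longrightarrow>
     (\<forall>z\<in>S m. cmod (\<phi> z) \<le> p m z) \<longrightarrow> e \<in> F \<longrightarrow> q e \<le> 1 \<longrightarrow>
     (\<exists>D. linear_on (S k) D \<and> (\<forall>z\<in>S k. D z \<in> F1 \<and> q1 (D z) \<le> C * p k z) \<and>
       (\<forall>z\<in>S n. \<phi> z *\<^sub>C e - D z \<in> F0 \<and> q0 (\<phi> z *\<^sub>C e - D z) \<le> \<epsilon>' * p n z))"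
    using R \<epsilon>' unfolding rank_one_approx_def by blast
  have \<psi>lin: "linear_on (S m) (\<psi> i)" for i unfolding \<psi>_def by (intro linear_on_scaled 1(1))
  have \<psi>le: "cmod (\<psi> i z) \<le> p m z" if "z \<in> S m" for i z
  proof (cases "t i = 0")
    case True
    then show ?thesis unfolding \<psi>_def using norm_on_nonneg[OF Nm that] by (simp add: scaleC_complex_def)
  next
    case False
    then have "t i > 0" using 1(5)[of i] by simp
    then show ?thesis using 1(2)[OF that, of i]
      by (simp add: \<psi>_def scaleC_complex_def norm_divide pos_divide_le_eq mult.commute)
  qed
  have t\<psi>: "complex_of_real (t i) *\<^sub>C \<psi> i z = \<phi> i z" if "z \<in> S m" for i z
  proof (cases "t i = 0")
    case True
    then show ?thesis using 1(2)[OF that, of i] by (simp add: scaleC_complex_def)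
  qed (simp add: \<psi>_def scaleC_complex_def)
  have "\<exists>D. linear_on (S k) D \<and> (\<forall>z\<in>S k. D z \<in> F1 \<and> q1 (D z) \<le> C * p k z) \<and>
       (\<forall>z\<in>S n. \<psi> i z *\<^sub>C e i - D z \<in> F0 \<and> q0 (\<psi> i z *\<^sub>C e i - D z) \<le> \<epsilon>' * p n z)" for i
    using app \<psi>lin \<psi>le 1(3,4) by blast
  then obtain A where A: "\<And>i. linear_on (S k) (A i) \<and> (\<forall>z\<in>S k. A i z \<in> F1 \<and> q1 (A i z) \<le> C * p k z) \<and>
       (\<forall>z\<in>S n. \<psi> i z *\<^sub>C e i - A i z \<in> F0 \<and> q0 (\<psi> i z *\<^sub>C e i - A i z) \<le> \<epsilon>' * p n z)" by metis
  let ?A = "\<lambda>i z. complex_of_real (t i) *\<^sub>C A i z"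
  have Alin: "linear_on (S k) (?A i)" for i using A by (intro linear_on_scaled) blast
  have AF: "?A i z \<in> F1" if "z \<in> S k" for i z using A that by (intro cvs.subspace_scale[OF sF1]) blast
  have Ale: "q1 (?A i z) \<le> (t i * C) * p k z" if z: "z \<in> S k" for i z
  proof -
    have m: "A i z \<in> F1" "q1 (A i z) \<le> C * p k z" using A z by blast+
    show ?thesis unfolding norm_on_scale[OF NF1 m(1)] using mult_left_mono[OF m(2) 1(5)[of i]] 1(5)[of i] by (simp add: mult.assoc)
  qed
  have "\<exists>G. linear_on (S k) G \<and> (\<forall>z\<in>S k. G z \<in> F1 \<and> q1 (G z) \<le> (T * C) * p k z \<and>
      (\<lambda>L. q1 (G z - (\<Sum>i<L. ?A i z))) \<longlonglongrightarrow> 0)"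
    by (rule banach_on_operator_series[OF banach_pieceD(1)[OF F1] Nk Alin AF Ale has_sum_cmult_left[OF 1(6)]])
  then obtain G where G: "linear_on (S k) G" "\<forall>z\<in>S k. G z \<in> F1 \<and> q1 (G z) \<le> (T * C) * p k z \<and>
      (\<lambda>L. q1 (G z - (\<Sum>i<L. ?A i z))) \<longlonglongrightarrow> 0" by (elim exE conjE)
  let ?B = "\<lambda>i z. \<phi> i z *\<^sub>C e i - ?A i z"
  have B\<psi>: "?B i z = complex_of_real (t i) *\<^sub>C (\<psi> i z *\<^sub>C e i - A i z)" if "z \<in> S n" for i z
    using t\<psi>[of z i] that Snm by (auto simp: cvs.scale_right_diff_distrib scaleC_scaleC scaleC_complex_def)
  have Blin: "linear_on (S n) (?B i)" for i
    by (intro linear_on_sub linear_on_rank_one linear_on_subset[OF 1(1) Snm] linear_on_subset[OF Alin Snk])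
  have BF: "?B i z \<in> F0" if "z \<in> S n" for i z
    unfolding B\<psi>[OF that] using A that by (intro cvs.subspace_scale[OF sF0]) blast
  have Ble: "q0 (?B i z) \<le> (t i * \<epsilon>') * p n z" if z: "z \<in> S n" for i z
  proof -
    have m: "\<psi> i z *\<^sub>C e i - A i z \<in> F0" "q0 (\<psi> i z *\<^sub>C e i - A i z) \<le> \<epsilon>' * p n z" using A z by blast+
    show ?thesis unfolding B\<psi>[OF z] norm_on_scale[OF NF0 m(1)]
      using mult_left_mono[OF m(2) 1(5)[of i]] 1(5)[of i] by (simp add: mult.assoc)
  qed
  have "\<exists>R. linear_on (S n) R \<and> (\<forall>z\<in>S n. R z \<in> F0 \<and> q0 (R z) \<le> (T * \<epsilon>') * p n z \<and>
      (\<lambda>L. q0 (R z - (\<Sum>i<L. ?B i z))) \<longlonglongrightarrow> 0)"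
    by (rule banach_on_operator_series[OF banach_pieceD(1)[OF F0] Nn Blin BF Ble has_sum_cmult_left[OF 1(6)]])
  then obtain R where R: "linear_on (S n) R" "\<forall>z\<in>S n. R z \<in> F0 \<and> q0 (R z) \<le> (T * \<epsilon>') * p n z \<and>
      (\<lambda>L. q0 (R z - (\<Sum>i<L. ?B i z))) \<longlonglongrightarrow> 0" by (elim exE conjE)
  have i1: "bounded_op F q F1 q1 (\<lambda>x. x)" by (rule bounded_op_id[of _ _ _ 1]) (use FF1 in auto)
  have i0: "bounded_op F0 q0 F1 q1 (\<lambda>x. x)" by (rule bounded_op_id[of _ _ _ 1]) (use F0F1 in auto)
  have eq: "D z - G z = R z" if z: "z \<in> S n" for z
  proof -
    have zm: "z \<in> S m" "z \<in> S k" using z Snm Snk by auto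
    have Gz: "G z \<in> F1" "(\<lambda>L. q1 (G z - (\<Sum>i<L. ?A i z))) \<longlonglongrightarrow> 0" using bspec[OF G(2) zm(2)] by blast+
    have Rz: "R z \<in> F0" "(\<lambda>L. q0 (R z - (\<Sum>i<L. ?B i z))) \<longlonglongrightarrow> 0" using bspec[OF R(2) z] by blast+
    have s1: "(\<Sum>i<L. \<phi> i z *\<^sub>C e i) \<in> F" for L by (intro cvs.subspace_sum[OF sF] cvs.subspace_scale[OF sF] 1(3))
    have s2: "(\<Sum>i<L. ?A i z) \<in> F1" for L using AF zm(2) by (intro cvs.subspace_sum[OF sF1])
    have s3: "(\<Sum>i<L. ?B i z) \<in> F0" for L using BF z by (intro cvs.subspace_sum[OF sF0])
    have l1: "(\<lambda>L. q1 (D z - (\<Sum>i<L. \<phi> i z *\<^sub>C e i))) \<longlonglongrightarrow> 0"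
      using s1 by (intro bounded_op_tendsto[OF NF NF1 i1 1(8)[OF zm(1)] _ 1(9)[OF zm(1)]]) simp
    have l3: "(\<lambda>L. q1 (R z - (\<Sum>i<L. ?B i z))) \<longlonglongrightarrow> 0"
      using s3 by (intro bounded_op_tendsto[OF NF0 NF1 i0 Rz(1) _ Rz(2)]) simp
    have D1: "D z \<in> F1" using FF1 1(8)[OF zm(1)] by blast
    have "(\<lambda>L. q1 ((D z - G z) - ((\<Sum>i<L. \<phi> i z *\<^sub>C e i) - (\<Sum>i<L. ?A i z)))) \<longlonglongrightarrow> 0"
      using s1 s2 FF1 by (intro tendsto_norm_on_diff[OF NF1 D1 Gz(1) _ l1 _ Gz(2)]) auto
    then have l4: "(\<lambda>L. q1 ((D z - G z) - (\<Sum>i<L. ?B i z))) \<longlonglongrightarrow> 0" unfolding sum_subtractf .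
    have R1: "R z \<in> F1" using F0F1 Rz(1) by blast
    show ?thesis
      using s3 F0F1 by (intro norm_on_limit_unique[OF NF1 trivial_limit_sequentially cvs.subspace_diff[OF sF1 D1 Gz(1)] R1 _ l4 l3]) auto
  qed
  have "T * \<epsilon>' \<le> \<epsilon>" unfolding \<epsilon>'_def using \<epsilon> 1(7) by (simp add: pos_divide_le_eq algebra_simps)
  then have "q0 (R z) \<le> \<epsilon> * p n z" if "z \<in> S n" for z
    using bspec[OF R(2) that] mult_right_mono[OF _ norm_on_nonneg[OF Nn that], of "T * \<epsilon>'" \<epsilon>] by linarith
  moreover have "bounded_op (S k) (p k) F1 q1 G" using G by (intro bounded_opI[of _ _ _ _ "T * C"]) auto
  ultimately show ?thesis using eq R(2) by (intro exI[of _ G]) simp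
qed

text \<open>The density hypothesis of a Mittag-Leffler argument for bounded operators on the levels
  \<open>S n\<close>. The pieces \<open>F\<close> and \<open>F1\<close> are free, while
  \<open>F0\<close> is the same for all levels, because the corrections are finally summed in
  it.\<close>

definition approx_property :: "'e::complex_vector topology \<Rightarrow> (nat \<Rightarrow> 'z::complex_vector set) \<Rightarrow> (nat \<Rightarrow> 'z \<Rightarrow> real) \<Rightarrow>
    'e set \<Rightarrow> ('e \<Rightarrow> real) \<Rightarrow> bool" where
  "approx_property E S p F0 q0 \<longleftrightarrow> (\<forall>n. \<exists>m\<ge>n. \<forall>k\<ge>m. \<forall>F q D \<epsilon>. banach_piece E F q \<longrightarrow> bounded_op (S m) (p m) F q D \<longrightarrow> \<epsilon> > 0 \<longrightarrow>
     (\<exists>F1 q1 D'. banach_piece E F1 q1 \<and> bounded_op (S k) (p k) F1 q1 D' \<and>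
       (\<forall>z\<in>S n. D z - D' z \<in> F0 \<and> q0 (D z - D' z) \<le> \<epsilon> * p n z)))"

text \<open>One more inclusion inside \<open>E\<close>, from \<open>G j\<close> to
  \<open>G (Suc j)\<close>, makes any bounded operator nuclear, so the level \<open>m\<close> of
  (D\<Omega>) can be kept.\<close>

lemma approx_property_range_nuclear:
  assumes H: "Hausdorff_space E" and A: "condA_piece E F0 q0" and S: "exhaustion Z S p" and DO: "DOmega S p"
    and G: "exhaustion E G g" and nuc: "\<And>n. nuclear_on (G n) (g n) (G (Suc n)) (g (Suc n)) (\<lambda>x. x)"
  shows "approx_property E S p F0 q0"
  unfolding approx_property_def
proof
  fix n
  have F0: "banach_piece E F0 q0" using A unfolding condA_piece_def by blast
  obtain m where m: "m \<ge> n" and I: "\<And>k. k \<ge> m \<Longrightarrow> interp_ineq S p n m k" using DO unfolding DOmega_def by blast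
  have "\<exists>F1 q1 D'. banach_piece E F1 q1 \<and> bounded_op (S k) (p k) F1 q1 D' \<and>
       (\<forall>z\<in>S n. D z - D' z \<in> F0 \<and> q0 (D z - D' z) \<le> \<epsilon> * p n z)"
    if k: "k \<ge> m" and F: "banach_piece E F q" and D: "bounded_op (S m) (p m) F q D" and \<epsilon>: "\<epsilon> > 0" for k F q D \<epsilon>
  proof -
    obtain j where j: "bounded_op F q (G j) (g j) (\<lambda>x. x)"
      by (rule exhaustion_factor[OF H G banach_pieceD(1)[OF F] linear_on_id banach_pieceD(2)[OF F]])
    have "bounded_op (S m) (p m) (G j) (g j) D"
      using bounded_op_compose[OF exhaustionD(3)[OF S] banach_pieceD(4)[OF F] D j] .
    moreover have "nuclear_op (G j) (g j) (G (Suc j)) (g (Suc j)) (\<lambda>x. x)"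
      by (rule nuclear_on_nuclear_op[OF exhaustionD(3)[OF G] exhaustionD(3)[OF G] nuc])
    ultimately have nD: "nuclear_op (S m) (p m) (G (Suc j)) (g (Suc j)) D"
      using nuclear_op_compose_right[OF exhaustionD(3)[OF G] exhaustionD(3)[OF S]] by blast
    obtain F1 q1 where F1: "banach_piece E F1 q1" and FF1: "\<forall>x\<in>G (Suc j). x \<in> F1 \<and> q1 x \<le> g (Suc j) x"
      and F0F1: "\<forall>x\<in>F0. x \<in> F1 \<and> q1 x \<le> q0 x" and R: "rank_one_approx F0 q0 (G (Suc j)) (g (Suc j)) F1 q1 S p n m k"
      using rank_one_approximation[OF A S m k I[OF k] exhaustionD(1)[OF G, of "Suc j"]] by (elim exE conjE)
    show ?thesis using nuclear_op_approximation[OF R F0 exhaustionD(1)[OF G] F1 bspec[OF FF1] bspec[OF F0F1] S m k nD \<epsilon>] F1 by blast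
  qed
  then show "\<exists>m\<ge>n. \<forall>k\<ge>m. \<forall>F q D \<epsilon>. banach_piece E F q \<longrightarrow> bounded_op (S m) (p m) F q D \<longrightarrow> \<epsilon> > 0 \<longrightarrow>
     (\<exists>F1 q1 D'. banach_piece E F1 q1 \<and> bounded_op (S k) (p k) F1 q1 D' \<and>
       (\<forall>z\<in>S n. D z - D' z \<in> F0 \<and> q0 (D z - D' z) \<le> \<epsilon> * p n z))" using m by blast
qed

text \<open>Here nuclearity comes from restricting an operator on \<open>S (Suc m)\<close> to
  \<open>S m\<close>; hence the level of the approximation property is one higher than that of
  (D\<Omega>).\<close>

lemma approx_property_domain_nuclear:
  assumes A: "condA_piece E F0 q0" and S: "exhaustion Z S p" and DO: "DOmega S p"
    and nuc: "\<And>n. nuclear_on (S n) (p n) (S (Suc n)) (p (Suc n)) (\<lambda>x. x)"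
  shows "approx_property E S p F0 q0"
  unfolding approx_property_def
proof
  fix n
  have F0: "banach_piece E F0 q0" using A unfolding condA_piece_def by blast
  obtain m where m: "m \<ge> n" and I: "\<And>k. k \<ge> m \<Longrightarrow> interp_ineq S p n m k" using DO unfolding DOmega_def by blast
  have "\<exists>F1 q1 D'. banach_piece E F1 q1 \<and> bounded_op (S k) (p k) F1 q1 D' \<and>
       (\<forall>z\<in>S n. D z - D' z \<in> F0 \<and> q0 (D z - D' z) \<le> \<epsilon> * p n z)"
    if k: "k \<ge> Suc m" and F: "banach_piece E F q" and D: "bounded_op (S (Suc m)) (p (Suc m)) F q D" and \<epsilon>: "\<epsilon> > 0" for k F q D \<epsilon>
  proof -
    have km: "k \<ge> m" using k by simp
    have "nuclear_op (S m) (p m) (S (Suc m)) (p (Suc m)) (\<lambda>x. x)"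
      by (rule nuclear_on_nuclear_op[OF exhaustionD(3)[OF S] exhaustionD(3)[OF S] nuc])
    then have nD: "nuclear_op (S m) (p m) F q D"
      using nuclear_op_compose_left[OF exhaustionD(3)[OF S] banach_pieceD(4)[OF F] _ D] by blast
    obtain F1 q1 where F1: "banach_piece E F1 q1" and FF1: "\<forall>x\<in>F. x \<in> F1 \<and> q1 x \<le> q x"
      and F0F1: "\<forall>x\<in>F0. x \<in> F1 \<and> q1 x \<le> q0 x" and R: "rank_one_approx F0 q0 F q F1 q1 S p n m k"
      using rank_one_approximation[OF A S m km I[OF km] F] by (elim exE conjE)
    show ?thesis using nuclear_op_approximation[OF R F0 F F1 bspec[OF FF1] bspec[OF F0F1] S m km nD \<epsilon>] F1 by blast
  qed
  moreover have "Suc m \<ge> n" using m by simp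
  ultimately show "\<exists>m\<ge>n. \<forall>k\<ge>m. \<forall>F q D \<epsilon>. banach_piece E F q \<longrightarrow> bounded_op (S m) (p m) F q D \<longrightarrow> \<epsilon> > 0 \<longrightarrow>
     (\<exists>F1 q1 D'. banach_piece E F1 q1 \<and> bounded_op (S k) (p k) F1 q1 D' \<and>
       (\<forall>z\<in>S n. D z - D' z \<in> F0 \<and> q0 (D z - D' z) \<le> \<epsilon> * p n z))" by blast
qed

text \<open>Hahn-Banach extends each functional with its bound \<open>t i\<close>, so the extended
  series still converges in \<open>F\<close>.\<close>

lemma nuclear_op_extension:
  assumes Y: "norm_on Y p" and K: "K \<subseteq> Y" "cvs.subspace K" and F: "banach_on F q" and D: "nuclear_op K p F q D"
  shows "\<exists>D'. bounded_op Y p F q D' \<and> (\<forall>x\<in>K. D' x = D x)"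
proof -
  obtain \<phi> e t T where 1: "\<And>i. linear_on K (\<phi> i)" "\<And>i x. x \<in> K \<Longrightarrow> cmod (\<phi> i x) \<le> t i * p x" "\<And>i. e i \<in> F" "\<And>i. q (e i) \<le> 1"
    "\<And>i. 0 \<le> t i" "(t has_sum T) UNIV" "0 \<le> T" "\<And>x. x \<in> K \<Longrightarrow> D x \<in> F"
    "\<And>x. x \<in> K \<Longrightarrow> (\<lambda>n. q (D x - (\<Sum>i<n. \<phi> i x *\<^sub>C e i))) \<longlonglongrightarrow> 0"
    using D by (rule nuclear_opE) blast
  note NF = banach_on_norm_on[OF F]
  note sF = norm_on_subspace[OF NF]
  have "\<exists>\<psi>. linear_on Y \<psi> \<and> (\<forall>x\<in>Y. cmod (\<psi> x) \<le> t i * p x) \<and> (\<forall>x\<in>K. \<psi> x = \<phi> i x)" for i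
    by (rule functional_extension[OF K seminorm_on_cmult[OF norm_on_seminorm_on[OF Y] 1(5)] 1(1) 1(2)]) blast+
  then obtain \<psi> where \<psi>: "\<And>i. linear_on Y (\<psi> i)" "\<And>i x. x \<in> Y \<Longrightarrow> cmod (\<psi> i x) \<le> t i * p x" "\<And>i x. x \<in> K \<Longrightarrow> \<psi> i x = \<phi> i x"
    by metis
  have inF: "\<psi> i x *\<^sub>C e i \<in> F" for i x by (intro cvs.subspace_scale[OF sF] 1(3))
  have le: "q (\<psi> i x *\<^sub>C e i) \<le> t i * p x" if x: "x \<in> Y" for i x
  proof -
    have "q (\<psi> i x *\<^sub>C e i) = cmod (\<psi> i x) * q (e i)" by (rule norm_on_scale[OF NF 1(3)])
    also have "\<dots> \<le> cmod (\<psi> i x) * 1" using 1(4) by (intro mult_left_mono) auto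
    finally show ?thesis using \<psi>(2)[OF x, of i] by simp
  qed
  have "\<exists>G. linear_on Y G \<and> (\<forall>x\<in>Y. G x \<in> F \<and> q (G x) \<le> T * p x \<and> (\<lambda>n. q (G x - (\<Sum>i<n. \<psi> i x *\<^sub>C e i))) \<longlonglongrightarrow> 0)"
    by (rule banach_on_operator_series[OF F Y linear_on_rank_one[OF \<psi>(1)] inF le 1(6)])
  then obtain G where G: "linear_on Y G" "\<forall>x\<in>Y. G x \<in> F \<and> q (G x) \<le> T * p x \<and> (\<lambda>n. q (G x - (\<Sum>i<n. \<psi> i x *\<^sub>C e i))) \<longlonglongrightarrow> 0"
    by (elim exE conjE)
  have "G x = D x" if x: "x \<in> K" for x
  proof -
    have Gx: "G x \<in> F" "(\<lambda>n. q (G x - (\<Sum>i<n. \<phi> i x *\<^sub>C e i))) \<longlonglongrightarrow> 0"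
      using bspec[OF G(2), of x] x K(1) \<psi>(3)[OF x] by auto
    have "(\<Sum>i<n. \<phi> i x *\<^sub>C e i) \<in> F" for n by (intro cvs.subspace_sum[OF sF] cvs.subspace_scale[OF sF] 1(3))
    then show ?thesis by (intro norm_on_limit_unique[OF NF trivial_limit_sequentially Gx(1) 1(8)[OF x] _ Gx(2) 1(9)[OF x]]) simp
  qed
  moreover have "bounded_op Y p F q G" using G by (intro bounded_opI[of _ _ _ _ T]) auto
  ultimately show ?thesis by blast
qed

text \<open>Bounded lifts of the single vectors \<open>e i\<close> are enough, since linearity is
  supplied by the functionals. \<open>W\<close> is a common larger space in which the image of the
  lifted series and the original series have the same limit.\<close>

lemma nuclear_lifting:
  assumes S: "norm_on S p" and S': "norm_on S' p'" and nuc: "nuclear_op S p S' p' (\<lambda>x. x)"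
    and Y: "banach_on Y y" and W: "norm_on W w" and Q: "bounded_op Y y W w Q" and i: "bounded_op S' p' W w (\<lambda>x. x)"
    and lift: "\<And>x. x \<in> S' \<Longrightarrow> \<exists>v\<in>Y. Q v = x \<and> y v \<le> C * p' x" and C: "C > 0"
  shows "\<exists>L. bounded_op S p Y y L \<and> (\<forall>z\<in>S. Q (L z) = z)"
proof -
  obtain \<phi> e t T where 1: "\<And>i. linear_on S (\<phi> i)" "\<And>i x. x \<in> S \<Longrightarrow> cmod (\<phi> i x) \<le> t i * p x" "\<And>i. e i \<in> S'" "\<And>i. p' (e i) \<le> 1"
    "\<And>i. 0 \<le> t i" "(t has_sum T) UNIV" "0 \<le> T" "\<And>x. x \<in> S \<Longrightarrow> x \<in> S'"
    "\<And>x. x \<in> S \<Longrightarrow> (\<lambda>n. p' (x - (\<Sum>i<n. \<phi> i x *\<^sub>C e i))) \<longlonglongrightarrow> 0"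
    using nuc by (rule nuclear_opE) blast
  note NY = banach_on_norm_on[OF Y]
  note sY = norm_on_subspace[OF NY] and sS' = norm_on_subspace[OF S'] and sW = norm_on_subspace[OF W]
  have "\<exists>v. v \<in> Y \<and> Q v = e i \<and> y v \<le> C" for i
  proof -
    obtain v where "v \<in> Y" "Q v = e i" "y v \<le> C * p' (e i)" using lift[OF 1(3)] by blast
    moreover have "C * p' (e i) \<le> C" using 1(4)[of i] C by simp
    ultimately show ?thesis using order_trans by blast
  qed
  then obtain v where v: "\<And>i. v i \<in> Y" "\<And>i. Q (v i) = e i" "\<And>i. y (v i) \<le> C" by metis
  have inY: "\<phi> i x *\<^sub>C v i \<in> Y" for i x by (intro cvs.subspace_scale[OF sY] v(1))
  have le: "y (\<phi> i x *\<^sub>C v i) \<le> (t i * C) * p x" if x: "x \<in> S" for i x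
  proof -
    have "y (\<phi> i x *\<^sub>C v i) = cmod (\<phi> i x) * y (v i)" by (rule norm_on_scale[OF NY v(1)])
    also have "\<dots> \<le> (t i * p x) * C"
      using 1(2)[OF x, of i] v(3)[of i] norm_on_nonneg[OF NY v(1)] 1(5)[of i] norm_on_nonneg[OF S x] by (intro mult_mono) auto
    finally show ?thesis by (simp add: mult_ac)
  qed
  have "\<exists>G. linear_on S G \<and> (\<forall>x\<in>S. G x \<in> Y \<and> y (G x) \<le> (T * C) * p x \<and> (\<lambda>n. y (G x - (\<Sum>i<n. \<phi> i x *\<^sub>C v i))) \<longlonglongrightarrow> 0)"
    by (rule banach_on_operator_series[OF Y S linear_on_rank_one[OF 1(1)] inY le has_sum_cmult_left[OF 1(6)]])
  then obtain G where G: "linear_on S G" "\<forall>x\<in>S. G x \<in> Y \<and> y (G x) \<le> (T * C) * p x \<and> (\<lambda>n. y (G x - (\<Sum>i<n. \<phi> i x *\<^sub>C v i))) \<longlonglongrightarrow> 0"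
    by (elim exE conjE)
  have "Q (G x) = x" if x: "x \<in> S" for x
  proof -
    have Gx: "G x \<in> Y" "(\<lambda>n. y (G x - (\<Sum>i<n. \<phi> i x *\<^sub>C v i))) \<longlonglongrightarrow> 0" using bspec[OF G(2) x] by blast+
    have s1: "(\<Sum>i<n. \<phi> i x *\<^sub>C v i) \<in> Y" for n using inY by (intro cvs.subspace_sum[OF sY])
    have s2: "(\<Sum>i<n. \<phi> i x *\<^sub>C e i) \<in> S'" for n by (intro cvs.subspace_sum[OF sS'] cvs.subspace_scale[OF sS'] 1(3))
    have "Q (\<Sum>i<n. \<phi> i x *\<^sub>C v i) = (\<Sum>i<n. \<phi> i x *\<^sub>C e i)" for n
      using linear_on_sum[OF bounded_op_linear[OF Q] sY, of "{..<n}" "\<lambda>i. \<phi> i x *\<^sub>C v i"] inY linear_onD(2)[OF bounded_op_linear[OF Q] v(1)] v(2) by simp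
    moreover have "(\<lambda>n. w (Q (G x) - Q (\<Sum>i<n. \<phi> i x *\<^sub>C v i))) \<longlonglongrightarrow> 0"
      using s1 by (intro bounded_op_tendsto[OF NY W Q Gx(1) _ Gx(2)]) simp
    ultimately have l1: "(\<lambda>n. w (Q (G x) - (\<Sum>i<n. \<phi> i x *\<^sub>C e i))) \<longlonglongrightarrow> 0" by simp
    have l2: "(\<lambda>n. w (x - (\<Sum>i<n. \<phi> i x *\<^sub>C e i))) \<longlonglongrightarrow> 0"
      using s2 by (intro bounded_op_tendsto[OF S' W i 1(8)[OF x] _ 1(9)[OF x]]) simp
    show ?thesis
      using s2 bounded_op_mem[OF i] by (intro norm_on_limit_unique[OF W trivial_limit_sequentially bounded_op_mem[OF Q Gx(1)] bounded_op_mem[OF i 1(8)[OF x]] _ l1 l2]) simp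
  qed
  moreover have "bounded_op S p Y y G" using G by (intro bounded_opI[of _ _ _ _ "T * C"]) auto
  ultimately show ?thesis by blast
qed

section \<open>Weighted \<open>\<ell>\<^sup>1\<close> and \<open>\<ell>\<^sup>\<infinity>\<close> spaces\<close>

lemma sum_fun_eval: "(\<Sum>j\<in>A. f j) i = (\<Sum>j\<in>A. (f j i :: 'b::comm_monoid_add))"
  by (induction A rule: infinite_finite_induct) simp_all

definition wsum :: "('i \<Rightarrow> real) \<Rightarrow> ('i \<Rightarrow> complex) \<Rightarrow> 'i set \<Rightarrow> real" where
  "wsum w c A = (\<Sum>j\<in>A. cmod (w j * c j))"

text \<open>\<open>\<ell>\<^sup>1\<close> and \<open>\<ell>\<^sup>\<infinity>\<close> are the cases where \<open>\<A>\<close> consists of all finite subsets, respectively of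
  the subsets with at most one element.\<close>

lemma banach_on_wsum_Sup:
  fixes w :: "'i \<Rightarrow> real"
  assumes w: "\<And>j. j \<in> I \<Longrightarrow> 0 < w j" and fin: "\<And>A. A \<in> \<A> \<Longrightarrow> finite A \<and> A \<subseteq> I"
    and empty: "{} \<in> \<A>" and cover: "\<And>j. j \<in> I \<Longrightarrow> {j} \<in> \<A>"
  shows "banach_on {c. (\<forall>j. j \<notin> I \<longrightarrow> c j = 0) \<and> bdd_above (wsum w c ` \<A>)} (\<lambda>c. Sup (wsum w c ` \<A>))"
proof -
  let ?S = "{c. (\<forall>j. j \<notin> I \<longrightarrow> c j = 0) \<and> bdd_above (wsum w c ` \<A>)}"
  let ?p = "\<lambda>c. Sup (wsum w c ` \<A>)"
  have upper: "wsum w c A \<le> ?p c" if "c \<in> ?S" "A \<in> \<A>" for c A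
    using that by (intro cSup_upper) auto
  have least: "?p c \<le> r" if "\<And>A. A \<in> \<A> \<Longrightarrow> wsum w c A \<le> r" for c r
    using that empty by (intro cSup_least) auto
  have inS: "c \<in> ?S" if "\<And>j. j \<notin> I \<Longrightarrow> c j = 0" "\<And>A. A \<in> \<A> \<Longrightarrow> wsum w c A \<le> r" for c r
    using that by (auto intro!: bdd_aboveI[of _ r])
  have add: "wsum w (x + y) A \<le> wsum w x A + wsum w y A" for x y A
    unfolding wsum_def sum.distrib[symmetric]
    by (intro sum_mono) (simp add: distrib_left norm_triangle_ineq)
  have scale: "wsum w (a *\<^sub>C x) A = cmod a * wsum w x A" for a x A
    unfolding wsum_def sum_distrib_left
    by (intro sum.cong) (simp_all add: scaleC_fun_def scaleC_complex_def norm_mult mult_ac)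
  have w0: "0 \<le> wsum w x A" for x A unfolding wsum_def by (intro sum_nonneg) simp
  have p0: "0 \<le> ?p c" if "c \<in> ?S" for c using upper[OF that empty] w0[of c "{}"] by simp
  have S0: "0 \<in> ?S" by (rule inS[of _ 0]) (simp_all add: wsum_def)
  have Sadd: "x + y \<in> ?S" if "x \<in> ?S" "y \<in> ?S" for x y
  proof (rule inS[of _ "?p x + ?p y"])
    show "(x + y) j = 0" if "j \<notin> I" for j using that \<open>x \<in> ?S\<close> \<open>y \<in> ?S\<close> by simp
    show "wsum w (x + y) A \<le> ?p x + ?p y" if "A \<in> \<A>" for A
      using add[of x y A] upper[OF \<open>x \<in> ?S\<close> that] upper[OF \<open>y \<in> ?S\<close> that] by linarith
  qed
  have Sscale: "a *\<^sub>C x \<in> ?S" if "x \<in> ?S" for a x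
  proof (rule inS[of _ "cmod a * ?p x"])
    show "(a *\<^sub>C x) j = 0" if "j \<notin> I" for j using that \<open>x \<in> ?S\<close> by (simp add: scaleC_fun_def)
    show "wsum w (a *\<^sub>C x) A \<le> cmod a * ?p x" if "A \<in> \<A>" for A
      unfolding scale using upper[OF \<open>x \<in> ?S\<close> that] by (intro mult_left_mono) auto
  qed
  have sub: "cvs.subspace ?S" using S0 Sadd Sscale by (rule cvs.subspaceI)
  have coord: "w j * cmod (c j) \<le> ?p c" if "c \<in> ?S" "j \<in> I" for c j
    using upper[OF that(1) cover[OF that(2)]] w[OF that(2)] by (simp add: wsum_def norm_mult)
  have N: "norm_on ?S ?p"
    unfolding norm_on_def
  proof (intro conjI sub ballI allI)
    fix x assume x: "x \<in> ?S"
    show "0 \<le> ?p x" using p0[OF x] .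
    show "?p x = 0 \<longleftrightarrow> x = 0"
    proof
      assume z: "?p x = 0"
      have "x j = 0" for j
      proof (cases "j \<in> I")
        case True
        then have "w j * cmod (x j) \<le> 0" using coord[OF x True] z by simp
        then show ?thesis using w[OF True] by (simp add: mult_le_0_iff)
      qed (use x in simp)
      then show "x = 0" by auto
    next
      assume "x = 0"
      moreover have "?p 0 \<le> 0" by (rule least) (simp add: wsum_def)
      ultimately show "?p x = 0" using p0[OF x] by simp
    qed
  next
    have le: "?p (a *\<^sub>C x) \<le> cmod a * ?p x" if "x \<in> ?S" for a x
      using upper[OF that] unfolding scale[symmetric] by (intro least) (simp add: scale mult_left_mono)
    fix a x assume x: "x \<in> ?S"
    show "?p (a *\<^sub>C x) = cmod a * ?p x"
    proof (cases "a = 0")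
      case True
      then show ?thesis using le[OF x, of a] p0[OF Sscale[OF x], of a] by simp
    next
      case False
      have "?p x = ?p ((1 / a) *\<^sub>C (a *\<^sub>C x))" using False by (simp add: scaleC_scaleC scaleC_one)
      also have "\<dots> \<le> cmod (1 / a) * ?p (a *\<^sub>C x)" by (rule le[OF Sscale[OF x]])
      finally have "cmod a * ?p x \<le> ?p (a *\<^sub>C x)" using False by (simp add: norm_divide field_simps)
      then show ?thesis using le[OF x, of a] by simp
    qed
  next
    fix x y assume "x \<in> ?S" "y \<in> ?S"
    then show "?p (x + y) \<le> ?p x + ?p y"
      using add[of x y] upper by (intro least) (meson add_mono order_trans)
  qed
  show ?thesis
    unfolding banach_on_def
  proof (intro conjI N allI impI)
    fix u :: "nat \<Rightarrow> 'i \<Rightarrow> complex"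
    assume u: "range u \<subseteq> ?S \<and> (\<forall>e>0. \<exists>M. \<forall>m\<ge>M. \<forall>n\<ge>M. ?p (u m - u n) < e)"
    have uS: "u n \<in> ?S" for n by (rule subsetD[OF conjunct1[OF u] rangeI])
    have dS: "u m - u n \<in> ?S" for m n by (rule cvs.subspace_diff[OF sub uS uS])
    have "Cauchy (\<lambda>n. u n j)" for j
    proof (cases "j \<in> I")
      case True
      show ?thesis
        unfolding Cauchy_iff
      proof (intro allI impI)
        fix e :: real assume "e > 0"
        then have "w j * e > 0" using w[OF True] by simp
        then obtain M where M: "\<And>m n. m \<ge> M \<Longrightarrow> n \<ge> M \<Longrightarrow> ?p (u m - u n) < w j * e" using u by meson
        have "cmod (u m j - u n j) < e" if "m \<ge> M" "n \<ge> M" for m n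
        proof -
          have "w j * cmod (u m j - u n j) < w j * e"
            using coord[OF dS[of m n] True] M[OF that] by simp
          then show ?thesis using w[OF True] by simp
        qed
        then show "\<exists>M. \<forall>m\<ge>M. \<forall>n\<ge>M. cmod (u m j - u n j) < e" by blast
      qed
    next
      case False
      then have "u n j = 0" for n using uS[of n] by simp
      then show ?thesis by (simp add: Cauchy_iff)
    qed
    then have "\<exists>l. (\<lambda>n. u n j) \<longlonglongrightarrow> l" for j using Cauchy_convergent_iff convergent_def by blast
    then obtain c where c: "\<And>j. (\<lambda>n. u n j) \<longlonglongrightarrow> c j" by metis
    have cI: "c j = 0" if "j \<notin> I" for j
    proof -
      have "u n j = 0" for n using uS[of n] that by simp
      then have "(\<lambda>n. u n j) \<longlonglongrightarrow> 0" by simp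
      then show ?thesis using c[of j] LIMSEQ_unique by blast
    qed
    \<comment> \<open>The Cauchy estimate for one finite set \<open>A\<close> passes to the
      coordinatewise limit in the second index; the resulting bound is uniform in
      \<open>A\<close>.\<close>
    have tail: "\<exists>M. \<forall>n\<ge>M. u n - c \<in> ?S \<and> ?p (u n - c) \<le> e" if e: "e > 0" for e
    proof -
      obtain M where M: "\<And>m n. m \<ge> M \<Longrightarrow> n \<ge> M \<Longrightarrow> ?p (u m - u n) < e" using u e by meson
      have "wsum w (u n - c) A \<le> e" if n: "n \<ge> M" and A: "A \<in> \<A>" for n A
      proof (rule tendsto_upperbound)
        show "(\<lambda>m. wsum w (u n - u m) A) \<longlonglongrightarrow> wsum w (u n - c) A"
          unfolding wsum_def by (auto intro!: tendsto_intros c)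
        show "eventually (\<lambda>m. wsum w (u n - u m) A \<le> e) sequentially"
          using eventually_ge_at_top[of M]
          by eventually_elim (use upper[OF dS A] M n in \<open>meson less_imp_le order_trans\<close>)
      qed simp
      moreover have "(u n - c) j = 0" if "j \<notin> I" for n j using uS[of n] cI[OF that] that by simp
      ultimately have "u n - c \<in> ?S \<and> ?p (u n - c) \<le> e" if "n \<ge> M" for n
        using that by (intro conjI inS[of _ e] least) auto
      then show ?thesis by blast
    qed
    obtain M where "\<forall>n\<ge>M. u n - c \<in> ?S \<and> ?p (u n - c) \<le> 1" using tail[OF zero_less_one] by (elim exE)
    then have "u M - c \<in> ?S" using order_refl[of M] by iprover
    then have "u M - (u M - c) \<in> ?S" by (rule cvs.subspace_diff[OF sub uS])
    moreover have "u M - (u M - c) = c" by simp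
    ultimately have cS: "c \<in> ?S" by (simp only:)
    have "(\<lambda>n. ?p (u n - c)) \<longlonglongrightarrow> 0"
      unfolding tendsto_iff
    proof (intro allI impI)
      fix e :: real assume "e > 0"
      then have "e / 2 > 0" by simp
      from tail[OF this] obtain M where M': "\<forall>n\<ge>M. u n - c \<in> ?S \<and> ?p (u n - c) \<le> e / 2" by (elim exE)
      have "dist (?p (u n - c)) 0 < e" if "n \<ge> M" for n
      proof -
        have "0 \<le> ?p (u n - c)" by (rule p0[OF conjunct1[OF M'[rule_format, OF that]]])
        moreover have "?p (u n - c) \<le> e / 2" by (rule conjunct2[OF M'[rule_format, OF that]])
        ultimately show ?thesis unfolding dist_real_def using \<open>e > 0\<close> by linarith
      qed
      then show "eventually (\<lambda>n. dist (?p (u n - c)) 0 < e) sequentially" unfolding eventually_sequentially by blast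
    qed
    then show "\<exists>x\<in>?S. (\<lambda>n. ?p (u n - x)) \<longlonglongrightarrow> 0" by (rule bexI[OF _ cS])
  qed
qed

lemma banach_on_l1:
  assumes "\<And>j. j \<in> I \<Longrightarrow> 0 < w j"
  shows "banach_on (l1_space I w) (l1_norm I w)"
proof -
  let ?A = "{A. finite A \<and> A \<subseteq> I}"
  have bdd: "(\<lambda>j. cmod (w j * c j)) summable_on I \<longleftrightarrow> bdd_above (wsum w c ` ?A)" for c :: "'a \<Rightarrow> complex"
  proof
    assume s: "(\<lambda>j. cmod (w j * c j)) summable_on I"
    show "bdd_above (wsum w c ` ?A)"
      using finite_sum_le_infsum[OF s] by (intro bdd_aboveI[of _ "infsum (\<lambda>j. cmod (w j * c j)) I"]) (auto simp: wsum_def)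
  next
    assume "bdd_above (wsum w c ` ?A)"
    moreover have "wsum w c ` ?A = sum (\<lambda>j. cmod (w j * c j)) ` {F. F \<subseteq> I \<and> finite F}" by (auto simp: wsum_def)
    ultimately show "(\<lambda>j. cmod (w j * c j)) summable_on I" by (intro nonneg_bdd_above_summable_on) auto
  qed
  have S: "l1_space I w = {c. (\<forall>j. j \<notin> I \<longrightarrow> c j = 0) \<and> bdd_above (wsum w c ` ?A)}"
    unfolding l1_space_def bdd ..
  \<comment> \<open>Stated for members of the space, as \<open>infsum\<close> defaults to 0 for
    families that are not summable.\<close>
  have p: "l1_norm I w c = Sup (wsum w c ` ?A)" if "c \<in> l1_space I w" for c
    using that unfolding l1_norm_def l1_space_def by (subst infsum_nonneg_is_SUPREMUM_real) (auto simp: wsum_def)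
  have B: "banach_on (l1_space I w) (\<lambda>c. Sup (wsum w c ` ?A))"
    unfolding S using assms by (intro banach_on_wsum_Sup) auto
  note sub = banach_on_subspace[OF B]
  have "norm_on (l1_space I w) (l1_norm I w)"
    using banach_on_norm_on[OF B] cvs.subspace_add[OF sub] cvs.subspace_scale[OF sub] unfolding norm_on_def by (simp add: p)
  moreover have "\<exists>x\<in>l1_space I w. (\<lambda>n. l1_norm I w (u n - x)) \<longlonglongrightarrow> 0"
    if u: "range u \<subseteq> l1_space I w" "\<forall>e>0. \<exists>M. \<forall>m\<ge>M. \<forall>n\<ge>M. l1_norm I w (u m - u n) < e" for u :: "nat \<Rightarrow> 'a \<Rightarrow> complex"
  proof -
    have d: "l1_norm I w (u m - x) = Sup (wsum w (u m - x) ` ?A)" if "x \<in> l1_space I w" for m x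
      using u(1) that by (intro p cvs.subspace_diff[OF sub]) auto
    have "\<forall>e>0. \<exists>M. \<forall>m\<ge>M. \<forall>n\<ge>M. Sup (wsum w (u m - u n) ` ?A) < e"
      using u(2) d[OF subsetD[OF u(1) rangeI]] by simp
    then obtain x where "x \<in> l1_space I w" "(\<lambda>n. Sup (wsum w (u n - x) ` ?A)) \<longlonglongrightarrow> 0"
      using B u(1) unfolding banach_on_def by blast
    then show ?thesis using d by (intro bexI[of _ x]) auto
  qed
  ultimately show ?thesis unfolding banach_on_def by blast
qed

lemma banach_on_linf:
  assumes "\<And>j. j \<in> I \<Longrightarrow> 0 < w j"
  shows "banach_on (linf_space I w) (linf_norm I w)"
proof -
  let ?A = "insert {} ((\<lambda>j. {j}) ` I)"
  have im: "wsum w c ` ?A = insert 0 ((\<lambda>j. cmod (w j * c j)) ` I)" for c :: "'a \<Rightarrow> complex"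
    by (auto simp: wsum_def image_image)
  have "linf_space I w = {c. (\<forall>j. j \<notin> I \<longrightarrow> c j = 0) \<and> bdd_above (wsum w c ` ?A)}"
    unfolding linf_space_def im by simp
  moreover have "linf_norm I w = (\<lambda>c. Sup (wsum w c ` ?A))" unfolding linf_norm_def im ..
  ultimately show ?thesis using assms by (simp only:) (intro banach_on_wsum_Sup, auto)
qed

section \<open>Weighted spaces as levels, and operators from l^1\<close>

lemma weight_matrixD:
  assumes "weight_matrix I a" "j \<in> I"
  shows "0 < a n j" "a (Suc n) j \<le> a n j"
  using assms unfolding weight_matrix_def by blast+

lemma exhaustion_k_one:
  assumes a: "weight_matrix I a"
  shows "exhaustion (k_one I a) (\<lambda>n. l1_space I (a n)) (\<lambda>n. l1_norm I (a n))"
  unfolding k_one_def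
proof (rule exhaustion_Ind)
  fix n
  show "banach_on (l1_space I (a n)) (l1_norm I (a n))" using weight_matrixD[OF a] by (intro banach_on_l1)
  show "l1_space I (a n) \<subseteq> l1_space I (a (Suc n))"
  proof
    fix c assume c: "c \<in> l1_space I (a n)"
    have "(\<lambda>j. cmod (a (Suc n) j * c j)) summable_on I"
    proof (rule summable_on_comparison_test)
      show "(\<lambda>j. cmod (a n j * c j)) summable_on I" using c unfolding l1_space_def by blast
      show "cmod (a (Suc n) j * c j) \<le> cmod (a n j * c j)" if "j \<in> I" for j
        using weight_matrixD[OF a that, of n] weight_matrixD(1)[OF a that, of "Suc n"]
        by (simp add: norm_mult mult_right_mono)
    qed simp
    then show "c \<in> l1_space I (a (Suc n))" using c unfolding l1_space_def by blast
  qed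
qed

lemma exhaustion_k_inf:
  assumes a: "weight_matrix I a"
  shows "exhaustion (k_inf I a) (\<lambda>n. linf_space I (a n)) (\<lambda>n. linf_norm I (a n))"
  unfolding k_inf_def
proof (rule exhaustion_Ind)
  fix n
  show "banach_on (linf_space I (a n)) (linf_norm I (a n))" using weight_matrixD[OF a] by (intro banach_on_linf)
  show "linf_space I (a n) \<subseteq> linf_space I (a (Suc n))"
  proof
    fix c assume c: "c \<in> linf_space I (a n)"
    then obtain r where r: "\<And>j. j \<in> I \<Longrightarrow> cmod (a n j * c j) \<le> r" unfolding linf_space_def bdd_above_def by auto
    have "cmod (a (Suc n) j * c j) \<le> r" if "j \<in> I" for j
    proof -
      have "cmod (a (Suc n) j * c j) \<le> cmod (a n j * c j)"
        using weight_matrixD[OF a that, of n] weight_matrixD(1)[OF a that, of "Suc n"]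
        by (simp add: norm_mult mult_right_mono)
      then show ?thesis using r[OF that] by simp
    qed
    then have "bdd_above ((\<lambda>j. cmod (a (Suc n) j * c j)) ` I)" by (auto intro!: bdd_aboveI[of _ r])
    then show "c \<in> linf_space I (a (Suc n))" using c unfolding linf_space_def by blast
  qed
qed

text \<open>Unit vectors and coordinates of k^1(A) carried over to \<open>Z\<close>. They do not
  depend on \<open>n\<close>, only their weights do, so operators on different levels are compared
  coordinate by coordinate.\<close>

definition l1_basis :: "'i set \<Rightarrow> (nat \<Rightarrow> 'i \<Rightarrow> real) \<Rightarrow> (nat \<Rightarrow> 'z::complex_vector set) \<Rightarrow> (nat \<Rightarrow> 'z \<Rightarrow> real) \<Rightarrow>
    ('i \<Rightarrow> 'z \<Rightarrow> complex) \<Rightarrow> ('i \<Rightarrow> 'z) \<Rightarrow> bool" where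
  "l1_basis I a S p c u \<longleftrightarrow> (\<forall>n. (\<forall>j\<in>I. 0 < a n j \<and> linear_on (S n) (c j) \<and> u j \<in> S n \<and> c j (u j) = 1 \<and> p n (u j) = a n j) \<and>
     (\<forall>z\<in>S n. ((\<lambda>j. a n j * cmod (c j z)) has_sum p n z) I \<and>
        ((\<lambda>A. p n (z - (\<Sum>j\<in>A. c j z *\<^sub>C u j))) \<longlongrightarrow> 0) (finite_subsets_at_top I)))"

lemma l1_basisD:
  assumes "l1_basis I a S p c u"
  shows "j \<in> I \<Longrightarrow> 0 < a n j" "j \<in> I \<Longrightarrow> linear_on (S n) (c j)" "j \<in> I \<Longrightarrow> u j \<in> S n" "j \<in> I \<Longrightarrow> c j (u j) = 1"
    "j \<in> I \<Longrightarrow> p n (u j) = a n j" "z \<in> S n \<Longrightarrow> ((\<lambda>j. a n j * cmod (c j z)) has_sum p n z) I"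
    "z \<in> S n \<Longrightarrow> ((\<lambda>A. p n (z - (\<Sum>j\<in>A. c j z *\<^sub>C u j))) \<longlongrightarrow> 0) (finite_subsets_at_top I)"
  using assms unfolding l1_basis_def by blast+

lemma l1_coefficient_bound:
  assumes B: "l1_basis I a S p c u" and j: "j \<in> I" and z: "z \<in> S n"
  shows "a n j * cmod (c j z) \<le> p n z"
proof -
  have "sum (\<lambda>j. a n j * cmod (c j z)) {j} \<le> p n z"
    using j less_imp_le[OF l1_basisD(1)[OF B]] by (intro finite_sum_le_has_sum[OF l1_basisD(6)[OF B z]]) auto
  then show ?thesis by simp
qed

lemma isomorphic_k_one_basis:
  fixes Z :: "'z::complex_vector topology"
  assumes Z: "cvs.subspace (topspace Z)" and a: "weight_matrix I a" and iso: "lc_isomorphic Z (k_one I a)"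
  obtains S p c u where "exhaustion Z S p" "l1_basis I a S p c u"
proof -
  obtain f where f: "linear_on (topspace Z) f" "homeomorphic_map Z (k_one I a) f" using iso unfolding lc_isomorphic_def by blast
  let ?S = "\<lambda>n. {x \<in> topspace Z. f x \<in> l1_space I (a n)}" and ?p = "\<lambda>n x. l1_norm I (a n) (f x)"
  let ?e = "\<lambda>j i. if i = j then (1::complex) else 0"
  have S: "exhaustion Z ?S ?p" by (rule homeomorphic_exhaustion[OF f Z exhaustion_k_one[OF a]])
  have e: "?e j \<in> l1_space I (a n)" "l1_norm I (a n) (?e j) = a n j" if "j \<in> I" for j n
  proof -
    have "((\<lambda>i. cmod (a n i * ?e j i)) has_sum (\<Sum>i\<in>{j}. cmod (a n i * ?e j i))) I"
      using that by (intro has_sum_finite_neutralI[of "{j}"]) auto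
    then have hs: "((\<lambda>i. cmod (a n i * ?e j i)) has_sum a n j) I" using weight_matrixD(1)[OF a that, of n] by simp
    show "?e j \<in> l1_space I (a n)" using that has_sum_imp_summable[OF hs] unfolding l1_space_def by auto
    show "l1_norm I (a n) (?e j) = a n j" unfolding l1_norm_def by (rule infsumI[OF hs])
  qed
  have "\<exists>z. z \<in> topspace Z \<and> f z = ?e j" if "j \<in> I" for j
  proof -
    have "?e j \<in> topspace (k_one I a)" using e(1)[OF that] exhaustionD(2)[OF exhaustion_k_one[OF a]] by blast
    then have "?e j \<in> f ` topspace Z" using homeomorphic_imp_surjective_map[OF f(2)] by simp
    then show ?thesis by (metis (no_types, lifting) imageE)
  qed
  then obtain u where u: "\<And>j. j \<in> I \<Longrightarrow> u j \<in> topspace Z" "\<And>j. j \<in> I \<Longrightarrow> f (u j) = ?e j" by metis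
  have "l1_basis I a ?S ?p (\<lambda>j z. f z j) u"
    unfolding l1_basis_def
  proof (intro allI conjI ballI)
    fix n j assume j: "j \<in> I"
    show "0 < a n j" by (rule weight_matrixD(1)[OF a j])
    show "linear_on (?S n) (\<lambda>z. f z j)"
      using linear_onD[OF f(1)] by (auto simp: linear_on_def scaleC_fun_def)
    show "u j \<in> ?S n" "f (u j) j = 1" "?p n (u j) = a n j" using u[OF j] e[OF j] by auto
  next
    fix n z assume z: "z \<in> ?S n"
    have fz: "f z \<in> l1_space I (a n)" "z \<in> topspace Z" using z by auto
    have eq: "cmod (a n j * f z j) = a n j * cmod (f z j)" if "j \<in> I" for j
      using weight_matrixD(1)[OF a that, of n] by (simp add: norm_mult)
    have hs: "((\<lambda>j. cmod (a n j * f z j)) has_sum ?p n z) I"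
      using fz unfolding l1_norm_def l1_space_def by (intro has_sum_infsum) blast
    then show "((\<lambda>j. a n j * cmod (f z j)) has_sum ?p n z) I" by (simp only: has_sum_cong[OF eq])
    \<comment> \<open>Removing the coordinates in \<open>A\<close> leaves the tail of the series for
      the norm, so the expansion converges because that series does.\<close>
    have "?p n (z - (\<Sum>j\<in>A. f z j *\<^sub>C u j)) = ?p n z - (\<Sum>j\<in>A. cmod (a n j * f z j))" if A: "finite A" "A \<subseteq> I" for A
    proof -
      have m: "f z j *\<^sub>C u j \<in> topspace Z" if "j \<in> A" for j using u(1) A(2) that by (intro cvs.subspace_scale[OF Z]) auto
      have sm: "(\<Sum>j\<in>A. f z j *\<^sub>C u j) \<in> topspace Z" by (rule cvs.subspace_sum[OF Z m])
      have fs: "f (\<Sum>j\<in>A. f z j *\<^sub>C u j) = (\<Sum>j\<in>A. f (f z j *\<^sub>C u j))" by (rule linear_on_sum[OF f(1) Z m])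
      have "f (z - (\<Sum>j\<in>A. f z j *\<^sub>C u j)) = f z - (\<Sum>j\<in>A. f (f z j *\<^sub>C u j))"
        unfolding linear_on_diff[OF f(1) Z fz(2) sm] fs ..
      also have "\<dots> = f z - (\<Sum>j\<in>A. f z j *\<^sub>C ?e j)"
        using A(2) u linear_onD(2)[OF f(1)] by (intro arg_cong[where f = "\<lambda>x. f z - x"] sum.cong) auto
      finally have v: "f (z - (\<Sum>j\<in>A. f z j *\<^sub>C u j)) = f z - (\<Sum>j\<in>A. f z j *\<^sub>C ?e j)" .
      have s: "(\<Sum>j\<in>A. f z j *\<^sub>C ?e j) i = (if i \<in> A then f z i else 0)" for i
      proof -
        have "(\<Sum>j\<in>A. f z j *\<^sub>C ?e j) i = (\<Sum>j\<in>A. if i = j then f z j else 0)"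
          unfolding sum_fun_eval by (intro sum.cong) (auto simp: scaleC_fun_def scaleC_complex_def)
        also have "\<dots> = (if i \<in> A then f z i else 0)" using A(1) by simp
        finally show ?thesis .
      qed
      have "((\<lambda>j. cmod (a n j * f z j)) has_sum (?p n z - (\<Sum>j\<in>A. cmod (a n j * f z j)))) (I - A)"
        by (rule has_sum_Diff[OF hs has_sum_finite[OF A(1)] A(2)])
      then have "((\<lambda>j. cmod (a n j * f (z - (\<Sum>j\<in>A. f z j *\<^sub>C u j)) j)) has_sum (?p n z - (\<Sum>j\<in>A. cmod (a n j * f z j)))) I"
        unfolding v by (rule iffD1[OF has_sum_cong_neutral, rotated -1]) (auto simp: s)
      then show ?thesis unfolding l1_norm_def by (rule infsumI)
    qed
    then have ev: "eventually (\<lambda>A. ?p n z - (\<Sum>j\<in>A. cmod (a n j * f z j)) = ?p n (z - (\<Sum>j\<in>A. f z j *\<^sub>C u j))) (finite_subsets_at_top I)"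
      by (intro eventually_finite_subsets_at_top_weakI) simp
    have "((\<lambda>A. ?p n z - (\<Sum>j\<in>A. cmod (a n j * f z j))) \<longlongrightarrow> ?p n z - ?p n z) (finite_subsets_at_top I)"
      using hs unfolding has_sum_def by (intro tendsto_diff tendsto_const)
    from Lim_transform_eventually[OF this ev]
    show "((\<lambda>A. ?p n (z - (\<Sum>j\<in>A. f z j *\<^sub>C u j))) \<longlongrightarrow> 0) (finite_subsets_at_top I)" by simp
  qed
  with S show thesis by (rule that)
qed

text \<open>An operator on a weighted l^1 space amounts to a choice of images of the unit vectors,
  and \<open>C\<close> bounds these images relative to the weights.\<close>

lemma l1_operator:
  assumes B: "l1_basis I a S p c u" and S: "cvs.subspace (S n)" and F: "banach_on F q"
    and x: "\<And>j. j \<in> I \<Longrightarrow> x j \<in> F" "\<And>j. j \<in> I \<Longrightarrow> q (x j) \<le> C * a n j"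
  shows "\<exists>G. linear_on (S n) G \<and> (\<forall>z\<in>S n. G z \<in> F \<and> q (G z) \<le> C * p n z \<and>
    ((\<lambda>A. q (G z - (\<Sum>j\<in>A. c j z *\<^sub>C x j))) \<longlongrightarrow> 0) (finite_subsets_at_top I))"
proof -
  note N = banach_on_norm_on[OF F]
  have lin: "linear_on (S n) (\<lambda>z. c j z *\<^sub>C x j)" if "j \<in> I" for j by (rule linear_on_rank_one[OF l1_basisD(2)[OF B that]])
  have inF: "c j z *\<^sub>C x j \<in> F" if "j \<in> I" for j z by (rule cvs.subspace_scale[OF norm_on_subspace[OF N] x(1)[OF that]])
  have s: "(\<lambda>j. q (c j z *\<^sub>C x j)) summable_on I \<and> infsum (\<lambda>j. q (c j z *\<^sub>C x j)) I \<le> C * p n z" if z: "z \<in> S n" for z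
  proof -
    have hs: "((\<lambda>j. C * (a n j * cmod (c j z))) has_sum (C * p n z)) I"
      by (rule has_sum_cmult_right[OF l1_basisD(6)[OF B z]])
    have le: "q (c j z *\<^sub>C x j) \<le> C * (a n j * cmod (c j z))" if "j \<in> I" for j
      using norm_on_scale[OF N x(1)[OF that], of "c j z"] mult_left_mono[OF x(2)[OF that] norm_ge_zero[of "c j z"]]
      by (simp add: mult_ac)
    have ge: "0 \<le> q (c j z *\<^sub>C x j)" if "j \<in> I" for j by (rule norm_on_nonneg[OF N inF[OF that]])
    show ?thesis by (intro conjI summable_on_le_has_sum[OF hs ge le])
  qed
  have "\<exists>G. linear_on (S n) G \<and> (\<forall>z\<in>S n. G z \<in> F \<and>
    ((\<lambda>A. q (G z - (\<Sum>j\<in>A. c j z *\<^sub>C x j))) \<longlongrightarrow> 0) (finite_subsets_at_top I) \<and> q (G z) \<le> infsum (\<lambda>j. q (c j z *\<^sub>C x j)) I)"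
    by (rule banach_on_operator_sum[OF F S lin inF]) (use s in blast)+
  then obtain G where G: "linear_on (S n) G" "\<forall>z\<in>S n. G z \<in> F \<and>
    ((\<lambda>A. q (G z - (\<Sum>j\<in>A. c j z *\<^sub>C x j))) \<longlongrightarrow> 0) (finite_subsets_at_top I) \<and> q (G z) \<le> infsum (\<lambda>j. q (c j z *\<^sub>C x j)) I"
    by (elim exE conjE)
  have "q (G z) \<le> C * p n z" if "z \<in> S n" for z
    using bspec[OF G(2) that] s[OF that] by linarith
  then show ?thesis using G by blast
qed

text \<open>Projectivity of l^1: lifting the unit vectors with a common constant is enough. That
  \<open>L\<close> is a right inverse is a comparison of limits in the larger space
  \<open>W\<close>.\<close>

lemma l1_lifting:
  assumes B: "l1_basis I a S p c u" and S: "norm_on (S n) (p n)"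
    and Y: "banach_on Y y" and W: "norm_on W w" and Q: "bounded_op Y y W w Q" and i: "bounded_op (S n) (p n) W w (\<lambda>x. x)"
    and lift: "\<And>x. x \<in> S n \<Longrightarrow> \<exists>v\<in>Y. Q v = x \<and> y v \<le> C * p n x"
  shows "\<exists>L. bounded_op (S n) (p n) Y y L \<and> (\<forall>z\<in>S n. Q (L z) = z)"
proof -
  note NY = banach_on_norm_on[OF Y]
  note sY = norm_on_subspace[OF NY] and sS = norm_on_subspace[OF S]
  have "\<exists>v. v \<in> Y \<and> Q v = u j \<and> y v \<le> C * a n j" if "j \<in> I" for j
    using lift[OF l1_basisD(3)[OF B that]] l1_basisD(5)[OF B that] by metis
  then obtain v where v: "\<And>j. j \<in> I \<Longrightarrow> v j \<in> Y" "\<And>j. j \<in> I \<Longrightarrow> Q (v j) = u j" "\<And>j. j \<in> I \<Longrightarrow> y (v j) \<le> C * a n j" by metis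
  have "\<exists>G. linear_on (S n) G \<and> (\<forall>z\<in>S n. G z \<in> Y \<and> y (G z) \<le> C * p n z \<and>
    ((\<lambda>A. y (G z - (\<Sum>j\<in>A. c j z *\<^sub>C v j))) \<longlongrightarrow> 0) (finite_subsets_at_top I))"
    by (rule l1_operator[OF B sS Y v(1,3)])
  then obtain G where G: "linear_on (S n) G" "\<forall>z\<in>S n. G z \<in> Y \<and> y (G z) \<le> C * p n z \<and>
    ((\<lambda>A. y (G z - (\<Sum>j\<in>A. c j z *\<^sub>C v j))) \<longlongrightarrow> 0) (finite_subsets_at_top I)" by (elim exE conjE)
  have "Q (G z) = z" if z: "z \<in> S n" for z
  proof -
    have Gz: "G z \<in> Y" "((\<lambda>A. y (G z - (\<Sum>j\<in>A. c j z *\<^sub>C v j))) \<longlongrightarrow> 0) (finite_subsets_at_top I)" using bspec[OF G(2) z] by blast+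
    have e1: "eventually (\<lambda>A. (\<Sum>j\<in>A. c j z *\<^sub>C v j) \<in> Y) (finite_subsets_at_top I)"
      using v(1) by (intro eventually_sum_in_subspace[OF sY] cvs.subspace_scale[OF sY])
    have e2: "eventually (\<lambda>A. (\<Sum>j\<in>A. c j z *\<^sub>C u j) \<in> S n) (finite_subsets_at_top I)"
      using l1_basisD(3)[OF B] by (intro eventually_sum_in_subspace[OF sS] cvs.subspace_scale[OF sS])
    have l2: "((\<lambda>A. w (z - (\<Sum>j\<in>A. c j z *\<^sub>C u j))) \<longlongrightarrow> 0) (finite_subsets_at_top I)"
      by (rule bounded_op_tendsto[OF S W i z e2 l1_basisD(7)[OF B z]])
    have "((\<lambda>A. w (Q (G z) - Q (\<Sum>j\<in>A. c j z *\<^sub>C v j))) \<longlongrightarrow> 0) (finite_subsets_at_top I)"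
      by (rule bounded_op_tendsto[OF NY W Q Gz(1) e1 Gz(2)])
    moreover have "eventually (\<lambda>A. w (Q (G z) - Q (\<Sum>j\<in>A. c j z *\<^sub>C v j)) = w (Q (G z) - (\<Sum>j\<in>A. c j z *\<^sub>C u j))) (finite_subsets_at_top I)"
    proof (rule eventually_finite_subsets_at_top_weakI)
      fix A assume A: "A \<subseteq> I"
      have "Q (\<Sum>j\<in>A. c j z *\<^sub>C v j) = (\<Sum>j\<in>A. Q (c j z *\<^sub>C v j))"
        using A v(1) by (intro linear_on_sum[OF bounded_op_linear[OF Q] sY] cvs.subspace_scale[OF sY]) auto
      also have "\<dots> = (\<Sum>j\<in>A. c j z *\<^sub>C u j)"
        using A v(1,2) linear_onD(2)[OF bounded_op_linear[OF Q]] by (intro sum.cong) auto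
      finally show "w (Q (G z) - Q (\<Sum>j\<in>A. c j z *\<^sub>C v j)) = w (Q (G z) - (\<Sum>j\<in>A. c j z *\<^sub>C u j))" by simp
    qed
    ultimately have l1: "((\<lambda>A. w (Q (G z) - (\<Sum>j\<in>A. c j z *\<^sub>C u j))) \<longlongrightarrow> 0) (finite_subsets_at_top I)"
      by (rule Lim_transform_eventually)
    have "eventually (\<lambda>A. (\<Sum>j\<in>A. c j z *\<^sub>C u j) \<in> W) (finite_subsets_at_top I)"
      using e2 by eventually_elim (rule bounded_op_mem[OF i])
    then show ?thesis
      by (rule norm_on_limit_unique[OF W finite_subsets_at_top_neq_bot bounded_op_mem[OF Q Gz(1)] bounded_op_mem[OF i z] _ l1 l2])
  qed
  moreover have "bounded_op (S n) (p n) Y y G" using G by (intro bounded_opI[of _ _ _ _ C]) auto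
  ultimately show ?thesis by blast
qed

text \<open>Each unit vector is treated by itself: the operator sending z to c_j(z) D(u_j) has rank
  one, and of its approximant only the value at \<open>u j\<close> is kept, as the new image
  \<open>x j\<close>. The l^1 structure then assembles the images on \<open>S k\<close> and the
  differences on \<open>S n\<close>.\<close>

lemma approx_property_l1:
  assumes A: "condA_piece E F0 q0" and S: "exhaustion Z S p" and DO: "DOmega S p" and B: "l1_basis I a S p c u"
  shows "approx_property E S p F0 q0"
  unfolding approx_property_def
proof
  fix n
  have F0: "banach_piece E F0 q0" using A unfolding condA_piece_def by blast
  obtain m where m: "m \<ge> n" and I: "\<And>k. k \<ge> m \<Longrightarrow> interp_ineq S p n m k" using DO unfolding DOmega_def by blast
  have "\<exists>F1 q1 D'. banach_piece E F1 q1 \<and> bounded_op (S k) (p k) F1 q1 D' \<and>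
       (\<forall>z\<in>S n. D z - D' z \<in> F0 \<and> q0 (D z - D' z) \<le> \<epsilon> * p n z)"
    if k: "k \<ge> m" and F: "banach_piece E F q" and D: "bounded_op (S m) (p m) F q D" and \<epsilon>: "\<epsilon> > 0" for k F q D \<epsilon>
  proof -
    note Nm = exhaustionD(3)[OF S, of m] and sm = exhaustionD(5)[OF S, of m] and sk = exhaustionD(5)[OF S, of k] and sn = exhaustionD(5)[OF S, of n]
    have Snm: "S n \<subseteq> S m" and Snk: "S n \<subseteq> S k" using exhaustion_mono[OF S] m k by auto
    obtain b where b: "b > 0" "\<And>z. z \<in> S m \<Longrightarrow> q (D z) \<le> b * p m z" using bounded_op_bound[OF Nm D] by blast
    obtain F1 q1 where F1: "banach_piece E F1 q1" and FF1: "\<forall>x\<in>F. x \<in> F1 \<and> q1 x \<le> q x"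
      and F0F1: "\<forall>x\<in>F0. x \<in> F1 \<and> q1 x \<le> q0 x" and R: "rank_one_approx F0 q0 F q F1 q1 S p n m k"
      using rank_one_approximation[OF A S m k I[OF k] F] by (elim exE conjE)
    note NF = banach_pieceD(4)[OF F] and NF1 = banach_pieceD(4)[OF F1] and NF0 = banach_pieceD(4)[OF F0]
    note sF = banach_pieceD(5)[OF F] and sF1 = banach_pieceD(5)[OF F1] and sF0 = banach_pieceD(5)[OF F0]
    \<comment> \<open>The approximants are multiplied by b afterwards, hence the accuracy
      \<epsilon>/b.\<close>
    have "\<epsilon> / b > 0" using \<epsilon> b by simp
    then obtain C where C: "C > 0" and app: "\<forall>\<phi> e. linear_on (S m) \<phi> \<longrightarrow>
     (\<forall>z\<in>S m. cmod (\<phi> z) \<le> p m z) \<longrightarrow> e \<in> F \<longrightarrow> q e \<le> 1 \<longrightarrow>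
     (\<exists>D. linear_on (S k) D \<and> (\<forall>z\<in>S k. D z \<in> F1 \<and> q1 (D z) \<le> C * p k z) \<and>
       (\<forall>z\<in>S n. \<phi> z *\<^sub>C e - D z \<in> F0 \<and> q0 (\<phi> z *\<^sub>C e - D z) \<le> \<epsilon> / b * p n z))"
      using R unfolding rank_one_approx_def by blast
    have ex: "\<exists>x. x \<in> F1 \<and> q1 x \<le> (b * C) * a k j \<and> D (u j) - x \<in> F0 \<and> q0 (D (u j) - x) \<le> \<epsilon> * a n j" if j: "j \<in> I" for j
    proof -
      have am: "a m j > 0" by (rule l1_basisD(1)[OF B j])
      note uS = l1_basisD(3)[OF B j] and pu = l1_basisD(5)[OF B j]
      \<comment> \<open>Scaled so that the functional is bounded by \<open>p m\<close> and the
        vector lies in the unit ball of \<open>F\<close>; at \<open>u j\<close> their product is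
        D(u_j)/b.\<close>
      let ?\<phi> = "\<lambda>z. complex_of_real (a m j) *\<^sub>C c j z" and ?e = "complex_of_real (1 / (b * a m j)) *\<^sub>C D (u j)"
      have 1: "linear_on (S m) ?\<phi>" by (rule linear_on_scaled[OF l1_basisD(2)[OF B j]])
      have 2: "cmod (?\<phi> z) \<le> p m z" if "z \<in> S m" for z
        using l1_coefficient_bound[OF B j that] am by (simp add: scaleC_complex_def norm_mult)
      have DF: "D (u j) \<in> F" by (rule bounded_op_mem[OF D uS])
      have 3: "?e \<in> F" by (rule cvs.subspace_scale[OF sF DF])
      have "q ?e = (1 / (b * a m j)) * q (D (u j))" unfolding norm_on_scale[OF NF DF] norm_of_real using b am by simp
      also have "\<dots> \<le> (1 / (b * a m j)) * (b * a m j)" using b(2)[OF uS] b(1) am pu by (intro mult_left_mono) auto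
      also have "\<dots> = 1" using b am by simp
      finally have 4: "q ?e \<le> 1" .
      obtain T where T: "\<forall>z\<in>S k. T z \<in> F1 \<and> q1 (T z) \<le> C * p k z"
        "\<forall>z\<in>S n. ?\<phi> z *\<^sub>C ?e - T z \<in> F0 \<and> q0 (?\<phi> z *\<^sub>C ?e - T z) \<le> \<epsilon> / b * p n z"
        using app[rule_format, OF 1 2 3 4] by blast
      let ?x = "complex_of_real b *\<^sub>C T (u j)"
      have Tu: "T (u j) \<in> F1" "q1 (T (u j)) \<le> C * a k j" using bspec[OF T(1) uS] pu by auto
      have d: "?\<phi> (u j) *\<^sub>C ?e - T (u j) \<in> F0" "q0 (?\<phi> (u j) *\<^sub>C ?e - T (u j)) \<le> \<epsilon> / b * a n j" using bspec[OF T(2) uS] pu by auto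
      have bmul: "complex_of_real b *\<^sub>C (?\<phi> (u j) *\<^sub>C ?e) = D (u j)"
        using l1_basisD(4)[OF B j] b am by (simp add: scaleC_complex_def scaleC_scaleC scaleC_one)
      have eq: "D (u j) - ?x = complex_of_real b *\<^sub>C (?\<phi> (u j) *\<^sub>C ?e - T (u j))"
        unfolding cvs.scale_right_diff_distrib bmul ..
      have "?x \<in> F1" by (rule cvs.subspace_scale[OF sF1 Tu(1)])
      moreover have "q1 ?x \<le> (b * C) * a k j"
        unfolding norm_on_scale[OF NF1 Tu(1)] using Tu(2) b(1) by (simp add: mult.assoc)
      moreover have "D (u j) - ?x \<in> F0" unfolding eq by (rule cvs.subspace_scale[OF sF0 d(1)])
      moreover have "q0 (D (u j) - ?x) \<le> \<epsilon> * a n j"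
        unfolding eq norm_on_scale[OF NF0 d(1)] using mult_left_mono[OF d(2), of b] b(1) by simp
      ultimately show ?thesis by blast
    qed
    then obtain x where x: "\<And>j. j \<in> I \<Longrightarrow> x j \<in> F1" "\<And>j. j \<in> I \<Longrightarrow> q1 (x j) \<le> (b * C) * a k j"
      "\<And>j. j \<in> I \<Longrightarrow> D (u j) - x j \<in> F0" "\<And>j. j \<in> I \<Longrightarrow> q0 (D (u j) - x j) \<le> \<epsilon> * a n j" by metis
    have "\<exists>G. linear_on (S k) G \<and> (\<forall>z\<in>S k. G z \<in> F1 \<and> q1 (G z) \<le> (b * C) * p k z \<and>
      ((\<lambda>A. q1 (G z - (\<Sum>j\<in>A. c j z *\<^sub>C x j))) \<longlongrightarrow> 0) (finite_subsets_at_top I))"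
      by (rule l1_operator[OF B sk banach_pieceD(1)[OF F1] x(1,2)])
    then obtain G where G: "linear_on (S k) G" "\<forall>z\<in>S k. G z \<in> F1 \<and> q1 (G z) \<le> (b * C) * p k z \<and>
      ((\<lambda>A. q1 (G z - (\<Sum>j\<in>A. c j z *\<^sub>C x j))) \<longlongrightarrow> 0) (finite_subsets_at_top I)" by (elim exE conjE)
    have "\<exists>H. linear_on (S n) H \<and> (\<forall>z\<in>S n. H z \<in> F0 \<and> q0 (H z) \<le> \<epsilon> * p n z \<and>
      ((\<lambda>A. q0 (H z - (\<Sum>j\<in>A. c j z *\<^sub>C (D (u j) - x j)))) \<longlongrightarrow> 0) (finite_subsets_at_top I))"
      by (rule l1_operator[OF B sn banach_pieceD(1)[OF F0] x(3,4)])
    then obtain H where H: "linear_on (S n) H" "\<forall>z\<in>S n. H z \<in> F0 \<and> q0 (H z) \<le> \<epsilon> * p n z \<and>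
      ((\<lambda>A. q0 (H z - (\<Sum>j\<in>A. c j z *\<^sub>C (D (u j) - x j)))) \<longlongrightarrow> 0) (finite_subsets_at_top I)" by (elim exE conjE)
    have i1: "bounded_op F q F1 q1 (\<lambda>x. x)" using FF1 by (intro bounded_op_id[of _ _ _ 1]) auto
    have i0: "bounded_op F0 q0 F1 q1 (\<lambda>x. x)" using F0F1 by (intro bounded_op_id[of _ _ _ 1]) auto
    have eq: "D z - G z = H z" if z: "z \<in> S n" for z
    proof -
      have zm: "z \<in> S m" "z \<in> S k" using z Snm Snk by auto
      have Gz: "G z \<in> F1" "((\<lambda>A. q1 (G z - (\<Sum>j\<in>A. c j z *\<^sub>C x j))) \<longlongrightarrow> 0) (finite_subsets_at_top I)" using bspec[OF G(2) zm(2)] by blast+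
      have Hz: "H z \<in> F0" "((\<lambda>A. q0 (H z - (\<Sum>j\<in>A. c j z *\<^sub>C (D (u j) - x j)))) \<longlongrightarrow> 0) (finite_subsets_at_top I)" using bspec[OF H(2) z] by blast+
      have D1: "D z \<in> F1" using FF1 bounded_op_mem[OF D zm(1)] by blast
      have D': "bounded_op (S m) (p m) F1 q1 D" by (rule bounded_op_compose[OF Nm NF D i1])
      have e1: "eventually (\<lambda>A. (\<Sum>j\<in>A. c j z *\<^sub>C u j) \<in> S m) (finite_subsets_at_top I)"
        using l1_basisD(3)[OF B] by (intro eventually_sum_in_subspace[OF sm] cvs.subspace_scale[OF sm])
      have e2: "eventually (\<lambda>A. D (\<Sum>j\<in>A. c j z *\<^sub>C u j) \<in> F1) (finite_subsets_at_top I)"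
        using e1 by eventually_elim (rule bounded_op_mem[OF D'])
      have e3: "eventually (\<lambda>A. (\<Sum>j\<in>A. c j z *\<^sub>C x j) \<in> F1) (finite_subsets_at_top I)"
        using x(1) by (intro eventually_sum_in_subspace[OF sF1] cvs.subspace_scale[OF sF1])
      have e4: "eventually (\<lambda>A. (\<Sum>j\<in>A. c j z *\<^sub>C (D (u j) - x j)) \<in> F0) (finite_subsets_at_top I)"
        using x(3) by (intro eventually_sum_in_subspace[OF sF0] cvs.subspace_scale[OF sF0])
      have e5: "eventually (\<lambda>A. (\<Sum>j\<in>A. c j z *\<^sub>C (D (u j) - x j)) \<in> F1) (finite_subsets_at_top I)"
        using e4 by eventually_elim (use F0F1 in blast)
      have "((\<lambda>A. q1 (D z - D (\<Sum>j\<in>A. c j z *\<^sub>C u j))) \<longlongrightarrow> 0) (finite_subsets_at_top I)"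
        by (rule bounded_op_tendsto[OF Nm NF1 D' zm(1) e1 l1_basisD(7)[OF B zm(1)]])
      then have "((\<lambda>A. q1 ((D z - G z) - (D (\<Sum>j\<in>A. c j z *\<^sub>C u j) - (\<Sum>j\<in>A. c j z *\<^sub>C x j)))) \<longlongrightarrow> 0) (finite_subsets_at_top I)"
        by (rule tendsto_norm_on_diff[OF NF1 D1 Gz(1) e2 _ e3 Gz(2)])
      moreover have "eventually (\<lambda>A. q1 ((D z - G z) - (D (\<Sum>j\<in>A. c j z *\<^sub>C u j) - (\<Sum>j\<in>A. c j z *\<^sub>C x j))) =
          q1 ((D z - G z) - (\<Sum>j\<in>A. c j z *\<^sub>C (D (u j) - x j)))) (finite_subsets_at_top I)"
      proof (rule eventually_finite_subsets_at_top_weakI)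
        fix A assume A: "A \<subseteq> I"
        have "D (\<Sum>j\<in>A. c j z *\<^sub>C u j) = (\<Sum>j\<in>A. D (c j z *\<^sub>C u j))"
          using A l1_basisD(3)[OF B] by (intro linear_on_sum[OF bounded_op_linear[OF D] sm] cvs.subspace_scale[OF sm]) auto
        also have "\<dots> = (\<Sum>j\<in>A. c j z *\<^sub>C D (u j))"
          using A l1_basisD(3)[OF B] linear_onD(2)[OF bounded_op_linear[OF D]] by (intro sum.cong) auto
        finally show "q1 ((D z - G z) - (D (\<Sum>j\<in>A. c j z *\<^sub>C u j) - (\<Sum>j\<in>A. c j z *\<^sub>C x j))) =
          q1 ((D z - G z) - (\<Sum>j\<in>A. c j z *\<^sub>C (D (u j) - x j)))"
          by (simp add: cvs.scale_right_diff_distrib sum_subtractf)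
      qed
      ultimately have l4: "((\<lambda>A. q1 ((D z - G z) - (\<Sum>j\<in>A. c j z *\<^sub>C (D (u j) - x j)))) \<longlongrightarrow> 0) (finite_subsets_at_top I)"
        by (rule Lim_transform_eventually)
      have l3: "((\<lambda>A. q1 (H z - (\<Sum>j\<in>A. c j z *\<^sub>C (D (u j) - x j)))) \<longlongrightarrow> 0) (finite_subsets_at_top I)"
        by (rule bounded_op_tendsto[OF NF0 NF1 i0 Hz(1) e4 Hz(2)])
      have "H z \<in> F1" using F0F1 Hz(1) by blast
      then show ?thesis
        by (rule norm_on_limit_unique[OF NF1 finite_subsets_at_top_neq_bot cvs.subspace_diff[OF sF1 D1 Gz(1)] _ e5 l4 l3])
    qed
    have "bounded_op (S k) (p k) F1 q1 G" using G by (intro bounded_opI[of _ _ _ _ "b * C"]) auto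
    then show ?thesis using F1 eq H(2) by (intro exI[of _ F1] exI[of _ q1] exI[of _ G]) simp
  qed
  then show "\<exists>m\<ge>n. \<forall>k\<ge>m. \<forall>F q D \<epsilon>. banach_piece E F q \<longrightarrow> bounded_op (S m) (p m) F q D \<longrightarrow> \<epsilon> > 0 \<longrightarrow>
     (\<exists>F1 q1 D'. banach_piece E F1 q1 \<and> bounded_op (S k) (p k) F1 q1 D' \<and>
       (\<forall>z\<in>S n. D z - D' z \<in> F0 \<and> q0 (D z - D' z) \<le> \<epsilon> * p n z))" using m by blast
qed

section \<open>Coordinates and operators into l^infinity\<close>

definition linf_coords :: "'i set \<Rightarrow> (nat \<Rightarrow> 'i \<Rightarrow> real) \<Rightarrow> (nat \<Rightarrow> 'e::complex_vector set) \<Rightarrow> (nat \<Rightarrow> 'e \<Rightarrow> real) \<Rightarrow>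
    ('i \<Rightarrow> 'e \<Rightarrow> complex) \<Rightarrow> (('i \<Rightarrow> complex) \<Rightarrow> 'e) \<Rightarrow> bool" where
  "linf_coords I b G g c d \<longleftrightarrow> (\<forall>n.
     (\<forall>i\<in>I. 0 < b n i \<and> linear_on (G n) (c i) \<and> (\<forall>x\<in>G n. b n i * cmod (c i x) \<le> g n x)) \<and>
     (\<forall>v r. 0 \<le> r \<longrightarrow> (\<forall>i\<in>I. b n i * cmod (v i) \<le> r) \<longrightarrow> d v \<in> G n \<and> g n (d v) \<le> r \<and> (\<forall>i\<in>I. c i (d v) = v i)) \<and>
     (\<forall>x\<in>G n. \<forall>y\<in>G n. (\<forall>i\<in>I. c i x = c i y) \<longrightarrow> x = y))"

lemma linf_coordsD:
  assumes "linf_coords I b G g c d"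
  shows "i \<in> I \<Longrightarrow> 0 < b n i" "i \<in> I \<Longrightarrow> linear_on (G n) (c i)"
    "i \<in> I \<Longrightarrow> x \<in> G n \<Longrightarrow> b n i * cmod (c i x) \<le> g n x"
    "0 \<le> r \<Longrightarrow> (\<And>i. i \<in> I \<Longrightarrow> b n i * cmod (v i) \<le> r) \<Longrightarrow> d v \<in> G n \<and> g n (d v) \<le> r \<and> (\<forall>i\<in>I. c i (d v) = v i)"
    "x \<in> G n \<Longrightarrow> y \<in> G n \<Longrightarrow> (\<And>i. i \<in> I \<Longrightarrow> c i x = c i y) \<Longrightarrow> x = y"
  using assms unfolding linf_coords_def by blast+

lemma isomorphic_k_inf_coords:
  fixes E :: "'e::complex_vector topology"
  assumes E: "cvs.subspace (topspace E)" and b: "weight_matrix I b" and iso: "lc_isomorphic E (k_inf I b)"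
  obtains G g c d where "exhaustion E G g" "linf_coords I b G g c d"
proof -
  obtain f where f: "linear_on (topspace E) f" "homeomorphic_map E (k_inf I b) f" using iso unfolding lc_isomorphic_def by blast
  let ?G = "\<lambda>n. {x \<in> topspace E. f x \<in> linf_space I (b n)}" and ?g = "\<lambda>n x. linf_norm I (b n) (f x)"
  \<comment> \<open>Members of \<open>linf_space\<close> vanish off \<open>I\<close>, whereas the
    reconstruction \<open>d\<close> is to accept any function.\<close>
  let ?v = "\<lambda>v i. if i \<in> I then v i else (0::complex)"
  let ?d = "\<lambda>v. inv_into (topspace E) f (?v v)"
  have S: "exhaustion E ?G ?g" by (rule homeomorphic_exhaustion[OF f E exhaustion_k_inf[OF b]])
  have surj: "f ` topspace E = topspace (k_inf I b)" using homeomorphic_imp_surjective_map[OF f(2)] .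
  have inj: "inj_on f (topspace E)" using homeomorphic_imp_injective_map[OF f(2)] .
  have "linf_coords I b ?G ?g (\<lambda>i x. f x i) ?d"
    unfolding linf_coords_def
  proof (intro allI conjI ballI impI)
    fix n i assume i: "i \<in> I"
    show bi: "0 < b n i" by (rule weight_matrixD(1)[OF b i])
    show "linear_on (?G n) (\<lambda>x. f x i)"
      using linear_onD[OF f(1)] by (auto simp: linear_on_def scaleC_fun_def)
    fix x assume "x \<in> ?G n"
    then have "bdd_above ((\<lambda>j. cmod (b n j * f x j)) ` I)" by (simp add: linf_space_def)
    then have "cmod (b n i * f x i) \<le> linf_norm I (b n) (f x)"
      unfolding linf_norm_def using i by (intro cSup_upper) auto
    then show "b n i * cmod (f x i) \<le> linf_norm I (b n) (f x)" using bi by (simp add: norm_mult)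
  next
    fix n v r assume r: "(0::real) \<le> r" and v: "\<forall>i\<in>I. b n i * cmod (v i) \<le> r"
    have le: "cmod (b n i * ?v v i) \<le> r" if "i \<in> I" for i
      using v that weight_matrixD(1)[OF b that, of n] by (simp add: norm_mult)
    have m: "?v v \<in> linf_space I (b n)" unfolding linf_space_def using le by (auto intro!: bdd_aboveI[of _ r])
    have nr: "linf_norm I (b n) (?v v) \<le> r" unfolding linf_norm_def using le r by (intro cSup_least) auto
    have "?v v \<in> f ` topspace E" using m exhaustionD(2)[OF exhaustion_k_inf[OF b]] surj by blast
    then have "f (?d v) = ?v v" "?d v \<in> topspace E" by (rule f_inv_into_f, rule inv_into_into)
    then show "?d v \<in> ?G n" "?g n (?d v) \<le> r" "\<And>i. i \<in> I \<Longrightarrow> f (?d v) i = v i" using m nr by simp_all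
  next
    fix n x y assume x: "x \<in> ?G n" and y: "y \<in> ?G n" and eq: "\<forall>i\<in>I. f x i = f y i"
    have "f x i = f y i" for i using x y eq unfolding linf_space_def by (cases "i \<in> I") auto
    then have "f x = f y" by blast
    then show "x = y" using inj x y by (auto dest: inj_onD)
  qed
  with S show thesis by (rule that)
qed

text \<open>An operator into a weighted l^infinity space is a family of functionals with a common
  weighted bound. Linearity follows because the coordinates separate points.\<close>

lemma linf_operator:
  assumes B: "linf_coords I b G g c d" and G: "cvs.subspace (G n)" and S: "norm_on S p" and C: "0 \<le> C"
    and \<psi>: "\<And>i. i \<in> I \<Longrightarrow> linear_on S (\<psi> i)" "\<And>i x. i \<in> I \<Longrightarrow> x \<in> S \<Longrightarrow> b n i * cmod (\<psi> i x) \<le> C * p x"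
  shows "\<exists>D. bounded_op S p (G n) (g n) D \<and> (\<forall>x\<in>S. \<forall>i\<in>I. c i (D x) = \<psi> i x)"
proof -
  let ?D = "\<lambda>x. d (\<lambda>i. \<psi> i x)"
  have D: "?D x \<in> G n" "g n (?D x) \<le> C * p x" "i \<in> I \<Longrightarrow> c i (?D x) = \<psi> i x" if x: "x \<in> S" for x i
  proof -
    have "0 \<le> C * p x" using C norm_on_nonneg[OF S x] by simp
    from linf_coordsD(4)[OF B this \<psi>(2)[OF _ x]]
    show "?D x \<in> G n" "g n (?D x) \<le> C * p x" "i \<in> I \<Longrightarrow> c i (?D x) = \<psi> i x" by blast+
  qed
  note sS = norm_on_subspace[OF S]
  have "linear_on S ?D"
    unfolding linear_on_def
  proof (intro conjI ballI allI)
    fix x y assume x: "x \<in> S" and y: "y \<in> S"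
    note xy = cvs.subspace_add[OF sS x y]
    show "?D (x + y) = ?D x + ?D y"
    proof (rule linf_coordsD(5)[OF B D(1)[OF xy] cvs.subspace_add[OF G D(1)[OF x] D(1)[OF y]]])
      fix i assume i: "i \<in> I"
      show "c i (?D (x + y)) = c i (?D x + ?D y)"
        using linear_onD(1)[OF linf_coordsD(2)[OF B i] D(1)[OF x] D(1)[OF y]] D(3)[OF xy i] D(3)[OF x i] D(3)[OF y i]
          linear_onD(1)[OF \<psi>(1)[OF i] x y] by simp
    qed
  next
    fix a x assume x: "x \<in> S"
    note ax = cvs.subspace_scale[OF sS x, of a]
    show "?D (a *\<^sub>C x) = a *\<^sub>C ?D x"
    proof (rule linf_coordsD(5)[OF B D(1)[OF ax] cvs.subspace_scale[OF G D(1)[OF x]]])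
      fix i assume i: "i \<in> I"
      show "c i (?D (a *\<^sub>C x)) = c i (a *\<^sub>C ?D x)"
        using linear_onD(2)[OF linf_coordsD(2)[OF B i] D(1)[OF x]] D(3)[OF ax i] D(3)[OF x i]
          linear_onD(2)[OF \<psi>(1)[OF i] x] by simp
    qed
  qed
  then have "bounded_op S p (G n) (g n) ?D" using D(1,2) by (rule bounded_opI)
  then show ?thesis using D(3) by blast
qed

lemma norm_on_subset:
  assumes N: "norm_on S p" and K: "K \<subseteq> S" "cvs.subspace K"
  shows "norm_on K p"
  unfolding norm_on_def
proof (intro conjI ballI allI)
  show "cvs.subspace K" by (rule K(2))
  show "0 \<le> p x" "p x = 0 \<longleftrightarrow> x = 0" if "x \<in> K" for x
    using norm_on_nonneg[OF N] norm_on_eq_0[OF N] K(1) that by blast+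
  show "p (c *\<^sub>C x) = cmod c * p x" if "x \<in> K" for c x
    using norm_on_scale[OF N] K(1) that by blast
  show "p (x + y) \<le> p x + p y" if "x \<in> K" "y \<in> K" for x y
    using norm_on_add[OF N] K(1) that by blast
qed

text \<open>Injectivity of l^infinity: Hahn-Banach in every coordinate, with one constant
  \<open>C\<close> divided by the respective weight.\<close>

lemma linf_extension:
  assumes B: "linf_coords I b G g c d" and G: "norm_on (G n) (g n)" and Y: "norm_on Y y"
    and K: "K \<subseteq> Y" "cvs.subspace K" and D: "bounded_op K y (G n) (g n) D"
  shows "\<exists>D'. bounded_op Y y (G n) (g n) D' \<and> (\<forall>x\<in>K. D' x = D x)"
proof -
  have NK: "norm_on K y" by (rule norm_on_subset[OF Y K])
  obtain C where C: "C > 0" "\<And>x. x \<in> K \<Longrightarrow> g n (D x) \<le> C * y x" using bounded_op_bound[OF NK D] by blast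
  have ex: "\<exists>\<psi>. linear_on Y \<psi> \<and> (\<forall>x\<in>Y. cmod (\<psi> x) \<le> (C / b n i) * y x) \<and> (\<forall>x\<in>K. \<psi> x = c i (D x))" if i: "i \<in> I" for i
  proof -
    have bi: "0 < b n i" by (rule linf_coordsD(1)[OF B i])
    have "0 \<le> C / b n i" using C(1) bi by simp
    note sn = seminorm_on_cmult[OF norm_on_seminorm_on[OF Y] this]
    have lin: "linear_on K (\<lambda>x. c i (D x))"
      by (rule linear_on_compose[OF bounded_op_linear[OF D] linf_coordsD(2)[OF B i] bounded_op_mem[OF D]])
    have le: "cmod (c i (D x)) \<le> (C / b n i) * y x" if "x \<in> K" for x
      using linf_coordsD(3)[OF B i bounded_op_mem[OF D that]] C(2)[OF that] bi by (simp add: field_simps)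
    show ?thesis by (rule functional_extension[OF K sn lin le]) blast+
  qed
  then obtain \<psi> where \<psi>: "\<And>i. i \<in> I \<Longrightarrow> linear_on Y (\<psi> i)" "\<And>i x. i \<in> I \<Longrightarrow> x \<in> Y \<Longrightarrow> cmod (\<psi> i x) \<le> (C / b n i) * y x"
    "\<And>i x. i \<in> I \<Longrightarrow> x \<in> K \<Longrightarrow> \<psi> i x = c i (D x)" by metis
  have "b n i * cmod (\<psi> i x) \<le> C * y x" if "i \<in> I" "x \<in> Y" for i x
    using \<psi>(2)[OF that] linf_coordsD(1)[OF B that(1), of n] by (simp add: field_simps)
  then have "\<exists>D'. bounded_op Y y (G n) (g n) D' \<and> (\<forall>x\<in>Y. \<forall>i\<in>I. c i (D' x) = \<psi> i x)"
    using C(1) \<psi>(1) by (intro linf_operator[OF B norm_on_subspace[OF G] Y, of C]) auto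
  then obtain D' where D': "bounded_op Y y (G n) (g n) D'" "\<forall>x\<in>Y. \<forall>i\<in>I. c i (D' x) = \<psi> i x" by blast
  have "D' x = D x" if x: "x \<in> K" for x
  proof (rule linf_coordsD(5)[OF B _ bounded_op_mem[OF D x]])
    show "D' x \<in> G n" using bounded_op_mem[OF D'(1)] x K(1) by blast
    show "c i (D' x) = c i (D x)" if "i \<in> I" for i using D'(2) x K(1) \<psi>(3)[OF that x] that by auto
  qed
  then show ?thesis using D'(1) by blast
qed

text \<open>Dual to the l^1 case: the i-th coordinate of \<open>D\<close> times the i-th unit vector
  is approximated, and only the i-th coordinate of the approximant is kept. Control of coordinates
  places the rebuilt element in a level of \<open>G\<close> and not in the given \<open>F0\<close>;
  therefore the piece is replaced by a level \<open>G N0\<close> that contains it.\<close>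

lemma approx_property_linf:
  assumes H: "Hausdorff_space E" and A: "condA_piece E F0 q0" and S: "exhaustion Z S p" and DO: "DOmega S p"
    and G: "exhaustion E G g" and B: "linf_coords I b G g c d"
  shows "\<exists>F0 q0. banach_piece E F0 q0 \<and> approx_property E S p F0 q0"
proof -
  have F0: "banach_piece E F0 q0" using A unfolding condA_piece_def by blast
  note fac = exhaustion_factor[OF H G banach_pieceD(1) linear_on_id banach_pieceD(2)]
  obtain N0 where N0: "bounded_op F0 q0 (G N0) (g N0) (\<lambda>x. x)" by (rule fac[OF F0 F0])
  obtain c0 where c0: "c0 > 0" "\<And>x. x \<in> F0 \<Longrightarrow> g N0 x \<le> c0 * q0 x" using bounded_op_bound[OF banach_pieceD(4)[OF F0] N0] by blast
  have "approx_property E S p (G N0) (g N0)"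
    unfolding approx_property_def
  proof
    fix n
    obtain m where m: "m \<ge> n" and int: "\<And>k. k \<ge> m \<Longrightarrow> interp_ineq S p n m k" using DO unfolding DOmega_def by blast
    have "\<exists>F1 q1 D'. banach_piece E F1 q1 \<and> bounded_op (S k) (p k) F1 q1 D' \<and>
         (\<forall>z\<in>S n. D z - D' z \<in> G N0 \<and> g N0 (D z - D' z) \<le> \<epsilon> * p n z)"
      if k: "k \<ge> m" and F: "banach_piece E F q" and DF: "bounded_op (S m) (p m) F q D" and \<epsilon>: "\<epsilon> > 0" for k F q D \<epsilon>
    proof -
      note Nm = exhaustionD(3)[OF S, of m] and Nn = exhaustionD(3)[OF S, of n] and Nk = exhaustionD(3)[OF S, of k]
      have Snm: "S n \<subseteq> S m" and Snk: "S n \<subseteq> S k" using exhaustion_mono[OF S] m k by auto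
      obtain M where M: "bounded_op F q (G M) (g M) (\<lambda>x. x)" by (rule fac[OF F F])
      have D: "bounded_op (S m) (p m) (G M) (g M) D" by (rule bounded_op_compose[OF Nm banach_pieceD(4)[OF F] DF M])
      obtain r where r: "r > 0" "\<And>z. z \<in> S m \<Longrightarrow> g M (D z) \<le> r * p m z" using bounded_op_bound[OF Nm D] by blast
      note GM = exhaustionD(1)[OF G, of M] and sM = exhaustionD(5)[OF G, of M]
      obtain F1 q1 where F1: "banach_piece E F1 q1" and FF1: "\<forall>x\<in>G M. x \<in> F1 \<and> q1 x \<le> g M x"
        and F0F1: "\<forall>x\<in>F0. x \<in> F1 \<and> q1 x \<le> q0 x" and R: "rank_one_approx F0 q0 (G M) (g M) F1 q1 S p n m k"
        using rank_one_approximation[OF A S m k int[OF k] GM] by (elim exE conjE)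
      obtain K where K: "bounded_op F1 q1 (G K) (g K) (\<lambda>x. x)" by (rule fac[OF F1 F1])
      obtain c1 where c1: "c1 > 0" "\<And>x. x \<in> F1 \<Longrightarrow> g K x \<le> c1 * q1 x" using bounded_op_bound[OF banach_pieceD(4)[OF F1] K] by blast
      \<comment> \<open>r undoes the normalization of \<open>D\<close>, and c0 bounds the inclusion
        of \<open>F0\<close> into \<open>G N0\<close>.\<close>
      have "\<epsilon> / (r * c0) > 0" using \<epsilon> r c0 by simp
      then obtain C where C: "C > 0" and app: "\<forall>\<phi> e. linear_on (S m) \<phi> \<longrightarrow>
       (\<forall>z\<in>S m. cmod (\<phi> z) \<le> p m z) \<longrightarrow> e \<in> G M \<longrightarrow> g M e \<le> 1 \<longrightarrow>
       (\<exists>D. linear_on (S k) D \<and> (\<forall>z\<in>S k. D z \<in> F1 \<and> q1 (D z) \<le> C * p k z) \<and>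
         (\<forall>z\<in>S n. \<phi> z *\<^sub>C e - D z \<in> F0 \<and> q0 (\<phi> z *\<^sub>C e - D z) \<le> \<epsilon> / (r * c0) * p n z))"
        using R unfolding rank_one_approx_def by blast
      have ex: "\<exists>\<psi>. linear_on (S k) \<psi> \<and> (\<forall>z\<in>S k. b K i * cmod (\<psi> z) \<le> (r * c1 * C) * p k z) \<and>
          (\<forall>z\<in>S n. b N0 i * cmod (c i (D z) - \<psi> z) \<le> \<epsilon> * p n z)" if i: "i \<in> I" for i
      proof -
        have bM: "b M i > 0" by (rule linf_coordsD(1)[OF B i])
        \<comment> \<open>The unit vector is normalized in \<open>G M\<close> by the factor
          1/b_M(i); dividing the coordinate of \<open>D\<close> by r makes the functional bounded by
          \<open>p m\<close>.\<close>
        let ?\<phi> = "\<lambda>z. complex_of_real (b M i / r) *\<^sub>C c i (D z)" and ?v = "\<lambda>j. if j = i then complex_of_real (1 / b M i) else 0"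
        have lD: "linear_on (S m) (\<lambda>x. c i (D x))" by (rule linear_on_compose[OF bounded_op_linear[OF D] linf_coordsD(2)[OF B i] bounded_op_mem[OF D]])
        have 1: "linear_on (S m) ?\<phi>" by (rule linear_on_scaled[OF lD])
        have 2: "cmod (?\<phi> z) \<le> p m z" if "z \<in> S m" for z
        proof -
          have "b M i * cmod (c i (D z)) \<le> r * p m z" using linf_coordsD(3)[OF B i bounded_op_mem[OF D that]] r(2)[OF that] by linarith
          then show ?thesis using bM r(1) by (simp add: scaleC_complex_def norm_mult norm_divide pos_divide_le_eq mult.commute)
        qed
        have vle: "b M j * cmod (?v j) \<le> 1" if "j \<in> I" for j using bM by (simp add: norm_divide)
        have d: "d ?v \<in> G M" "g M (d ?v) \<le> 1" "\<forall>j\<in>I. c j (d ?v) = ?v j"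
          using linf_coordsD(4)[OF B zero_le_one vle] by blast+
        obtain T where T: "linear_on (S k) T" "\<forall>z\<in>S k. T z \<in> F1 \<and> q1 (T z) \<le> C * p k z"
          "\<forall>z\<in>S n. ?\<phi> z *\<^sub>C d ?v - T z \<in> F0 \<and> q0 (?\<phi> z *\<^sub>C d ?v - T z) \<le> \<epsilon> / (r * c0) * p n z"
          using app[rule_format, OF 1 2 d(1,2)] by blast
        have TK: "T z \<in> G K" if "z \<in> S k" for z using bounded_op_mem[OF K] T(2) that by blast
        let ?\<psi> = "\<lambda>z. complex_of_real r *\<^sub>C c i (T z)"
        have "linear_on (S k) ?\<psi>" by (rule linear_on_scaled[OF linear_on_compose[OF T(1) linf_coordsD(2)[OF B i] TK]])
        moreover have "b K i * cmod (?\<psi> z) \<le> (r * c1 * C) * p k z" if z: "z \<in> S k" for z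
        proof -
          have Tz: "T z \<in> F1" "q1 (T z) \<le> C * p k z" using bspec[OF T(2) z] by blast+
          have "b K i * cmod (c i (T z)) \<le> g K (T z)" by (rule linf_coordsD(3)[OF B i TK[OF z]])
          also have "\<dots> \<le> c1 * q1 (T z)" by (rule c1(2)[OF Tz(1)])
          also have "\<dots> \<le> c1 * (C * p k z)" using Tz(2) c1(1) by (intro mult_left_mono) auto
          finally have "r * (b K i * cmod (c i (T z))) \<le> r * (c1 * (C * p k z))" using r(1) by (intro mult_left_mono) auto
          then show ?thesis using r(1) by (simp add: scaleC_complex_def norm_mult mult_ac)
        qed
        moreover have "b N0 i * cmod (c i (D z) - ?\<psi> z) \<le> \<epsilon> * p n z" if z: "z \<in> S n" for z
        proof -
          let ?x = "?\<phi> z *\<^sub>C d ?v - T z"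
          have x: "?x \<in> F0" "q0 ?x \<le> \<epsilon> / (r * c0) * p n z" using bspec[OF T(3) z] by blast+
          \<comment> \<open>A level containing both vectors, so that linearity of the coordinate can
            be applied to their difference.\<close>
          let ?L = "max M K"
          have zk: "z \<in> S k" using z Snk by blast
          have GL: "G M \<subseteq> G ?L" "G K \<subseteq> G ?L" using exhaustion_mono[OF G] by auto
          have mem: "d ?v \<in> G ?L" "T z \<in> G ?L" using d(1) TK[OF zk] GL by blast+
          have cv: "c i (d ?v) = complex_of_real (1 / b M i)" using d(3) i by simp
          have "c i ?x = ?\<phi> z *\<^sub>C c i (d ?v) - c i (T z)"
            using linear_on_diff[OF linf_coordsD(2)[OF B i] exhaustionD(5)[OF G] cvs.subspace_scale[OF exhaustionD(5)[OF G] mem(1)] mem(2)]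
              linear_onD(2)[OF linf_coordsD(2)[OF B i] mem(1)] by simp
          also have "?\<phi> z *\<^sub>C c i (d ?v) = c i (D z) / complex_of_real r" unfolding cv using bM by (simp add: scaleC_complex_def)
          finally have eq: "c i (D z) - ?\<psi> z = complex_of_real r * c i ?x"
            using r(1) by (simp add: scaleC_complex_def right_diff_distrib)
          have "b N0 i * cmod (c i ?x) \<le> g N0 ?x" by (rule linf_coordsD(3)[OF B i bounded_op_mem[OF N0 x(1)]])
          also have "\<dots> \<le> c0 * q0 ?x" by (rule c0(2)[OF x(1)])
          also have "\<dots> \<le> c0 * (\<epsilon> / (r * c0) * p n z)" using x(2) c0(1) by (intro mult_left_mono) auto
          finally have "r * (b N0 i * cmod (c i ?x)) \<le> r * (c0 * (\<epsilon> / (r * c0) * p n z))" using r(1) by (intro mult_left_mono) auto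
          also have "\<dots> = \<epsilon> * p n z" using r(1) c0(1) by simp
          finally show ?thesis unfolding eq using r(1) by (simp add: norm_mult mult_ac)
        qed
        ultimately show ?thesis by blast
      qed
      then obtain \<psi> where \<psi>: "\<And>i. i \<in> I \<Longrightarrow> linear_on (S k) (\<psi> i)"
        "\<And>i z. i \<in> I \<Longrightarrow> z \<in> S k \<Longrightarrow> b K i * cmod (\<psi> i z) \<le> (r * c1 * C) * p k z"
        "\<And>i z. i \<in> I \<Longrightarrow> z \<in> S n \<Longrightarrow> b N0 i * cmod (c i (D z) - \<psi> i z) \<le> \<epsilon> * p n z" by metis
      have "0 \<le> r * c1 * C" using r(1) c1(1) C by simp
      from linf_operator[OF B exhaustionD(5)[OF G] Nk this \<psi>(1,2)]
      obtain D' where D': "bounded_op (S k) (p k) (G K) (g K) D'" "\<forall>x\<in>S k. \<forall>i\<in>I. c i (D' x) = \<psi> i x" by blast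
      have "D z - D' z \<in> G N0 \<and> g N0 (D z - D' z) \<le> \<epsilon> * p n z" if z: "z \<in> S n" for z
      proof -
        have zm: "z \<in> S m" "z \<in> S k" using z Snm Snk by auto
        have "0 \<le> \<epsilon> * p n z" using \<epsilon> norm_on_nonneg[OF Nn z] by simp
        from linf_coordsD(4)[OF B this \<psi>(3)[OF _ z]]
        have w: "d (\<lambda>i. c i (D z) - \<psi> i z) \<in> G N0" "g N0 (d (\<lambda>i. c i (D z) - \<psi> i z)) \<le> \<epsilon> * p n z"
          "\<forall>i\<in>I. c i (d (\<lambda>i. c i (D z) - \<psi> i z)) = c i (D z) - \<psi> i z" by blast+
        let ?L = "max (max M K) N0"
        have GL: "G M \<subseteq> G ?L" "G K \<subseteq> G ?L" "G N0 \<subseteq> G ?L" by (intro exhaustion_mono[OF G], simp)+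
        have mem: "D z \<in> G ?L" "D' z \<in> G ?L" "d (\<lambda>i. c i (D z) - \<psi> i z) \<in> G ?L"
          using GL bounded_op_mem[OF D zm(1)] bounded_op_mem[OF D'(1) zm(2)] w(1) by blast+
        have "D z - D' z = d (\<lambda>i. c i (D z) - \<psi> i z)"
        proof (rule linf_coordsD(5)[OF B cvs.subspace_diff[OF exhaustionD(5)[OF G] mem(1,2)] mem(3)])
          fix i assume i: "i \<in> I"
          show "c i (D z - D' z) = c i (d (\<lambda>i. c i (D z) - \<psi> i z))"
            using linear_on_diff[OF linf_coordsD(2)[OF B i] exhaustionD(5)[OF G] mem(1,2)] D'(2) zm(2) w(3) i by simp
        qed
        then show ?thesis using w by simp
      qed
      then show ?thesis using D'(1) exhaustionD(1)[OF G, of K] by blast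
    qed
    then show "\<exists>m\<ge>n. \<forall>k\<ge>m. \<forall>F q D \<epsilon>. banach_piece E F q \<longrightarrow> bounded_op (S m) (p m) F q D \<longrightarrow> \<epsilon> > 0 \<longrightarrow>
       (\<exists>F1 q1 D'. banach_piece E F1 q1 \<and> bounded_op (S k) (p k) F1 q1 D' \<and>
         (\<forall>z\<in>S n. D z - D' z \<in> G N0 \<and> g N0 (D z - D' z) \<le> \<epsilon> * p n z))" using m by blast
  qed
  then show ?thesis using exhaustionD(1)[OF G] by blast
qed

section \<open>Gluing local extensions\<close>

lemma banach_piece_join:
  assumes E: "locally_convex E" "locally_complete E" and F: "banach_piece E F q" and G: "banach_piece E G r"
  shows "\<exists>H s. banach_piece E H s \<and> bounded_op F q H s (\<lambda>x. x) \<and> bounded_op G r H s (\<lambda>x. x)"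
proof (rule banach_piece_directed[OF E F G])
  show "bounded_in E {}" unfolding bounded_in_def by (auto intro: exI[of _ 1])
  fix H s assume H: "banach_piece E H s" "\<And>x. x \<in> F \<Longrightarrow> x \<in> H \<and> s x \<le> q x" "\<And>x. x \<in> G \<Longrightarrow> x \<in> H \<and> s x \<le> r x"
  have "bounded_op F q H s (\<lambda>x. x)" using H(2) by (intro bounded_op_id[of _ _ _ 1]) auto
  moreover have "bounded_op G r H s (\<lambda>x. x)" using H(3) by (intro bounded_op_id[of _ _ _ 1]) auto
  ultimately show ?thesis using H(1) by blast
qed

text \<open>For \<open>Y\<close> the inductive limit itself is recorded, because continuity of the
  glued operator is tested on its levels. The exhaustion of \<open>Z\<close> is a parameter so that
  one adapted to the respective case can be inserted.\<close>

locale exact_LB =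
  fixes E :: "'e::complex_vector topology" and X :: "'x::complex_vector topology" and Y :: "'y::complex_vector topology"
    and Z :: "'z::complex_vector topology" and \<iota> Q SX px SY py S p
  assumes E: "lcHs E" "locally_complete E" and X: "exhaustion X SX px"
    and Y: "lcHs Y" "banach_spectrum SY py" "Y = Ind SY py"
    and Z: "lcHs Z" "exhaustion Z S p" and exact: "exact_seq X \<iota> Y Q Z"
begin

lemma lcE: "locally_convex E" and HE: "Hausdorff_space E" and HY: "Hausdorff_space Y" and HZ: "Hausdorff_space Z"
  using E(1) Y(1) Z(1) unfolding lcHs_def by auto

lemma specY: "exhaustion Y SY py"
  using banach_spectrum_exhaustion[OF Y(2)] Y(3) by simp

lemma \<iota>: "linear_on (topspace X) \<iota>" "continuous_map X Y \<iota>" "inj_on \<iota> (topspace X)" "\<iota> ` topspace X = {y \<in> topspace Y. Q y = 0}"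
  using exact unfolding exact_seq_def clinear_maps_def by auto

lemma Q: "linear_on (topspace Y) Q" "continuous_map Y Z Q" "Q ` topspace Y = topspace Z"
  using exact unfolding exact_seq_def clinear_maps_def by auto

definition K :: "'y set" where "K = {y \<in> topspace Y. Q y = 0}"

lemma \<iota>K: "\<iota> ` topspace X = K"
  unfolding K_def by (rule \<iota>(4))

lemma subY: "cvs.subspace (topspace Y)"
  using Y(1) unfolding lcHs_def locally_convex_def by blast

lemma subK: "cvs.subspace K"
  unfolding K_def
  using cvs.subspace_0[OF subY] cvs.subspace_add[OF subY] cvs.subspace_scale[OF subY] linear_on_0[OF Q(1) subY]
  by (intro cvs.subspaceI) (auto simp: linear_onD[OF Q(1)])

lemma subKn: "cvs.subspace (K \<inter> SY n)"
  by (rule cvs.subspace_inter[OF subK exhaustionD(5)[OF specY]])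

lemma normKn: "norm_on (K \<inter> SY n) (py n)"
  by (rule norm_on_subset[OF exhaustionD(3)[OF specY] _ subKn]) simp

lemma Q_level:
  obtains l where "l \<ge> l0" "bounded_op (SY n) (py n) (S l) (p l) Q"
proof (rule exhaustion_factor[OF HZ Z(2) exhaustionD(4)[OF specY]])
  show "linear_on (SY n) Q" by (rule linear_on_subset[OF Q(1) exhaustionD(6)[OF specY]])
  show "continuous_map (norm_topology (SY n) (py n)) Z Q"
    using continuous_map_compose[OF banach_pieceD(2)[OF exhaustionD(1)[OF specY]] Q(2)] by (simp add: o_def)
qed (rule that)

text \<open>Surjectivity of \<open>Q\<close> and the factorization theorem together produce lifts
  that are bounded, though not linear.\<close>

lemma lift_level:
  obtains m C where "m \<ge> m0" "C > 0" "\<And>z. z \<in> S l \<Longrightarrow> \<exists>y\<in>SY m. Q y = z \<and> py m y \<le> C * p l z"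
proof (rule exhaustion_lift_ge[OF HZ HY specY exhaustionD(4)[OF Z(2)] linear_on_id banach_pieceD(2)[OF exhaustionD(1)[OF Z(2)]] Q(1,2)])
  show "\<exists>y\<in>topspace Y. Q y = x" if "x \<in> S l" for x
  proof -
    have "x \<in> Q ` topspace Y" unfolding Q(3) using exhaustionD(6)[OF Z(2), of l] that by blast
    then show ?thesis by blast
  qed
qed (rule that)

text \<open>\<open>K\<close> meets each level in a closed subspace, because \<open>Q\<close> is
  bounded from \<open>SY n\<close> into a normed level of \<open>Z\<close>. Completeness is what the
  factorization theorem will need on \<open>K \<inter> SY n\<close>.\<close>

lemma banach_Kn: "banach_on (K \<inter> SY n) (py n)"
  unfolding banach_on_def
proof (intro conjI normKn allI impI)
  fix u :: "nat \<Rightarrow> 'y"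
  assume u: "range u \<subseteq> K \<inter> SY n \<and> (\<forall>e>0. \<exists>M. \<forall>i\<ge>M. \<forall>j\<ge>M. py n (u i - u j) < e)"
  have uK: "u i \<in> K" "u i \<in> SY n" for i using u by auto
  then obtain x where x: "x \<in> SY n" "(\<lambda>i. py n (u i - x)) \<longlonglongrightarrow> 0"
    using u exhaustionD(4)[OF specY, of n] unfolding banach_on_def by blast
  obtain l where l: "bounded_op (SY n) (py n) (S l) (p l) Q" by (rule Q_level)
  note NS = exhaustionD(3)[OF Z(2), of l] and NY = exhaustionD(3)[OF specY, of n]
  have "(\<lambda>i. py n (x - u i)) \<longlonglongrightarrow> 0" using x(2) norm_on_diff_commute[OF NY x(1) uK(2)] by simp
  then have "(\<lambda>i. p l (Q x - Q (u i))) \<longlonglongrightarrow> 0" using uK(2) by (intro bounded_op_tendsto[OF NY NS l x(1)]) auto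
  then have "p l (Q x) = 0" using uK(1) by (simp add: K_def LIMSEQ_const_iff)
  then have "Q x = 0" using norm_on_eq_0[OF NS bounded_op_mem[OF l x(1)]] by blast
  then have "x \<in> K \<inter> SY n" unfolding K_def using x(1) exhaustionD(6)[OF specY] by blast
  then show "\<exists>x\<in>K \<inter> SY n. (\<lambda>i. py n (u i - x)) \<longlonglongrightarrow> 0" using x(2) by blast
qed

text \<open>The inverse of \<open>\<iota>\<close> need not be continuous on \<open>K\<close> for the
  topology of \<open>Y\<close>. By the factorization theorem it is bounded from each
  \<open>K \<inter> SY n\<close> into one level of \<open>X\<close>, and the image of that level
  under \<open>R\<close> is absorbed by a Banach piece.\<close>

lemma transported_map:
  assumes R: "R \<in> clinear_maps X E"
  obtains R0 where "linear_on K R0" "\<And>x. x \<in> topspace X \<Longrightarrow> R0 (\<iota> x) = R x"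
    "\<And>n. \<exists>F q. banach_piece E F q \<and> bounded_op (K \<inter> SY n) (py n) F q R0"
proof -
  have Rl: "linear_on (topspace X) R" "continuous_map X E R" using R unfolding clinear_maps_def by auto
  define R0 where "R0 y = R (inv_into (topspace X) \<iota> y)" for y
  have R0\<iota>: "R0 (\<iota> x) = R x" if "x \<in> topspace X" for x unfolding R0_def using inv_into_f_f[OF \<iota>(3) that] by simp
  have pre: "\<exists>x\<in>topspace X. \<iota> x = y" if "y \<in> K" for y using that unfolding \<iota>K[symmetric] by blast
  have subX: "x + x' \<in> topspace X" "a *\<^sub>C x \<in> topspace X" if xx: "x \<in> topspace X" "x' \<in> topspace X" for x x' a
  proof -
    obtain i j where ij: "x \<in> SX i" "x' \<in> SX j" using xx unfolding exhaustionD(2)[OF X] by blast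
    have m: "x \<in> SX (max i j)" "x' \<in> SX (max i j)" using ij exhaustion_mono[OF X, of i "max i j"] exhaustion_mono[OF X, of j "max i j"] by auto
    show "x + x' \<in> topspace X" using cvs.subspace_add[OF exhaustionD(5)[OF X] m] exhaustionD(6)[OF X] by blast
    show "a *\<^sub>C x \<in> topspace X" using cvs.subspace_scale[OF exhaustionD(5)[OF X] m(1)] exhaustionD(6)[OF X] by blast
  qed
  have lin: "linear_on K R0"
    unfolding linear_on_def
  proof (intro conjI ballI allI)
    fix y y' assume "y \<in> K" "y' \<in> K"
    then obtain x x' where x: "x \<in> topspace X" "\<iota> x = y" "x' \<in> topspace X" "\<iota> x' = y'" using pre by metis
    have "\<iota> (x + x') = y + y'" using linear_onD(1)[OF \<iota>(1) x(1,3)] x by simp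
    then show "R0 (y + y') = R0 y + R0 y'"
      using R0\<iota>[OF subX(1)[OF x(1,3)]] R0\<iota>[OF x(1)] R0\<iota>[OF x(3)] x linear_onD(1)[OF Rl(1) x(1,3)] by simp
  next
    fix a y assume "y \<in> K"
    then obtain x where x: "x \<in> topspace X" "\<iota> x = y" using pre by metis
    have "\<iota> (a *\<^sub>C x) = a *\<^sub>C y" using linear_onD(2)[OF \<iota>(1) x(1)] x by simp
    then show "R0 (a *\<^sub>C y) = a *\<^sub>C R0 y"
      using R0\<iota>[OF subX(2)[OF x(1) x(1)], of a] R0\<iota>[OF x(1)] x linear_onD(2)[OF Rl(1) x(1)] by simp
  qed
  have "\<exists>F q. banach_piece E F q \<and> bounded_op (K \<inter> SY n) (py n) F q R0" for n
  proof -
    have c: "continuous_map (norm_topology (K \<inter> SY n) (py n)) Y (\<lambda>x. x)"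
    proof -
      have "bounded_op (K \<inter> SY n) (py n) (SY n) (py n) (\<lambda>x. x)" by (rule bounded_op_id[of _ _ _ 1]) auto
      from continuous_map_compose[OF bounded_op_continuous[OF normKn exhaustionD(3)[OF specY] this] banach_pieceD(2)[OF exhaustionD(1)[OF specY]]]
      show ?thesis by (simp add: o_def)
    qed
    have cover: "\<exists>x\<in>topspace X. \<iota> x = y" if "y \<in> K \<inter> SY n" for y using pre that by blast
    obtain m C where C: "C > 0" "\<And>y. y \<in> K \<inter> SY n \<Longrightarrow> \<exists>x\<in>SX m. \<iota> x = y \<and> px m x \<le> C * py n y"
      by (rule exhaustion_lift[OF HY X banach_Kn linear_on_id c \<iota>(1,2) cover]) blast+
    have "continuous_map (norm_topology (SX m) (px m)) E R"
      using continuous_map_compose[OF banach_pieceD(2)[OF exhaustionD(1)[OF X]] Rl(2)] by (simp add: o_def)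
    then obtain F q where F: "banach_piece E F q" "bounded_op (SX m) (px m) F q R"
      using continuous_bounded_op_into_banach_piece[OF lcE E(2) exhaustionD(3)[OF X] linear_on_subset[OF Rl(1) exhaustionD(6)[OF X]]] by blast
    obtain C' where C': "C' > 0" "\<And>x. x \<in> SX m \<Longrightarrow> q (R x) \<le> C' * px m x" using bounded_op_bound[OF exhaustionD(3)[OF X] F(2)] by blast
    have "R0 y \<in> F \<and> q (R0 y) \<le> (C' * C) * py n y" if y: "y \<in> K \<inter> SY n" for y
    proof -
      obtain x where x: "x \<in> SX m" "\<iota> x = y" "px m x \<le> C * py n y" using C(2)[OF y] by blast
      have xX: "x \<in> topspace X" using x(1) exhaustionD(6)[OF X] by blast
      have eq: "R0 y = R x" using R0\<iota>[OF xX] x(2) by simp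
      have "q (R x) \<le> C' * px m x" by (rule C'(2)[OF x(1)])
      also have "\<dots> \<le> C' * (C * py n y)" using x(3) C'(1) by (intro mult_left_mono) auto
      finally show ?thesis unfolding eq using bounded_op_mem[OF F(2) x(1)] by (simp add: mult.assoc)
    qed
    then have "bounded_op (K \<inter> SY n) (py n) F q R0"
      using linear_on_subset[OF lin, of "K \<inter> SY n"] by (intro bounded_opI[of _ _ _ _ "C' * C"]) auto
    then show ?thesis using F(1) by blast
  qed
  with lin R0\<iota> show thesis by (rule that)
qed

text \<open>The approximation property carried over to operators on the levels of \<open>Y\<close>
  that vanish on \<open>K\<close>: differences of two local extensions are of this kind.\<close>

definition approx_Y :: "'e set \<Rightarrow> ('e \<Rightarrow> real) \<Rightarrow> nat \<Rightarrow> nat \<Rightarrow> bool" where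
  "approx_Y F0 q0 n m \<longleftrightarrow> n \<le> m \<and> (\<forall>k\<ge>m. \<forall>F q D \<epsilon>. banach_piece E F q \<longrightarrow> bounded_op (SY m) (py m) F q D \<longrightarrow>
     (\<forall>x\<in>K \<inter> SY m. D x = 0) \<longrightarrow> \<epsilon> > 0 \<longrightarrow>
     (\<exists>F1 q1 D'. banach_piece E F1 q1 \<and> bounded_op (SY k) (py k) F1 q1 D' \<and> (\<forall>x\<in>K \<inter> SY k. D' x = 0) \<and>
       (\<forall>y\<in>SY n. D y - D' y \<in> F0 \<and> q0 (D y - D' y) \<le> \<epsilon> * py n y)))"

lemma approx_YD:
  assumes "approx_Y F0 q0 n m" "m \<le> k" "banach_piece E F q" "bounded_op (SY m) (py m) F q D" "\<forall>x\<in>K \<inter> SY m. D x = 0" "\<epsilon> > 0"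
  shows "\<exists>F1 q1 D'. banach_piece E F1 q1 \<and> bounded_op (SY k) (py k) F1 q1 D' \<and> (\<forall>x\<in>K \<inter> SY k. D' x = 0) \<and>
       (\<forall>y\<in>SY n. D y - D' y \<in> F0 \<and> q0 (D y - D' y) \<le> \<epsilon> * py n y)"
  using assms unfolding approx_Y_def by blast

text \<open>Operators on \<open>SY m\<close> that vanish on the kernel of \<open>Q\<close> descend to \<open>Z\<close> by means of bounded lifts.\<close>

lemma approx_property_Y:
  assumes AP: "approx_property E S p F0 q0"
  shows "\<exists>m. approx_Y F0 q0 n m"
proof -
  \<comment> \<open>Order of the levels: \<open>l\<close> receives the image of \<open>SY n\<close>,
    \<open>m1\<close> belongs to \<open>l\<close> by the approximation property, and
    \<open>SY m\<close> contains bounded lifts of \<open>S m1\<close>.\<close>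
  obtain l where l: "bounded_op (SY n) (py n) (S l) (p l) Q" by (rule Q_level)
  obtain m1 where m1: "m1 \<ge> l" and ap: "\<forall>k\<ge>m1. \<forall>F q D \<epsilon>. banach_piece E F q \<longrightarrow> bounded_op (S m1) (p m1) F q D \<longrightarrow> \<epsilon> > 0 \<longrightarrow>
     (\<exists>F1 q1 D'. banach_piece E F1 q1 \<and> bounded_op (S k) (p k) F1 q1 D' \<and>
       (\<forall>z\<in>S l. D z - D' z \<in> F0 \<and> q0 (D z - D' z) \<le> \<epsilon> * p l z))"
    using AP unfolding approx_property_def by blast
  obtain m C where m: "m \<ge> n" and C: "C > 0" and lift: "\<And>z. z \<in> S m1 \<Longrightarrow> \<exists>y\<in>SY m. Q y = z \<and> py m y \<le> C * p m1 z"
    by (rule lift_level[of n m1]) blast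
  obtain h where h: "\<And>z. z \<in> S m1 \<Longrightarrow> h z \<in> SY m" "\<And>z. z \<in> S m1 \<Longrightarrow> Q (h z) = z" "\<And>z. z \<in> S m1 \<Longrightarrow> py m (h z) \<le> C * p m1 z"
    using lift by metis
  obtain c where c: "c > 0" "\<And>y. y \<in> SY n \<Longrightarrow> p l (Q y) \<le> c * py n y" using bounded_op_bound[OF exhaustionD(3)[OF specY] l] by blast
  note sYm = exhaustionD(5)[OF specY, of m] and sm1 = exhaustionD(5)[OF Z(2), of m1]
  have QYm: "linear_on (SY m) Q" by (rule linear_on_subset[OF Q(1) exhaustionD(6)[OF specY]])
  have "approx_Y F0 q0 n m"
    unfolding approx_Y_def
  proof (intro conjI m allI impI)
    fix k F q D and \<epsilon> :: real
    assume k: "m \<le> k" and F: "banach_piece E F q" and D: "bounded_op (SY m) (py m) F q D" and D0: "\<forall>x\<in>K \<inter> SY m. D x = 0" and \<epsilon>: "\<epsilon> > 0"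
    \<comment> \<open>\<open>D\<close> depends on Q y alone, which makes its composition with the
      nonlinear lift \<open>h\<close> linear.\<close>
    have same: "D y = D y'" if "y \<in> SY m" "y' \<in> SY m" "Q y = Q y'" for y y'
    proof -
      have d: "y - y' \<in> SY m" by (rule cvs.subspace_diff[OF sYm that(1,2)])
      have "Q (y - y') = 0" using linear_on_diff[OF QYm sYm that(1,2)] that(3) by simp
      then have "D (y - y') = 0" using D0 d exhaustionD(6)[OF specY] unfolding K_def by blast
      then show ?thesis using linear_on_diff[OF bounded_op_linear[OF D] sYm that(1,2)] by simp
    qed
    let ?D = "\<lambda>z. D (h z)"
    obtain b where b: "b > 0" "\<And>y. y \<in> SY m \<Longrightarrow> q (D y) \<le> b * py m y" using bounded_op_bound[OF exhaustionD(3)[OF specY] D] by blast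
    have "bounded_op (S m1) (p m1) F q ?D"
    proof (rule bounded_opI)
      show "linear_on (S m1) ?D"
        unfolding linear_on_def
      proof (intro conjI ballI allI)
        fix x y assume xy: "x \<in> S m1" "y \<in> S m1"
        have "D (h (x + y)) = D (h x + h y)"
          using h(1,2) xy cvs.subspace_add[OF sm1 xy] by (intro same cvs.subspace_add[OF sYm]) (auto simp: linear_onD(1)[OF QYm])
        then show "D (h (x + y)) = D (h x) + D (h y)" using linear_onD(1)[OF bounded_op_linear[OF D] h(1)[OF xy(1)] h(1)[OF xy(2)]] by simp
      next
        fix a x assume x: "x \<in> S m1"
        have "D (h (a *\<^sub>C x)) = D (a *\<^sub>C h x)"
          using h(1,2) x cvs.subspace_scale[OF sm1 x] by (intro same cvs.subspace_scale[OF sYm]) (auto simp: linear_onD(2)[OF QYm])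
        then show "D (h (a *\<^sub>C x)) = a *\<^sub>C D (h x)" using linear_onD(2)[OF bounded_op_linear[OF D] h(1)[OF x]] by simp
      qed
      fix x assume x: "x \<in> S m1"
      show "D (h x) \<in> F" by (rule bounded_op_mem[OF D h(1)[OF x]])
      have "q (D (h x)) \<le> b * py m (h x)" by (rule b(2)[OF h(1)[OF x]])
      also have "\<dots> \<le> b * (C * p m1 x)" using h(3)[OF x] b(1) by (intro mult_left_mono) auto
      finally show "q (D (h x)) \<le> (b * C) * p m1 x" by (simp add: mult.assoc)
    qed
    moreover obtain k1 where k1: "k1 \<ge> m1" "bounded_op (SY k) (py k) (S k1) (p k1) Q" by (rule Q_level)
    moreover have "\<epsilon> / c > 0" using \<epsilon> c(1) by simp
    ultimately obtain F1 q1 D' where F1: "banach_piece E F1 q1" and D': "bounded_op (S k1) (p k1) F1 q1 D'"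
      and app: "\<forall>z\<in>S l. ?D z - D' z \<in> F0 \<and> q0 (?D z - D' z) \<le> \<epsilon> / c * p l z"
      using ap F by blast
    have "bounded_op (SY k) (py k) F1 q1 (\<lambda>y. D' (Q y))" by (rule bounded_op_compose[OF exhaustionD(3)[OF specY] exhaustionD(3)[OF Z(2)] k1(2) D'])
    moreover have "\<forall>x\<in>K \<inter> SY k. D' (Q x) = 0" using linear_on_0[OF bounded_op_linear[OF D'] exhaustionD(5)[OF Z(2)]] unfolding K_def by simp
    moreover have "D y - D' (Q y) \<in> F0 \<and> q0 (D y - D' (Q y)) \<le> \<epsilon> * py n y" if y: "y \<in> SY n" for y
    proof -
      have Qy: "Q y \<in> S l" by (rule bounded_op_mem[OF l y])
      then have Qm: "Q y \<in> S m1" using exhaustion_mono[OF Z(2) m1] by blast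
      have "D (h (Q y)) = D y" using h(1,2)[OF Qm] y exhaustion_mono[OF specY m] by (intro same) auto
      moreover have "\<epsilon> / c * p l (Q y) \<le> \<epsilon> / c * (c * py n y)" using c \<epsilon> y by (intro mult_left_mono) auto
      moreover have "\<epsilon> / c * (c * py n y) = \<epsilon> * py n y" using c(1) by simp
      ultimately show ?thesis using bspec[OF app Qy] by simp
    qed
    ultimately show "\<exists>F1 q1 D'. banach_piece E F1 q1 \<and> bounded_op (SY k) (py k) F1 q1 D' \<and> (\<forall>x\<in>K \<inter> SY k. D' x = 0) \<and>
       (\<forall>y\<in>SY n. D y - D' y \<in> F0 \<and> q0 (D y - D' y) \<le> \<epsilon> * py n y)"
      using F1 by (intro exI[of _ F1] exI[of _ q1] exI[of _ "\<lambda>y. D' (Q y)"]) simp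
  qed
  then show ?thesis by blast
qed

text \<open>The extensions on different levels need not agree and may take values in different
  pieces.\<close>

definition locally_extendable :: "('y \<Rightarrow> 'e) \<Rightarrow> bool" where
  "locally_extendable R0 \<longleftrightarrow> (\<forall>n. \<exists>F q T. banach_piece E F q \<and> bounded_op (SY n) (py n) F q T \<and> (\<forall>x\<in>K \<inter> SY n. T x = R0 x))"

text \<open>The difference between the next local extension and the current operator vanishes on
  \<open>K\<close>. Up to a small error on the current level it is therefore the restriction of an
  operator on the next level that also vanishes on \<open>K\<close>; subtracting the latter from the
  next extension makes consecutive operators close.\<close>

lemma mittag_leffler:
  assumes F0: "banach_piece E F0 q0" and AP: "approx_property E S p F0 q0" and ext: "locally_extendable R0"
  shows "\<exists>U\<in>clinear_maps Y E. \<forall>x\<in>K. U x = R0 x"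
proof -
  have "\<forall>n. \<exists>m. approx_Y F0 q0 n m" using approx_property_Y[OF AP] by blast
  then obtain \<mu> where \<mu>: "\<And>n. approx_Y F0 q0 n (\<mu> n)" by metis
  have \<mu>ge: "n \<le> \<mu> n" for n using \<mu>[of n] unfolding approx_Y_def by blast
  \<comment> \<open>Each index lies beyond the level that \<open>\<mu>\<close> demands for the
    previous one; the successor makes the sequence strictly increasing, hence cofinal.\<close>
  define \<sigma> where "\<sigma> i = ((\<lambda>n. Suc (\<mu> n)) ^^ i) 0" for i
  have \<sigma>Suc: "\<sigma> (Suc i) = Suc (\<mu> (\<sigma> i))" for i by (simp add: \<sigma>_def)
  have \<sigma>less: "\<sigma> i < \<sigma> (Suc i)" for i using \<mu>ge[of "\<sigma> i"] by (simp add: \<sigma>Suc)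
  have \<sigma>mono: "\<sigma> i \<le> \<sigma> j" if "i \<le> j" for i j using lift_Suc_mono_le[of \<sigma>] \<sigma>less that by (simp add: less_imp_le)
  have \<sigma>ge: "i \<le> \<sigma> i" for i
  proof (induction i)
    case (Suc i)
    then show ?case using \<sigma>less[of i] by simp
  qed simp
  let ?S = "\<lambda>i. SY (\<sigma> i)" and ?p = "\<lambda>i. py (\<sigma> i)"
  note NY = exhaustionD(3)[OF specY] and sY = exhaustionD(5)[OF specY]
  have Smono: "?S i \<subseteq> ?S j" if "i \<le> j" for i j by (rule exhaustion_mono[OF specY \<sigma>mono[OF that]])
  have "\<exists>c>0. i \<le> j \<longrightarrow> (\<forall>y\<in>?S i. ?p j y \<le> c * ?p i y)" for i j
  proof (cases "i \<le> j")
    case True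
    show ?thesis by (rule bounded_op_bound[OF NY exhaustion_embedding[OF HY specY \<sigma>mono[OF True]]]) blast
  qed (auto intro: exI[of _ 1])
  then obtain c where c: "\<And>i j. c i j > (0::real)" "\<And>i j. i \<le> j \<Longrightarrow> \<forall>y\<in>?S i. ?p j y \<le> c i j * ?p i y" by metis
  \<comment> \<open>Small enough that the j-th correction is at most 2^-j on all earlier levels at
    once, after their norms have been compared by \<open>c i j\<close>.\<close>
  define e where "e j = (1 / 2) ^ j / (1 + (\<Sum>i\<le>j. c i j))" for j
  have den: "0 < 1 + (\<Sum>i\<le>j. c i j)" for j using sum_nonneg[of "{..j}" "\<lambda>i. c i j"] less_imp_le[OF c(1)] by (simp add: add_pos_nonneg)
  have e0: "e j > 0" for j unfolding e_def using den[of j] by simp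
  have ele: "e j * ?p j y \<le> (1 / 2) ^ j * ?p i y" if ij: "i \<le> j" and y: "y \<in> ?S i" for i j y
  proof -
    have "c i j \<le> (\<Sum>i\<le>j. c i j)" using ij less_imp_le[OF c(1)] by (intro member_le_sum) auto
    then have "?p j y \<le> (1 + (\<Sum>i\<le>j. c i j)) * ?p i y"
      using c(2)[OF ij] y mult_right_mono[OF _ norm_on_nonneg[OF NY y], of "c i j" "1 + (\<Sum>i\<le>j. c i j)"] by fastforce
    then have "e j * ?p j y \<le> e j * ((1 + (\<Sum>i\<le>j. c i j)) * ?p i y)" using e0[of j] by (intro mult_left_mono) auto
    also have "\<dots> = (1 / 2) ^ j * ?p i y" unfolding e_def using den[of j] by simp
    finally show ?thesis .
  qed
  \<comment> \<open>\<open>good i\<close> concerns the level with index i + 1 of the subsequence,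
    while \<open>near i\<close> measures on that with index i; the level given by
    \<open>\<mu>\<close> fits in between.\<close>
  define good where "good i T \<longleftrightarrow> (\<exists>F q. banach_piece E F q \<and> bounded_op (?S (Suc i)) (?p (Suc i)) F q T) \<and> (\<forall>x\<in>K \<inter> ?S (Suc i). T x = R0 x)" for i T
  define near where "near i T T' \<longleftrightarrow> (\<forall>y\<in>?S i. T' y - T y \<in> F0 \<and> q0 (T' y - T y) \<le> e i * ?p i y)" for i T and T' :: "'y \<Rightarrow> 'e"
  have base: "\<exists>T. good 0 T" using ext unfolding locally_extendable_def good_def by blast
  have step: "\<exists>T'. good (Suc i) T' \<and> near i T T'" if T: "good i T" for T i
  proof -
    obtain F q where F: "banach_piece E F q" and TF: "bounded_op (?S (Suc i)) (?p (Suc i)) F q T" and TK: "\<forall>x\<in>K \<inter> ?S (Suc i). T x = R0 x"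
      using T unfolding good_def by blast
    obtain G r R' where G: "banach_piece E G r" and RG: "bounded_op (?S (Suc (Suc i))) (?p (Suc (Suc i))) G r R'" and RK: "\<forall>x\<in>K \<inter> ?S (Suc (Suc i)). R' x = R0 x"
      using ext unfolding locally_extendable_def by blast
    obtain H s where H: "banach_piece E H s" and FH: "bounded_op F q H s (\<lambda>x. x)" and GH: "bounded_op G r H s (\<lambda>x. x)"
      using banach_piece_join[OF lcE E(2) F G] by blast
    note NH = banach_pieceD(4)[OF H]
    let ?m = "\<mu> (\<sigma> i)" and ?k = "\<sigma> (Suc (Suc i))"
    have mk: "?m \<le> \<sigma> (Suc i)" "?m \<le> ?k" using \<sigma>Suc[of i] \<sigma>less[of "Suc i"] by auto
    have Sm: "SY ?m \<subseteq> ?S (Suc i)" "SY ?m \<subseteq> ?S (Suc (Suc i))" by (rule exhaustion_mono[OF specY mk(1)], rule exhaustion_mono[OF specY mk(2)])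
    have T': "bounded_op (SY ?m) (py ?m) H s T"
      using bounded_op_compose[OF NY NY exhaustion_embedding[OF HY specY mk(1)] bounded_op_compose[OF NY banach_pieceD(4)[OF F] TF FH]] .
    have RH: "bounded_op (?S (Suc (Suc i))) (?p (Suc (Suc i))) H s R'" by (rule bounded_op_compose[OF NY banach_pieceD(4)[OF G] RG GH])
    have R'': "bounded_op (SY ?m) (py ?m) H s R'" using bounded_op_compose[OF NY NY exhaustion_embedding[OF HY specY mk(2)] RH] .
    have RT: "bounded_op (SY ?m) (py ?m) H s (\<lambda>y. R' y - T y)" by (rule bounded_op_diff[OF NH R'' T'])
    have RT0: "\<forall>x\<in>K \<inter> SY ?m. R' x - T x = 0" using TK RK Sm by (metis IntD1 IntD2 IntI diff_self subsetD)
    obtain F1 q1 D' where F1: "banach_piece E F1 q1" and D': "bounded_op (SY ?k) (py ?k) F1 q1 D'" and D0: "\<forall>x\<in>K \<inter> SY ?k. D' x = 0"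
      and app: "\<forall>y\<in>SY (\<sigma> i). (R' y - T y) - D' y \<in> F0 \<and> q0 ((R' y - T y) - D' y) \<le> e i * py (\<sigma> i) y"
      using approx_YD[OF \<mu> mk(2) H RT RT0 e0[of i]] by (elim exE conjE)
    obtain H' s' where H': "banach_piece E H' s'" and HH: "bounded_op H s H' s' (\<lambda>x. x)" and FH': "bounded_op F1 q1 H' s' (\<lambda>x. x)"
      using banach_piece_join[OF lcE E(2) H F1] by blast
    have "bounded_op (SY ?k) (py ?k) H' s' (\<lambda>y. R' y - D' y)"
      by (rule bounded_op_diff[OF banach_pieceD(4)[OF H'] bounded_op_compose[OF NY NH RH HH] bounded_op_compose[OF NY banach_pieceD(4)[OF F1] D' FH']])
    then have "good (Suc i) (\<lambda>y. R' y - D' y)" unfolding good_def using H' RK D0 by auto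
    moreover have "near i T (\<lambda>y. R' y - D' y)" unfolding near_def using app by (simp add: algebra_simps)
    ultimately show ?thesis by blast
  qed
  obtain T where T: "\<And>i. good i (T i)" "\<And>i. near i (T i) (T (Suc i))"
    using dependent_nat_choice[of good near] base step by blast
  define d where "d j y = T (Suc j) y - T j y" for j y
  have Tlin: "linear_on (?S i) (T j)" if "i \<le> Suc j" for i j
  proof -
    obtain F q where "bounded_op (?S (Suc j)) (?p (Suc j)) F q (T j)" using T(1)[of j] unfolding good_def by blast
    then show ?thesis using linear_on_subset[OF bounded_op_linear Smono[OF that]] by blast
  qed
  have dF: "d j y \<in> F0" "q0 (d j y) \<le> (1 / 2) ^ j * ?p i y" if "i \<le> j" "y \<in> ?S i" for i j y
  proof -
    have "y \<in> ?S j" using that Smono by blast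
    then have "d j y \<in> F0" "q0 (d j y) \<le> e j * ?p j y" using T(2)[of j] unfolding near_def d_def by blast+
    then show "d j y \<in> F0" "q0 (d j y) \<le> (1 / 2) ^ j * ?p i y" using ele[OF that] by linarith+
  qed
  have hs: "((\<lambda>j. 1 * (1 / 2 :: real) ^ j) has_sum (1 / (1 - 1 / 2))) (UNIV :: nat set)"
    by (rule has_sum_geometric_real) auto
  \<comment> \<open>\<open>G i\<close> is the sum of the corrections from index i on. It converges
    in \<open>F0\<close>, although the operators \<open>T i\<close> take values in varying
    pieces.\<close>
  have "\<exists>G. linear_on (?S i) G \<and> (\<forall>y\<in>?S i. G y \<in> F0 \<and> q0 (G y) \<le> (1 / (1 - 1 / 2)) * ?p i y \<and>
      (\<lambda>n. q0 (G y - (\<Sum>j<n. d (i + j) y))) \<longlonglongrightarrow> 0)" for i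
  proof (rule banach_on_operator_series[OF banach_pieceD(1)[OF F0] NY _ _ _ hs])
    show "linear_on (?S i) (d (i + j))" for j unfolding d_def by (intro linear_on_sub Tlin) auto
    show "d (i + j) y \<in> F0" if "y \<in> ?S i" for j y using dF(1)[OF _ that, of "i + j"] by simp
    show "q0 (d (i + j) y) \<le> 1 * (1 / 2) ^ j * ?p i y" if y: "y \<in> ?S i" for j y
    proof -
      have "(1 / 2 :: real) ^ (i + j) \<le> (1 / 2) ^ j" by (intro power_decreasing) auto
      then have "(1 / 2) ^ (i + j) * ?p i y \<le> (1 / 2) ^ j * ?p i y" using norm_on_nonneg[OF NY y] by (rule mult_right_mono)
      then show ?thesis using dF(2)[OF _ y, of "i + j"] by simp
    qed
  qed
  then obtain G where G: "\<And>i. linear_on (?S i) (G i)" "\<And>i. \<forall>y\<in>?S i. G i y \<in> F0 \<and> q0 (G i y) \<le> (1 / (1 - 1 / 2)) * ?p i y \<and>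
      (\<lambda>n. q0 (G i y - (\<Sum>j<n. d (i + j) y))) \<longlonglongrightarrow> 0" by metis
  have GF: "G i y \<in> F0" "q0 (G i y) \<le> (1 / (1 - 1 / 2)) * ?p i y" "(\<lambda>n. q0 (G i y - (\<Sum>j<n. d (i + j) y))) \<longlonglongrightarrow> 0" if "y \<in> ?S i" for i y
    using bspec[OF G(2)[of i] that] by blast+
  note NF0 = banach_pieceD(4)[OF F0] and sF0 = banach_pieceD(5)[OF F0]
  \<comment> \<open>The limit of the \<open>T j\<close>, written from index i on, where all
    operators involved are linear on the i-th level.\<close>
  define A where "A i y = T i y + G i y" for i y
  have AS: "A (Suc i) y = A i y" if y: "y \<in> ?S i" for i y
  proof -
    have y': "y \<in> ?S (Suc i)" using y Smono[of i "Suc i"] by auto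
    have di: "d i y \<in> F0" by (rule dF(1)[OF order_refl y])
    have sF: "(\<Sum>j<n. d (i + j) y) \<in> F0" for n using dF(1)[OF _ y] by (intro cvs.subspace_sum[OF sF0]) auto
    have "(\<lambda>n. q0 (G i y - (\<Sum>j<Suc n. d (i + j) y))) \<longlonglongrightarrow> 0" by (rule LIMSEQ_Suc[OF GF(3)[OF y]])
    moreover have sh: "(\<Sum>j<Suc n. d (i + j) y) = d i y + (\<Sum>j<n. d (Suc i + j) y)" for n
      by (subst sum.lessThan_Suc_shift) simp
    ultimately have l1: "(\<lambda>n. q0 (G i y - (d i y + (\<Sum>j<n. d (Suc i + j) y)))) \<longlonglongrightarrow> 0" by (simp only:)
    have l2: "(\<lambda>n. q0 ((d i y + G (Suc i) y) - (d i y + (\<Sum>j<n. d (Suc i + j) y)))) \<longlonglongrightarrow> 0"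
      unfolding add_diff_cancel_left by (rule GF(3)[OF y'])
    have "eventually (\<lambda>n. d i y + (\<Sum>j<n. d (Suc i + j) y) \<in> F0) sequentially" unfolding sh[symmetric] by (intro always_eventually allI sF)
    then have "G i y = d i y + G (Suc i) y"
      by (rule norm_on_limit_unique[OF NF0 trivial_limit_sequentially GF(1)[OF y] cvs.subspace_add[OF sF0 di GF(1)[OF y']] _ l1 l2])
    then show ?thesis unfolding A_def d_def by simp
  qed
  have AA: "A j y = A i y" if "i \<le> j" "y \<in> ?S i" for i j y
    using that(1)
  proof (induction j rule: dec_induct)
    case (step j)
    then show ?case using AS[of y j] Smono[of i j] that(2) by auto
  qed simp
  define U where "U y = A (LEAST i. y \<in> ?S i) y" for y
  have UA: "U y = A i y" if "y \<in> ?S i" for i y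
    unfolding U_def using AA[of "LEAST i. y \<in> ?S i" i] LeastI[of "\<lambda>i. y \<in> ?S i", OF that] Least_le[of "\<lambda>i. y \<in> ?S i", OF that] by simp
  have Alin: "linear_on (?S i) (A i)" for i unfolding A_def by (intro linear_on_add G(1) Tlin) simp
  have inS: "\<exists>i. y \<in> ?S i" if y: "y \<in> topspace Y" for y
  proof -
    obtain n where "y \<in> SY n" using y unfolding exhaustionD(2)[OF specY] by blast
    then show ?thesis using exhaustion_mono[OF specY \<sigma>ge[of n]] by blast
  qed
  have Ulin: "linear_on (topspace Y) U"
    unfolding linear_on_def
  proof (intro conjI ballI allI)
    fix x y assume "x \<in> topspace Y" "y \<in> topspace Y"
    then obtain i j where "x \<in> ?S i" "y \<in> ?S j" using inS by metis
    then have m: "x \<in> ?S (max i j)" "y \<in> ?S (max i j)" using Smono[of i "max i j"] Smono[of j "max i j"] by auto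
    show "U (x + y) = U x + U y"
      using UA[OF cvs.subspace_add[OF sY m]] UA[OF m(1)] UA[OF m(2)] linear_onD(1)[OF Alin m] by simp
  next
    fix a x assume "x \<in> topspace Y"
    then obtain i where m: "x \<in> ?S i" using inS by metis
    show "U (a *\<^sub>C x) = a *\<^sub>C U x"
      using UA[OF cvs.subspace_scale[OF sY m]] UA[OF m] linear_onD(2)[OF Alin m] by simp
  qed
  \<comment> \<open>Level n of \<open>Y\<close> lies in the n-th level of the subsequence, where U =
    T n + G n; a piece containing the ranges of both summands makes the restriction bounded.\<close>
  have Ucont: "continuous_map (norm_topology (SY n) (py n)) E U" for n
  proof -
    obtain F q where F: "banach_piece E F q" and TF: "bounded_op (?S (Suc n)) (?p (Suc n)) F q (T n)" using T(1)[of n] unfolding good_def by blast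
    obtain H s where H: "banach_piece E H s" and FH: "bounded_op F q H s (\<lambda>x. x)" and GH: "bounded_op F0 q0 H s (\<lambda>x. x)"
      using banach_piece_join[OF lcE E(2) F F0] by blast
    have "bounded_op (?S n) (?p n) F q (T n)"
      using bounded_op_compose[OF NY NY exhaustion_embedding[OF HY specY \<sigma>mono[of n "Suc n"]] TF] by simp
    then have 1: "bounded_op (?S n) (?p n) H s (T n)" using bounded_op_compose[OF NY banach_pieceD(4)[OF F] _ FH] by blast
    have "bounded_op (?S n) (?p n) F0 q0 (G n)" using GF by (intro bounded_opI[OF G(1), where C = "1 / (1 - 1 / 2)"]) auto
    then have 2: "bounded_op (?S n) (?p n) H s (G n)" using bounded_op_compose[OF NY NF0 _ GH] by blast
    have "bounded_op (?S n) (?p n) H s (A n)" unfolding A_def by (rule bounded_op_add[OF banach_pieceD(4)[OF H] 1 2])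
    then have "bounded_op (SY n) (py n) H s (A n)" using bounded_op_compose[OF NY NY exhaustion_embedding[OF HY specY \<sigma>ge]] by blast
    from continuous_map_compose[OF bounded_op_continuous[OF NY banach_pieceD(4)[OF H] this] banach_pieceD(2)[OF H]]
    have "continuous_map (norm_topology (SY n) (py n)) E (A n)" by (simp add: o_def)
    then show ?thesis
      by (rule continuous_map_eq) (use UA exhaustion_mono[OF specY \<sigma>ge[of n]] in auto)
  qed
  have "continuous_map Y E U"
    unfolding Y(3) using Ulin exhaustionD(2)[OF specY] by (intro Ind_continuous[OF Y(2) lcE _ Ucont]) simp
  then have "U \<in> clinear_maps Y E" unfolding clinear_maps_def using Ulin by blast
  moreover have "U x = R0 x" if x: "x \<in> K" for x
  proof -
    obtain i where xi: "x \<in> ?S i" using inS x unfolding K_def by blast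
    have TK: "T j x = R0 x" if "i \<le> j" for j
      using T(1)[of j] x xi Smono[of i "Suc j"] that unfolding good_def by auto
    \<comment> \<open>On \<open>K\<close> all the operators agree with \<open>R0\<close>, so the
      corrections vanish there.\<close>
    have "d (i + j) x = 0" for j unfolding d_def using TK[of "i + j"] TK[of "Suc (i + j)"] by simp
    then have "q0 (G i x) = 0" using GF(3)[OF xi] by (simp add: LIMSEQ_const_iff)
    then have "G i x = 0" using norm_on_eq_0[OF NF0 GF(1)[OF xi]] by blast
    then show ?thesis using UA[OF xi] TK[of i] unfolding A_def by simp
  qed
  ultimately show ?thesis by blast
qed

lemma extension_from_local:
  assumes F0: "banach_piece E F0 q0" and AP: "approx_property E S p F0 q0"
    and ext: "\<And>R0. linear_on K R0 \<Longrightarrow> (\<And>n. \<exists>F q. banach_piece E F q \<and> bounded_op (K \<inter> SY n) (py n) F q R0) \<Longrightarrow> locally_extendable R0"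
    and R: "R \<in> clinear_maps X E"
  shows "\<exists>T\<in>clinear_maps Y E. \<forall>x\<in>topspace X. T (\<iota> x) = R x"
proof (rule transported_map[OF R])
  fix R0 assume R0: "linear_on K R0" "\<And>x. x \<in> topspace X \<Longrightarrow> R0 (\<iota> x) = R x"
    "\<And>n. \<exists>F q. banach_piece E F q \<and> bounded_op (K \<inter> SY n) (py n) F q R0"
  obtain U where U: "U \<in> clinear_maps Y E" "\<forall>x\<in>K. U x = R0 x"
    using mittag_leffler[OF F0 AP ext[OF R0(1,3)]] by blast
  have "U (\<iota> x) = R x" if "x \<in> topspace X" for x using U(2) R0(2)[OF that] imageI[OF that, of \<iota>] unfolding \<iota>K by simp
  then show ?thesis using U(1) by blast
qed

section \<open>Extensions on a single level in the four cases\<close>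

lemma locally_extendable_linf:
  assumes G: "exhaustion E G g" and B: "linf_coords I b G g c d"
    and R0: "\<And>n. \<exists>F q. banach_piece E F q \<and> bounded_op (K \<inter> SY n) (py n) F q R0"
  shows "locally_extendable R0"
  unfolding locally_extendable_def
proof
  fix n
  obtain F q where F: "banach_piece E F q" "bounded_op (K \<inter> SY n) (py n) F q R0" using R0 by blast
  obtain j where "bounded_op F q (G j) (g j) (\<lambda>x. x)"
    by (rule exhaustion_factor[OF HE G banach_pieceD(1)[OF F(1)] linear_on_id banach_pieceD(2)[OF F(1)]])
  from linf_extension[OF B exhaustionD(3)[OF G] exhaustionD(3)[OF specY] _ subKn bounded_op_compose[OF normKn banach_pieceD(4)[OF F(1)] F(2) this]]
  obtain T where "bounded_op (SY n) (py n) (G j) (g j) T" "\<forall>x\<in>K \<inter> SY n. T x = R0 x" by blast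
  then show "\<exists>F q T. banach_piece E F q \<and> bounded_op (SY n) (py n) F q T \<and> (\<forall>x\<in>K \<inter> SY n. T x = R0 x)" using exhaustionD(1)[OF G] by blast
qed

lemma locally_extendable_range_nuclear:
  assumes G: "exhaustion E G g" and nuc: "\<And>n. nuclear_on (G n) (g n) (G (Suc n)) (g (Suc n)) (\<lambda>x. x)"
    and R0: "\<And>n. \<exists>F q. banach_piece E F q \<and> bounded_op (K \<inter> SY n) (py n) F q R0"
  shows "locally_extendable R0"
  unfolding locally_extendable_def
proof
  fix n
  obtain F q where F: "banach_piece E F q" "bounded_op (K \<inter> SY n) (py n) F q R0" using R0 by blast
  obtain j where "bounded_op F q (G j) (g j) (\<lambda>x. x)"
    by (rule exhaustion_factor[OF HE G banach_pieceD(1)[OF F(1)] linear_on_id banach_pieceD(2)[OF F(1)]])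
  from bounded_op_compose[OF normKn banach_pieceD(4)[OF F(1)] F(2) this]
  have "nuclear_op (K \<inter> SY n) (py n) (G (Suc j)) (g (Suc j)) R0"
    using nuclear_op_compose_right[OF exhaustionD(3)[OF G] normKn nuclear_on_nuclear_op[OF exhaustionD(3)[OF G] exhaustionD(3)[OF G] nuc]] by blast
  from nuclear_op_extension[OF exhaustionD(3)[OF specY] _ subKn exhaustionD(4)[OF G] this]
  obtain T where "bounded_op (SY n) (py n) (G (Suc j)) (g (Suc j)) T" "\<forall>x\<in>K \<inter> SY n. T x = R0 x" by blast
  then show "\<exists>F q T. banach_piece E F q \<and> bounded_op (SY n) (py n) F q T \<and> (\<forall>x\<in>K \<inter> SY n. T x = R0 x)" using exhaustionD(1)[OF G] by blast
qed

text \<open>A bounded right inverse \<open>L\<close> of \<open>Q\<close> gives the local projection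
  y - L(Q y) onto \<open>K\<close>. It leads into the possibly higher level \<open>?M\<close>, on
  which \<open>R0\<close> is bounded as well, so \<open>R0\<close> composed with the projection is
  the extension.\<close>

lemma locally_extendable_lifting:
  assumes lifting: "\<And>l. \<exists>m L. bounded_op (S l) (p l) (SY m) (py m) L \<and> (\<forall>z\<in>S l. Q (L z) = z)"
    and lin: "linear_on K R0" and R0: "\<And>n. \<exists>F q. banach_piece E F q \<and> bounded_op (K \<inter> SY n) (py n) F q R0"
  shows "locally_extendable R0"
  unfolding locally_extendable_def
proof
  fix n
  note NY = exhaustionD(3)[OF specY]
  obtain l where l: "bounded_op (SY n) (py n) (S l) (p l) Q" by (rule Q_level)
  obtain m L where L: "bounded_op (S l) (p l) (SY m) (py m) L" "\<forall>z\<in>S l. Q (L z) = z" using lifting by blast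
  let ?M = "max m n"
  have LQ: "bounded_op (SY n) (py n) (SY ?M) (py ?M) (\<lambda>y. L (Q y))"
    using bounded_op_compose[OF NY NY bounded_op_compose[OF NY exhaustionD(3)[OF Z(2)] l L(1)] exhaustion_embedding[OF HY specY max.cobounded1]] .
  define P where "P y = y - L (Q y)" for y
  have PM: "bounded_op (SY n) (py n) (SY ?M) (py ?M) P"
    unfolding P_def by (rule bounded_op_diff[OF NY exhaustion_embedding[OF HY specY max.cobounded2] LQ])
  have PK: "P y \<in> K \<inter> SY ?M" if y: "y \<in> SY n" for y
  proof -
    have t: "y \<in> topspace Y" "L (Q y) \<in> topspace Y" using y bounded_op_mem[OF LQ y] exhaustionD(6)[OF specY] by blast+
    have "Q (P y) = 0" unfolding P_def using linear_on_diff[OF Q(1) subY t] L(2) bounded_op_mem[OF l y] by simp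
    then show ?thesis unfolding K_def using bounded_op_mem[OF PM y] exhaustionD(6)[OF specY] by blast
  qed
  have PK': "bounded_op (SY n) (py n) (K \<inter> SY ?M) (py ?M) P" using PM PK unfolding bounded_op_def by blast
  obtain F q where F: "banach_piece E F q" "bounded_op (K \<inter> SY ?M) (py ?M) F q R0" using R0 by blast
  have "bounded_op (SY n) (py n) F q (\<lambda>y. R0 (P y))" by (rule bounded_op_compose[OF NY normKn PK' F(2)])
  moreover have "R0 (P x) = R0 x" if "x \<in> K \<inter> SY n" for x
    using that linear_on_0[OF bounded_op_linear[OF L(1)] exhaustionD(5)[OF Z(2)]] unfolding P_def K_def by simp
  ultimately show "\<exists>F q T. banach_piece E F q \<and> bounded_op (SY n) (py n) F q T \<and> (\<forall>x\<in>K \<inter> SY n. T x = R0 x)" using F(1) by blast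
qed

text \<open>Vectors of \<open>S (Suc l)\<close> are lifted, so that the nuclear inclusion of
  \<open>S l\<close> into it can be used. \<open>k\<close> is a level of \<open>Z\<close> receiving
  both \<open>Q\<close> and that space.\<close>

lemma lifting_nuclear:
  assumes nuc: "\<And>n. nuclear_on (S n) (p n) (S (Suc n)) (p (Suc n)) (\<lambda>x. x)"
  shows "\<exists>m L. bounded_op (S l) (p l) (SY m) (py m) L \<and> (\<forall>z\<in>S l. Q (L z) = z)"
proof (rule lift_level[of 0 "Suc l"])
  fix m C assume C: "C > 0" and lift: "\<And>z. z \<in> S (Suc l) \<Longrightarrow> \<exists>y\<in>SY m. Q y = z \<and> py m y \<le> C * p (Suc l) z"
  note NS = exhaustionD(3)[OF Z(2)]
  obtain k where k: "k \<ge> Suc l" "bounded_op (SY m) (py m) (S k) (p k) Q" by (rule Q_level)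
  show ?thesis
    using nuclear_lifting[OF NS NS nuclear_on_nuclear_op[OF NS NS nuc] exhaustionD(4)[OF specY] NS k(2) exhaustion_embedding[OF HZ Z(2) k(1)] lift C]
    by blast
qed

lemma lifting_l1:
  assumes B: "l1_basis I a S p c u"
  shows "\<exists>m L. bounded_op (S l) (p l) (SY m) (py m) L \<and> (\<forall>z\<in>S l. Q (L z) = z)"
proof (rule lift_level[of 0 l])
  fix m C assume C: "C > 0" and lift: "\<And>z. z \<in> S l \<Longrightarrow> \<exists>y\<in>SY m. Q y = z \<and> py m y \<le> C * p l z"
  note NS = exhaustionD(3)[OF Z(2)]
  obtain k where k: "k \<ge> l" "bounded_op (SY m) (py m) (S k) (p k) Q" by (rule Q_level)
  show ?thesis
    using l1_lifting[OF B NS exhaustionD(4)[OF specY] NS k(2) exhaustion_embedding[OF HZ Z(2) k(1)] lift] by blast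
qed

end

theorem theorem4p5:
  fixes E :: "'e::complex_vector topology" and Z :: "'z::complex_vector topology"
  assumes "lcHs E" and "locally_complete E" and "\<exists>B. fundamental_bounded E B"
    and "LB_space Z"
    and "(\<exists>(I :: 'i set) a. weight_matrix I a \<and> lc_isomorphic E (k_inf I a))
       \<or> LN_space E
       \<or> (\<exists>(J :: 'j set) a. weight_matrix J a \<and> lc_isomorphic Z (k_one J a))
       \<or> LN_space Z"
    and "condition_A E" and "condition_DOmega Z"
  shows "weakly_acyclic TYPE('x::complex_vector) TYPE('y::complex_vector) E Z"
  unfolding weakly_acyclic_def
proof (intro allI impI ballI)
  fix X :: "'x topology" and Y :: "'y topology" and \<iota> Q R
  assume a: "LB_space X \<and> LB_space Y \<and> LB_space Z \<and> exact_seq X \<iota> Y Q Z" and R: "R \<in> clinear_maps X E"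
  have E: "locally_convex E" "Hausdorff_space E" "cvs.subspace (topspace E)"
    using assms(1) unfolding lcHs_def locally_convex_def by blast+
  have Z: "lcHs Z" "Hausdorff_space Z" "cvs.subspace (topspace Z)"
    using assms(4) unfolding LB_space_def lcHs_def locally_convex_def by blast+
  obtain SX px where X: "exhaustion X SX px" using a banach_spectrum_exhaustion unfolding LB_space_def by blast
  obtain SY py where Y: "lcHs Y" "banach_spectrum SY py" "Y = Ind SY py" using a unfolding LB_space_def by blast
  obtain SZ pZ where SZ: "exhaustion Z SZ pZ" using assms(4) banach_spectrum_exhaustion unfolding LB_space_def by blast
  obtain F0 q0 where A: "condA_piece E F0 q0" by (rule condition_A_piece[OF E(1) assms(2,6)])
  have F0: "banach_piece E F0 q0" using A unfolding condA_piece_def by blast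
  \<comment> \<open>The exhaustion of \<open>Z\<close> is left open: (c) and (d) supply their own,
    to which (D\<Omega>) is then transferred.\<close>
  have loc: "exact_LB E X Y Z \<iota> Q SX px SY py S p" if "exhaustion Z S p" for S p
    using assms(1,2) X Y Z(1) that a by (intro exact_LB.intro) blast+
  note DO = condition_DOmega_transfer[OF Z(2) assms(7)]
  show "\<exists>T\<in>clinear_maps Y E. \<forall>x\<in>topspace X. T (\<iota> x) = R x"
    using assms(5)
  proof (elim disjE exE conjE)
    fix I :: "'i set" and b assume "weight_matrix I b" "lc_isomorphic E (k_inf I b)"
    then obtain G g c d where G: "exhaustion E G g" "linf_coords I b G g c d" by (rule isomorphic_k_inf_coords[OF E(3)])
    \<comment> \<open>In this case the piece coming from (A) is exchanged for a level of the
      exhaustion of \<open>E\<close>.\<close>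
    obtain F1 q1 where F1: "banach_piece E F1 q1" "approx_property E SZ pZ F1 q1"
      using approx_property_linf[OF E(2) A SZ DO[OF SZ] G] by blast
    show ?thesis
      by (rule exact_LB.extension_from_local[OF loc[OF SZ] F1 exact_LB.locally_extendable_linf[OF loc[OF SZ] G] R])
  next
    assume "LN_space E"
    then obtain G g where "banach_spectrum G g" "E = Ind G g"
      and nuc: "\<And>n. nuclear_on (G n) (g n) (G (Suc n)) (g (Suc n)) (\<lambda>x. x)" unfolding LN_space_def by blast
    then have G: "exhaustion E G g" using banach_spectrum_exhaustion by blast
    show ?thesis
      by (rule exact_LB.extension_from_local[OF loc[OF SZ] F0 approx_property_range_nuclear[OF E(2) A SZ DO[OF SZ] G nuc]
          exact_LB.locally_extendable_range_nuclear[OF loc[OF SZ] G nuc] R])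
  next
    fix J :: "'j set" and b assume "weight_matrix J b" "lc_isomorphic Z (k_one J b)"
    then obtain S p c u where S: "exhaustion Z S p" and B: "l1_basis J b S p c u" by (rule isomorphic_k_one_basis[OF Z(3)])
    show ?thesis
      by (rule exact_LB.extension_from_local[OF loc[OF S] F0 approx_property_l1[OF A S DO[OF S] B]
          exact_LB.locally_extendable_lifting[OF loc[OF S] exact_LB.lifting_l1[OF loc[OF S] B]] R])
  next
    assume "LN_space Z"
    then obtain S p where "banach_spectrum S p" "Z = Ind S p"
      and nuc: "\<And>n. nuclear_on (S n) (p n) (S (Suc n)) (p (Suc n)) (\<lambda>x. x)" unfolding LN_space_def by blast
    then have S: "exhaustion Z S p" using banach_spectrum_exhaustion by blast
    show ?thesis
      by (rule exact_LB.extension_from_local[OF loc[OF S] F0 approx_property_domain_nuclear[OF A S DO[OF S] nuc]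
          exact_LB.locally_extendable_lifting[OF loc[OF S] exact_LB.lifting_nuclear[OF loc[OF S] nuc]] R])
  qed
qed

end
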